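(* Let $L_1[0,1]$ carry its usual norm $\|\cdot\|_1$, and let $Y$ be a non-reflexive subspace of $L_1[0,1]$. Then $Y$ fails the fixed point property for closed, bounded, convex sets in $Y$ and nonexpansive (or contractive) mappings on them: there exist a non-empty, closed, bounded, convex set $C \subseteq Y$ and a nonexpansive mapping $T : C \to C$ that has no fixed point, and likewise there exist a non-empty, closed, bounded, convex set $C\subseteq Y$ and a contraction $T : C \to C$ that has no fixed point.
   Context: $L_1[0,1]$ is the Banach space of (equivalence classes modulo a.e. equality of) Lebesgue integrable scalar functions on $[0,1]$ with norm $\|f\|_1=\int_0^1|f|$. "Subspace" means closed linear subspace. For a subset $C$ of a Banach space $(X,\|\cdot\|_X)$, a map $T:C\to C$ is nonexpansive if $\|Tx-Ty\|_X\le\|x-y\|_X$ for all $x,y\in C$; it is a contraction (contractive) if $\|Tx-Ty\|_X<\|x-y\|_X$ for all $x,y\in C$ with $x\ne y$ (strict inequality only, no uniform constant). *)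

theory Defs
  imports "HOL-Analysis.Analysis"
begin

text \<open>
  The scalars are a type of sort \<open>{real_normed_field, euclidean_space}\<close>. Both \<open>real\<close> and
  \<open>complex\<close> are of this sort, and by the theorem of Frobenius every type of this sort is
  isometrically isomorphic, as a real normed algebra, to one of these two.

  Representatives of elements of \<open>L\<^sub>1[0,1]\<close> are functions on the whole real line, of which
  only the values on the unit interval matter, since the measure lives on that interval.
\<close>

abbreviation leb01 :: "real measure"
  where "leb01 \<equiv> lebesgue_on {0..1}"

definition l1_rel ::
    "(real \<Rightarrow> 'k::{real_normed_field, euclidean_space}) \<Rightarrow> (real \<Rightarrow> 'k) \<Rightarrow> bool"
  where "l1_rel f g \<longleftrightarrow> integrable leb01 f \<and> integrable leb01 g \<and> (AE x in leb01. f x = g x)"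

lemma part_equivp_l1_rel: "part_equivp l1_rel"
proof (rule part_equivpI)
  show "\<exists>f. l1_rel f (f :: real \<Rightarrow> 'k::{real_normed_field, euclidean_space})"
    by (rule exI[of _ "\<lambda>_. 0"]) (simp add: l1_rel_def)
  show "symp (l1_rel :: (real \<Rightarrow> 'k::{real_normed_field, euclidean_space}) \<Rightarrow> _)"
    by (rule sympI) (auto simp: l1_rel_def elim: eventually_mono)
  show "transp (l1_rel :: (real \<Rightarrow> 'k::{real_normed_field, euclidean_space}) \<Rightarrow> _)"
  proof (rule transpI)
    fix f g h :: "real \<Rightarrow> 'k" assume "l1_rel f g" "l1_rel g h"
    then show "l1_rel f h"
      unfolding l1_rel_def by (auto elim: eventually_elim2)
  qed
qed

quotient_type (overloaded) 'k l1 =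
    "real \<Rightarrow> 'k::{real_normed_field, euclidean_space}" / partial: l1_rel
  by (rule part_equivp_l1_rel)

lift_definition scale_l1 :: "'k \<Rightarrow> 'k l1 \<Rightarrow> 'k::{real_normed_field, euclidean_space} l1"
  is "\<lambda>c f x. c * f x"
  by (auto simp: l1_rel_def elim: eventually_mono)

instantiation l1 :: ("{real_normed_field, euclidean_space}") real_normed_vector
begin

lift_definition zero_l1 :: "'a l1" is "\<lambda>_. 0"
  by (simp add: l1_rel_def)

lift_definition plus_l1 :: "'a l1 \<Rightarrow> 'a l1 \<Rightarrow> 'a l1" is "\<lambda>f g x. f x + g x"
  by (auto simp: l1_rel_def elim: eventually_elim2)

lift_definition minus_l1 :: "'a l1 \<Rightarrow> 'a l1 \<Rightarrow> 'a l1" is "\<lambda>f g x. f x - g x"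
  by (auto simp: l1_rel_def elim: eventually_elim2)

lift_definition uminus_l1 :: "'a l1 \<Rightarrow> 'a l1" is "\<lambda>f x. - f x"
  by (auto simp: l1_rel_def elim: eventually_mono)

lift_definition scaleR_l1 :: "real \<Rightarrow> 'a l1 \<Rightarrow> 'a l1" is "\<lambda>r f x. r *\<^sub>R f x"
  by (auto simp: l1_rel_def elim: eventually_mono)

lift_definition norm_l1 :: "'a l1 \<Rightarrow> real" is "\<lambda>f. \<integral>x. norm (f x) \<partial>leb01"
  by (auto simp: l1_rel_def intro!: integral_cong_AE elim: eventually_mono)

definition dist_l1 :: "'a l1 \<Rightarrow> 'a l1 \<Rightarrow> real"
  where "dist_l1 f g = norm (f - g)"

definition sgn_l1 :: "'a l1 \<Rightarrow> 'a l1"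
  where "sgn_l1 f = inverse (norm f) *\<^sub>R f"

definition uniformity_l1 :: "('a l1 \<times> 'a l1) filter"
  where "uniformity_l1 = (INF e\<in>{0<..}. principal {(f, g). dist f g < e})"

definition open_l1 :: "'a l1 set \<Rightarrow> bool"
  where "open_l1 U \<longleftrightarrow> (\<forall>f\<in>U. \<forall>\<^sub>F (f', g) in uniformity. f' = f \<longrightarrow> g \<in> U)"

instance
proof
  fix f g h :: "'a l1" and a b :: real
  show "f + g + h = f + (g + h)"
    by transfer (simp add: l1_rel_def add.assoc)
  show "f + g = g + f"
    by transfer (simp add: l1_rel_def add.commute)
  show "0 + f = f"
    by transfer (simp add: l1_rel_def)
  show "- f + f = 0"
    by transfer (simp add: l1_rel_def)
  show "f - g = f + - g"
    by transfer (simp add: l1_rel_def)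
  show "a *\<^sub>R (f + g) = a *\<^sub>R f + a *\<^sub>R g"
    by transfer (simp add: l1_rel_def scaleR_add_right)
  show "(a + b) *\<^sub>R f = a *\<^sub>R f + b *\<^sub>R f"
    by transfer (simp add: l1_rel_def scaleR_add_left)
  show "a *\<^sub>R b *\<^sub>R f = (a * b) *\<^sub>R f"
    by transfer (simp add: l1_rel_def)
  show "1 *\<^sub>R f = f"
    by transfer (simp add: l1_rel_def)
  show "norm f = 0 \<longleftrightarrow> f = 0"
    by transfer (simp add: l1_rel_def integral_nonneg_eq_0_iff_AE)
  show "norm (f + g) \<le> norm f + norm g"
  proof transfer
    fix f g :: "real \<Rightarrow> 'a" assume "l1_rel f f" "l1_rel g g"
    then have f: "integrable leb01 f" and g: "integrable leb01 g"
      by (auto simp: l1_rel_def)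
    have "(\<integral>x. norm (f x + g x) \<partial>leb01) \<le> (\<integral>x. norm (f x) + norm (g x) \<partial>leb01)"
      using f g by (intro integral_mono) (auto intro: norm_triangle_ineq)
    also have "\<dots> = (\<integral>x. norm (f x) \<partial>leb01) + (\<integral>x. norm (g x) \<partial>leb01)"
      using f g by simp
    finally show "(\<integral>x. norm (f x + g x) \<partial>leb01)
        \<le> (\<integral>x. norm (f x) \<partial>leb01) + (\<integral>x. norm (g x) \<partial>leb01)" .
  qed
  show "norm (a *\<^sub>R f) = \<bar>a\<bar> * norm f"
    by transfer simp
qed (fact dist_l1_def sgn_l1_def uniformity_l1_def open_l1_def)+

end

interpretation l1: vector_space
  "scale_l1 :: 'k \<Rightarrow> 'k l1 \<Rightarrow> 'k::{real_normed_field, euclidean_space} l1"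
proof
  fix a b :: 'k and f g :: "'k l1"
  show "scale_l1 a (f + g) = scale_l1 a f + scale_l1 a g"
    by transfer (simp add: l1_rel_def distrib_left)
  show "scale_l1 (a + b) f = scale_l1 a f + scale_l1 b f"
    by transfer (simp add: l1_rel_def distrib_right)
  show "scale_l1 a (scale_l1 b f) = scale_l1 (a * b) f"
    by transfer (simp add: l1_rel_def mult.assoc)
  show "scale_l1 1 f = f"
    by transfer (simp add: l1_rel_def)
qed

lemma norm_scale_l1: "norm (scale_l1 c f) = norm c * norm f"
  by transfer (simp add: norm_mult)

lemma scaleR_l1_eq_scale_l1: "r *\<^sub>R f = scale_l1 (of_real r) f"
  by transfer (simp add: l1_rel_def scaleR_conv_of_real)

text \<open>
  The library's type of bounded linear maps covers only functionals on a whole type and only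
  real linearity. Here a normed space is given by its carrier \<open>V\<close>, addition, scalar
  multiplication and norm. A functional on \<open>V\<close> is normalised to be zero off \<open>V\<close>, so that
  functionals are determined by their restrictions to \<open>V\<close> and pointwise sums and multiples
  of functionals are again functionals.
\<close>

definition dual_carrier ::
    "('v \<Rightarrow> 'v \<Rightarrow> 'v) \<Rightarrow> ('k::real_normed_field \<Rightarrow> 'v \<Rightarrow> 'v) \<Rightarrow> ('v \<Rightarrow> real) \<Rightarrow> 'v set \<Rightarrow> ('v \<Rightarrow> 'k) set"
  where "dual_carrier add smul nrm V =
    {\<phi>. (\<forall>x\<in>V. \<forall>y\<in>V. \<phi> (add x y) = \<phi> x + \<phi> y) \<and>
        (\<forall>c. \<forall>x\<in>V. \<phi> (smul c x) = c * \<phi> x) \<and>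
        (\<exists>B. \<forall>x\<in>V. norm (\<phi> x) \<le> B * nrm x) \<and>
        (\<forall>x. x \<notin> V \<longrightarrow> \<phi> x = 0)}"

definition dual_norm :: "('v \<Rightarrow> real) \<Rightarrow> 'v set \<Rightarrow> ('v \<Rightarrow> 'k::real_normed_field) \<Rightarrow> real"
  where "dual_norm nrm V \<phi> = (SUP x\<in>{x \<in> V. nrm x \<le> 1}. norm (\<phi> x))"

definition l1_dual :: "'k::{real_normed_field, euclidean_space} l1 set \<Rightarrow> ('k l1 \<Rightarrow> 'k) set"
  where "l1_dual Y = dual_carrier (+) scale_l1 norm Y"

definition l1_bidual ::
    "'k::{real_normed_field, euclidean_space} l1 set \<Rightarrow> (('k l1 \<Rightarrow> 'k) \<Rightarrow> 'k) set"
  where "l1_bidual Y =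
    dual_carrier (\<lambda>\<phi> \<psi> x. \<phi> x + \<psi> x) (\<lambda>c \<phi> x. c * \<phi> x) (dual_norm norm Y) (l1_dual Y)"

text \<open>Surjectivity of the canonical embedding of \<open>Y\<close> into its bidual.\<close>

definition reflexive_l1 :: "'k::{real_normed_field, euclidean_space} l1 set \<Rightarrow> bool"
  where "reflexive_l1 Y \<longleftrightarrow> (\<forall>\<Psi>\<in>l1_bidual Y. \<exists>x\<in>Y. \<forall>\<phi>\<in>l1_dual Y. \<Psi> \<phi> = \<phi> x)"

definition nonexpansive_on :: "'v::real_normed_vector set \<Rightarrow> ('v \<Rightarrow> 'v) \<Rightarrow> bool"
  where "nonexpansive_on C T \<longleftrightarrow> (\<forall>x\<in>C. \<forall>y\<in>C. norm (T x - T y) \<le> norm (x - y))"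

definition contractive_on :: "'v::real_normed_vector set \<Rightarrow> ('v \<Rightarrow> 'v) \<Rightarrow> bool"
  where "contractive_on C T \<longleftrightarrow> (\<forall>x\<in>C. \<forall>y\<in>C. x \<noteq> y \<longrightarrow> norm (T x - T y) < norm (x - y))"

end

(*
  If the unit ball of Y is uniformly integrable, then Y is reflexive: a bidual functional Psi of Y
  gives the set function A |-> Psi (f |-> integral of f over A), which is additive and absolutely
  continuous, hence has a density h; by Hahn-Banach and the representation of functionals on L_1 by
  bounded functions, h lies in Y and represents Psi.

  If it is not, then for a fixed mass delta > 0 there are f_n in the ball of Y carrying almost delta
  on almost disjoint sets of small measure, and the remainders are, up to a small error, bounded by
  a constant. Averages of the f_n with suitable signs make the remainders cancel in L_2 while the
  concentrated parts add up, so after normalisation Y contains unit vectors concentrated on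
  arbitrarily small sets. A gliding hump extracts from these an asymptotically isometric copy of the
  unit vector basis of l_1. With suitable weights, the shift on the closed convex hull of the basis
  vectors is a contraction without fixed point, and it serves for both claims.
*)
theory Submission imports Defs begin

section \<open>The Hahn-Banach theorem\<close>

text \<open>An arbitrary copy of l_1 would not do: the shift is contractive only if the lower l_1
  estimate loses less at each index than the weights drop from that index to the next. So the basis
  vectors must be concentrated up to errors \<open>e n\<close> prescribed in advance, and this is
  the real obstacle. Failure of uniform integrability gives only functions with some fixed mass on
  small sets, while the rest may carry most of the norm. Taking delta as the limit, for heights
  tending to infinity, of the largest mass that functions of the unit ball carry above a height is
  what controls the rest: above a large height there is almost nothing besides the mass delta, so
  the remainder is bounded up to a small error. Signs make these remainders cancel, whereas
  concentrated parts on almost disjoint sets cannot cancel; hence the averages keep a norm bounded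
  below in terms of delta and can be normalised within Y.

  On the side of reflexivity, the density of a bidual functional is at first just a function in L_1;
  that its class lies in Y uses that Y is closed.\<close>

lemma hahn_banach:
  fixes f :: "'a::real_normed_vector \<Rightarrow> real"
  assumes V: "subspace V"
    and add: "\<And>x y. x \<in> V \<Longrightarrow> y \<in> V \<Longrightarrow> f (x + y) = f x + f y"
    and scale: "\<And>c x. x \<in> V \<Longrightarrow> f (c *\<^sub>R x) = c * f x"
    and bound: "\<And>x. x \<in> V \<Longrightarrow> f x \<le> B * norm x"
    and B: "0 \<le> B"
  obtains F where "linear F" "\<And>x. F x \<le> B * norm x" "\<And>x. x \<in> V \<Longrightarrow> F x = f x"
proof -
  \<comment> \<open>Extensions are represented by their graphs, subspaces of
    \<open>'a \<times> real\<close> ordered by inclusion, so that Zorn's lemma applies to unions of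
    chains.\<close>
  define G0 where "G0 = (\<lambda>x. (x, f x)) ` V"
  define dom where "dom G \<longleftrightarrow> subspace G \<and> (\<forall>(x, r)\<in>G. r \<le> B * norm x)" for G :: "('a \<times> real) set"
  define \<A> where "\<A> = {G. dom G \<and> G0 \<subseteq> G}"
  have "f 0 = 0"
    using scale[of 0 0] V by (simp add: subspace_0)
  have "subspace G0"
    unfolding subspace_def G0_def
    using V add scale \<open>f 0 = 0\<close>
    by (auto simp: subspace_0 subspace_add subspace_scale image_iff zero_prod_def)
  then have G0: "G0 \<in> \<A>"
    using bound by (auto simp: \<A>_def dom_def G0_def)
  have "\<Union>\<C> \<in> \<A>" if "\<C> \<noteq> {}" and ch: "subset.chain \<A> \<C>" for \<C>
  proof -
    have sub: "\<And>G. G \<in> \<C> \<Longrightarrow> subspace G \<and> (\<forall>(x, r)\<in>G. r \<le> B * norm x) \<and> G0 \<subseteq> G"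
      using ch by (auto simp: subset.chain_def \<A>_def dom_def)
    have "subspace (\<Union>\<C>)"
      unfolding subspace_def
    proof (intro conjI ballI allI)
      show "0 \<in> \<Union>\<C>"
        using \<open>\<C> \<noteq> {}\<close> sub subspace_0 by blast
      fix x y assume "x \<in> \<Union>\<C>" "y \<in> \<Union>\<C>"
      then obtain G H where GH: "G \<in> \<C>" "x \<in> G" "H \<in> \<C>" "y \<in> H"
        by blast
      then have "G \<subseteq> H \<or> H \<subseteq> G"
        using ch by (auto simp: subset.chain_def)
      then obtain G where "G \<in> \<C>" "x \<in> G" "y \<in> G"
        using GH by blast
      then show "x + y \<in> \<Union>\<C>"
        using sub subspace_add by blast
    next
      fix c x assume "x \<in> \<Union>\<C>"
      then show "c *\<^sub>R x \<in> \<Union>\<C>"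
        using sub subspace_scale by blast
    qed
    moreover have "\<forall>(x, r)\<in>\<Union>\<C>. r \<le> B * norm x"
      using sub by blast
    moreover have "G0 \<subseteq> \<Union>\<C>"
      using sub \<open>\<C> \<noteq> {}\<close> by blast
    ultimately show ?thesis
      by (simp add: \<A>_def dom_def)
  qed
  then obtain M where M: "M \<in> \<A>" and max: "\<And>X. X \<in> \<A> \<Longrightarrow> M \<subseteq> X \<Longrightarrow> X = M"
    using subset_Zorn_nonempty[of \<A>] G0 by blast
  have sM: "subspace M" and dM: "\<And>x r. (x, r) \<in> M \<Longrightarrow> r \<le> B * norm x" and G0M: "G0 \<subseteq> M"
    using M by (auto simp: \<A>_def dom_def)
  \<comment> \<open>A graph in \<A> is automatically single-valued: two values over the same point
    differ by a value over 0, where the bound is 0.\<close>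
  have uniq: "r = s" if "(x, r) \<in> M" "(x, s) \<in> M" for x r s
    using dM[of 0 "r - s"] dM[of 0 "s - r"] subspace_diff[OF sM that] subspace_diff[OF sM that(2,1)]
    by simp
  have ex: "\<exists>r. (x, r) \<in> M" for x
  proof -
    \<comment> \<open>A value c at the new vector x must lie above all
      \<open>r - B * norm (y - x)\<close> and below all \<open>B * norm (y' + x) - r'\<close>. By
      \<open>key\<close> every lower bound is at most every upper bound, so the supremum of the
      lower ones serves.\<close>
    define S where "S = (\<lambda>(y, r). r - B * norm (y - x)) ` M"
    have "(0, 0) \<in> M"
      using subspace_0[OF sM] by (simp add: zero_prod_def)
    have key: "r - B * norm (y - x) \<le> B * norm (y' + x) - r'"
      if "(y, r) \<in> M" "(y', r') \<in> M" for y r y' r'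
    proof -
      have "r + r' \<le> B * norm (y + y')"
        using dM subspace_add[OF sM that] by simp
      also have "\<dots> \<le> B * (norm (y - x) + norm (y' + x))"
        using norm_triangle_ineq[of "y - x" "y' + x"] B by (intro mult_left_mono) auto
      finally show ?thesis
        by (simp add: algebra_simps)
    qed
    define c where "c = Sup S"
    have bdd: "bdd_above S"
      unfolding bdd_above_def S_def using key[OF _ \<open>(0, 0) \<in> M\<close>] by fastforce
    have c1: "r - B * norm (y - x) \<le> c" if "(y, r) \<in> M" for y r
      unfolding c_def using that bdd by (intro cSup_upper) (auto simp: S_def)
    have c2: "c \<le> B * norm (y + x) - r" if "(y, r) \<in> M" for y r
      unfolding c_def using that key \<open>(0, 0) \<in> M\<close> by (intro cSup_least) (auto simp: S_def)
    define G where "G = {(y + t *\<^sub>R x, r + t * c) |y r t. (y, r) \<in> M}"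
    have GI: "(y + t *\<^sub>R x, r + t * c) \<in> G" if "(y, r) \<in> M" for y r t
      using that by (auto simp: G_def)
    have "subspace G"
      unfolding subspace_def
    proof (intro conjI ballI allI)
      show "0 \<in> G"
        using GI[OF \<open>(0, 0) \<in> M\<close>, of 0] by (simp add: zero_prod_def)
      fix p q assume "p \<in> G" "q \<in> G"
      then obtain y r t y' r' t' where "(y, r) \<in> M" "(y', r') \<in> M"
        "p = (y + t *\<^sub>R x, r + t * c)" "q = (y' + t' *\<^sub>R x, r' + t' * c)"
        unfolding G_def by blast
      then show "p + q \<in> G"
        using GI[of "y + y'" "r + r'" "t + t'"] subspace_add[OF sM, of "(y, r)" "(y', r')"]
        by (simp add: algebra_simps)
    next
      fix a p assume "p \<in> G"
      then obtain y r t where "(y, r) \<in> M" "p = (y + t *\<^sub>R x, r + t * c)"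
        unfolding G_def by blast
      then show "a *\<^sub>R p \<in> G"
        using GI[of "a *\<^sub>R y" "a * r" "a * t"] subspace_scale[OF sM, of "(y, r)" a]
        by (simp add: algebra_simps)
    qed
    \<comment> \<open>Division by the modulus of t reduces the bound to \<open>c2\<close> for
      positive t and to \<open>c1\<close> for negative t.\<close>
    moreover have "r + t * c \<le> B * norm (y + t *\<^sub>R x)" if yr: "(y, r) \<in> M" for y r t
    proof (cases t "0::real" rule: linorder_cases)
      case equal
      then show ?thesis using dM[OF yr] by simp
    next
      case greater
      have "c \<le> B * norm ((1/t) *\<^sub>R y + x) - (1/t) * r"
        using c2 subspace_scale[OF sM yr, of "1/t"] by simp
      then have "t * c \<le> t * (B * norm ((1/t) *\<^sub>R y + x) - (1/t) * r)"
        using greater by (intro mult_left_mono) auto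
      also have "\<dots> = B * norm (t *\<^sub>R ((1/t) *\<^sub>R y + x)) - r"
        unfolding norm_scaleR using greater by (simp add: algebra_simps)
      also have "t *\<^sub>R ((1/t) *\<^sub>R y + x) = y + t *\<^sub>R x"
        using greater by (simp add: algebra_simps)
      finally show ?thesis by simp
    next
      case less
      define s where "s = - t"
      have s: "s > 0" using less by (simp add: s_def)
      have "(1/s) * r - B * norm ((1/s) *\<^sub>R y - x) \<le> c"
        using c1 subspace_scale[OF sM yr, of "1/s"] by simp
      then have "s * ((1/s) * r - B * norm ((1/s) *\<^sub>R y - x)) \<le> s * c"
        using s by (intro mult_left_mono) auto
      moreover have "s * ((1/s) * r - B * norm ((1/s) *\<^sub>R y - x)) = r - B * norm (s *\<^sub>R ((1/s) *\<^sub>R y - x))"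
        unfolding norm_scaleR using s by (simp add: algebra_simps)
      moreover have "s *\<^sub>R ((1/s) *\<^sub>R y - x) = y + t *\<^sub>R x"
        using s by (simp add: algebra_simps s_def)
      ultimately have "r - B * norm (y + t *\<^sub>R x) \<le> s * c"
        by (simp only:)
      then show ?thesis by (simp add: s_def)
    qed
    moreover have "M \<subseteq> G"
      using GI[of _ _ 0] by fastforce
    ultimately have "G = M"
      using G0M by (intro max) (auto simp: \<A>_def dom_def G_def)
    then show ?thesis
      using GI[OF \<open>(0, 0) \<in> M\<close>, of 1] by auto
  qed
  define F where "F x = (THE r. (x, r) \<in> M)" for x
  have F: "(x, F x) \<in> M" for x
    unfolding F_def by (rule theI') (use ex uniq in blast)
  have Feq: "F x = r" if "(x, r) \<in> M" for x r
    using uniq[OF F that] .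
  show thesis
  proof
    show "linear F"
    proof (rule linearI)
      show "F (x + y) = F x + F y" for x y
        using subspace_add[OF sM F[of x] F[of y]] by (intro Feq) simp
      show "F (c *\<^sub>R x) = c *\<^sub>R F x" for c x
        using subspace_scale[OF sM F[of x], of c] by (intro Feq) simp
    qed
    show "F x \<le> B * norm x" for x
      by (rule dM[OF F])
    show "F x = f x" if "x \<in> V" for x
      using that G0M by (intro Feq) (auto simp: G0_def)
  qed
qed

section \<open>Densities of additive set functions\<close>

text \<open>Absolute continuity makes the finitely additive \<nu> continuous along sequences
  decreasing to the empty set, hence countably additive; the density then comes from the
  Radon-Nikodym theorem.\<close>

lemma (in finite_measure) nonneg_additive_density:
  fixes \<nu> :: "'a set \<Rightarrow> real"
  assumes add: "\<And>A B. A \<in> sets M \<Longrightarrow> B \<in> sets M \<Longrightarrow> A \<inter> B = {} \<Longrightarrow> \<nu> (A \<union> B) = \<nu> A + \<nu> B"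
    and nonneg: "\<And>A. A \<in> sets M \<Longrightarrow> 0 \<le> \<nu> A"
    and ac: "\<And>e. e > 0 \<Longrightarrow> \<exists>d>0. \<forall>A\<in>sets M. measure M A < d \<longrightarrow> \<nu> A \<le> e"
  obtains h where "integrable M h" "\<And>A. A \<in> sets M \<Longrightarrow> \<nu> A = (\<integral>x. indicator A x * h x \<partial>M)"
proof -
  have \<nu>0: "\<nu> {} = 0"
    using add[of "{}" "{}"] by simp
  define N where "N = measure_of (space M) (sets M) (\<lambda>A. ennreal (\<nu> A))"
  have pos: "positive (sets M) (\<lambda>A. ennreal (\<nu> A))"
    by (simp add: positive_def \<nu>0)
  have "countably_additive (sets M) (\<lambda>A. ennreal (\<nu> A))"
  proof (rule sets.empty_continuous_imp_countably_additive[OF pos])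
    show "additive (sets M) (\<lambda>A. ennreal (\<nu> A))"
      by (simp add: additive_def add nonneg)
    show "\<forall>A\<in>sets M. ennreal (\<nu> A) \<noteq> \<infinity>"
      by simp
    fix A :: "nat \<Rightarrow> 'a set"
    assume A: "range A \<subseteq> sets M" "decseq A" "(\<Inter>i. A i) = {}"
    have m: "(\<lambda>i. measure M (A i)) \<longlonglongrightarrow> 0"
      using finite_Lim_measure_decseq[OF A(1,2)] A(3) by simp
    have "(\<lambda>i. \<nu> (A i)) \<longlonglongrightarrow> 0"
    proof (rule LIMSEQ_I)
      fix e :: real assume "e > 0"
      then obtain d where d: "d > 0" "\<And>A. A \<in> sets M \<Longrightarrow> measure M A < d \<Longrightarrow> \<nu> A \<le> e/2"
        using ac[of "e/2"] by auto
      obtain n0 where n0: "\<And>n. n \<ge> n0 \<Longrightarrow> measure M (A n) < d"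
        using LIMSEQ_D[OF m d(1)] by auto
      have "norm (\<nu> (A n) - 0) < e" if "n \<ge> n0" for n
        using d(2)[OF _ n0[OF that]] nonneg[of "A n"] A(1) \<open>e > 0\<close> by force
      then show "\<exists>n0. \<forall>n\<ge>n0. norm (\<nu> (A n) - 0) < e" by blast
    qed
    then show "(\<lambda>i. ennreal (\<nu> (A i))) \<longlonglongrightarrow> 0"
      by (metis ennreal_0 tendsto_ennrealI)
  qed
  then have emN: "emeasure N A = ennreal (\<nu> A)" if "A \<in> sets M" for A
    using that pos unfolding N_def
    by (intro emeasure_measure_of_sigma) (auto simp: sets.sigma_algebra_axioms)
  have setsN: "sets N = sets M"
    by (simp add: N_def)
  have "absolutely_continuous M N"
    unfolding absolutely_continuous_def
  proof
    fix A assume A: "A \<in> null_sets M"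
    then have "\<nu> A \<le> e" if "e > 0" for e
      using ac[OF that] A by (auto simp: null_sets_def measure_def)
    then have "\<nu> A \<le> 0"
      by (metis field_le_epsilon add_0)
    then show "A \<in> null_sets N"
      using A by (auto simp: null_sets_def emN setsN ennreal_neg)
  qed
  then obtain f where f[measurable]: "f \<in> borel_measurable M" and dens: "density M f = N"
    using Radon_Nikodym[OF _ setsN] by blast
  have fN: "(\<integral>\<^sup>+x. f x * indicator A x \<partial>M) = ennreal (\<nu> A)" if "A \<in> sets M" for A
    using that emN[OF that] by (simp add: dens[symmetric] emeasure_density)
  have "(\<integral>\<^sup>+x. f x \<partial>M) = (\<integral>\<^sup>+x. f x * indicator (space M) x \<partial>M)"
    by (intro nn_integral_cong) simp
  also have "\<dots> = ennreal (\<nu> (space M))"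
    by (rule fN) simp
  finally have "(\<integral>\<^sup>+x. f x \<partial>M) \<noteq> \<infinity>"
    by simp
  then have fin: "AE x in M. f x \<noteq> \<infinity>"
    by (intro nn_integral_PInf_AE) auto
  have hA: "has_bochner_integral M (\<lambda>x. indicator A x * enn2real (f x)) (\<nu> A)" if A[measurable]: "A \<in> sets M" for A
  proof (rule has_bochner_integral_nn_integral)
    have "(\<integral>\<^sup>+x. ennreal (indicator A x * enn2real (f x)) \<partial>M) = (\<integral>\<^sup>+x. f x * indicator A x \<partial>M)"
      using fin by (intro nn_integral_cong_AE)
        (auto elim!: eventually_mono split: split_indicator simp: ennreal_enn2real less_top)
    then show "(\<integral>\<^sup>+x. ennreal (indicator A x * enn2real (f x)) \<partial>M) = ennreal (\<nu> A)"
      by (simp add: fN)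
  qed (auto simp: nonneg)
  show thesis
  proof
    have "integrable M (\<lambda>x. indicator (space M) x * enn2real (f x))"
      using hA[of "space M"] by (auto simp: has_bochner_integral_iff)
    then show "integrable M (\<lambda>x. enn2real (f x))"
      by (rule Bochner_Integration.integrable_cong[THEN iffD1, rotated 2]) auto
    show "\<nu> A = (\<integral>x. indicator A x * enn2real (f x) \<partial>M)" if "A \<in> sets M" for A
      using hA[OF that] by (simp add: has_bochner_integral_iff)
  qed
qed

text \<open>Jordan decomposition: the positive part of \<open>\<nu>\<close> at \<open>A\<close> is the supremum of \<open>\<nu>\<close> over the
  measurable subsets of \<open>A\<close>.\<close>

lemma (in finite_measure) bounded_additive_density:
  fixes \<nu> :: "'a set \<Rightarrow> real"
  assumes add: "\<And>A B. A \<in> sets M \<Longrightarrow> B \<in> sets M \<Longrightarrow> A \<inter> B = {} \<Longrightarrow> \<nu> (A \<union> B) = \<nu> A + \<nu> B"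
    and bound: "\<And>A. A \<in> sets M \<Longrightarrow> \<bar>\<nu> A\<bar> \<le> K"
    and ac: "\<And>e. e > 0 \<Longrightarrow> \<exists>d>0. \<forall>A\<in>sets M. measure M A < d \<longrightarrow> \<bar>\<nu> A\<bar> \<le> e"
  obtains h where "integrable M h" "\<And>A. A \<in> sets M \<Longrightarrow> \<nu> A = (\<integral>x. indicator A x * h x \<partial>M)"
proof -
  define S where "S A = \<nu> ` {B \<in> sets M. B \<subseteq> A}" for A
  define p where "p A = Sup (S A)" for A
  have \<nu>0: "\<nu> {} = 0"
    using add[of "{}" "{}"] by simp
  have bdd: "bdd_above (S A)" for A
    unfolding bdd_above_def S_def using bound by (auto simp: abs_le_iff)
  have ne: "S A \<noteq> {}" for A
    by (auto simp: S_def)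
  have up: "\<nu> B \<le> p A" if "B \<in> sets M" "B \<subseteq> A" for A B
    unfolding p_def using that by (intro cSup_upper bdd) (auto simp: S_def)
  have lub: "p A \<le> c" if "\<And>B. B \<in> sets M \<Longrightarrow> B \<subseteq> A \<Longrightarrow> \<nu> B \<le> c" for A c
    unfolding p_def using that by (intro cSup_least ne) (auto simp: S_def)
  have p_nonneg: "0 \<le> p A" for A
    using up[of "{}" A] \<nu>0 by simp
  have p_add: "p (A \<union> B) = p A + p B"
    if [measurable]: "A \<in> sets M" "B \<in> sets M" and AB: "A \<inter> B = {}" for A B
  proof (rule antisym)
    show "p (A \<union> B) \<le> p A + p B"
    proof (rule lub)
      fix C assume [measurable]: "C \<in> sets M" and "C \<subseteq> A \<union> B"
      then have "C = (C \<inter> A) \<union> (C \<inter> B)" by blast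
      then have "\<nu> C = \<nu> (C \<inter> A) + \<nu> (C \<inter> B)"
        using AB add[of "C \<inter> A" "C \<inter> B"] by auto
      then show "\<nu> C \<le> p A + p B"
        using up[of "C \<inter> A" A] up[of "C \<inter> B" B] by simp
    qed
    have "p A \<le> p (A \<union> B) - p B"
    proof (rule lub)
      fix C assume C: "C \<in> sets M" "C \<subseteq> A"
      have "p B \<le> p (A \<union> B) - \<nu> C"
      proof (rule lub)
        fix D assume D: "D \<in> sets M" "D \<subseteq> B"
        have "C \<inter> D = {}" using C D AB by blast
        then have "\<nu> C + \<nu> D = \<nu> (C \<union> D)"
          using C D add by simp
        also have "\<dots> \<le> p (A \<union> B)"
          using C D by (intro up) auto
        finally show "\<nu> D \<le> p (A \<union> B) - \<nu> C" by simp
      qed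
      then show "\<nu> C \<le> p (A \<union> B) - p B" by simp
    qed
    then show "p A + p B \<le> p (A \<union> B)" by simp
  qed
  have p_ac: "\<exists>d>0. \<forall>A\<in>sets M. measure M A < d \<longrightarrow> p A \<le> e" if "e > 0" for e
  proof -
    obtain d where "d > 0" and d: "\<And>A. A \<in> sets M \<Longrightarrow> measure M A < d \<Longrightarrow> \<bar>\<nu> A\<bar> \<le> e"
      using ac[OF \<open>e > 0\<close>] by blast
    have "p A \<le> e" if "A \<in> sets M" "measure M A < d" for A
    proof (rule lub)
      fix B assume "B \<in> sets M" "B \<subseteq> A"
      then show "\<nu> B \<le> e"
        using d[of B] finite_measure_mono[of B A] that by fastforce
    qed
    then show ?thesis using \<open>d > 0\<close> by blast
  qed
  \<comment> \<open>\<open>p A - \<nu> A\<close> is the negative part of \<nu>. Both parts inherit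
    absolute continuity, so each has a density and \<nu> has their difference.\<close>
  have q_ac: "\<exists>d>0. \<forall>A\<in>sets M. measure M A < d \<longrightarrow> p A - \<nu> A \<le> e" if "e > 0" for e
  proof -
    obtain d1 where d1: "d1 > 0" "\<And>A. A \<in> sets M \<Longrightarrow> measure M A < d1 \<Longrightarrow> \<bar>\<nu> A\<bar> \<le> e/2"
      using ac[of "e/2"] \<open>e > 0\<close> by auto
    obtain d2 where d2: "d2 > 0" "\<And>A. A \<in> sets M \<Longrightarrow> measure M A < d2 \<Longrightarrow> p A \<le> e/2"
      using p_ac[of "e/2"] \<open>e > 0\<close> by auto
    show ?thesis
      using d1 d2 by (intro exI[of _ "min d1 d2"]) fastforce
  qed
  obtain h1 where h1: "integrable M h1" "\<And>A. A \<in> sets M \<Longrightarrow> p A = (\<integral>x. indicator A x * h1 x \<partial>M)"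
    using nonneg_additive_density[of p, OF p_add p_nonneg p_ac] by blast
  obtain h2 where h2: "integrable M h2" "\<And>A. A \<in> sets M \<Longrightarrow> p A - \<nu> A = (\<integral>x. indicator A x * h2 x \<partial>M)"
  proof (rule nonneg_additive_density[of "\<lambda>A. p A - \<nu> A"])
    show "p (A \<union> B) - \<nu> (A \<union> B) = p A - \<nu> A + (p B - \<nu> B)"
      if "A \<in> sets M" "B \<in> sets M" "A \<inter> B = {}" for A B
      using p_add[OF that] add[OF that] by simp
    show "0 \<le> p A - \<nu> A" if "A \<in> sets M" for A
      using up[OF that order_refl] by simp
  qed (use q_ac in auto)
  show thesis
  proof
    show "integrable M (\<lambda>x. h1 x - h2 x)"
      using h1 h2 by simp
    show "\<nu> A = (\<integral>x. indicator A x * (h1 x - h2 x) \<partial>M)" if A: "A \<in> sets M" for A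
      using h1(2)[OF A] h2(2)[OF A]
        integrable_mult_indicator[OF A h1(1)] integrable_mult_indicator[OF A h2(1)]
      by (simp add: right_diff_distrib)
  qed
qed

lemma (in finite_measure) bounded_additive_density_euclidean:
  fixes \<nu> :: "'a set \<Rightarrow> 'b::euclidean_space"
  assumes add: "\<And>A B. A \<in> sets M \<Longrightarrow> B \<in> sets M \<Longrightarrow> A \<inter> B = {} \<Longrightarrow> \<nu> (A \<union> B) = \<nu> A + \<nu> B"
    and bound: "\<And>A. A \<in> sets M \<Longrightarrow> norm (\<nu> A) \<le> K"
    and ac: "\<And>e. e > 0 \<Longrightarrow> \<exists>d>0. \<forall>A\<in>sets M. measure M A < d \<longrightarrow> norm (\<nu> A) \<le> e"
  obtains h where "integrable M h" "\<And>A. A \<in> sets M \<Longrightarrow> \<nu> A = (\<integral>x. indicator A x *\<^sub>R h x \<partial>M)"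
proof -
  have "\<exists>h. integrable M h \<and> (\<forall>A\<in>sets M. \<nu> A \<bullet> b = (\<integral>x. indicator A x * h x \<partial>M))"
    if b: "b \<in> Basis" for b
  proof -
    have le: "\<bar>\<nu> A \<bullet> b\<bar> \<le> norm (\<nu> A)" for A
      using Basis_le_norm[OF b] by simp
    show ?thesis
    proof (rule bounded_additive_density[of "\<lambda>A. \<nu> A \<bullet> b" K])
      show "\<nu> (A \<union> B) \<bullet> b = \<nu> A \<bullet> b + \<nu> B \<bullet> b"
        if "A \<in> sets M" "B \<in> sets M" "A \<inter> B = {}" for A B
        using add[OF that] by (simp add: inner_add_left)
      show "\<bar>\<nu> A \<bullet> b\<bar> \<le> K" if "A \<in> sets M" for A
        using le[of A] bound[OF that] by simp
      show "\<exists>d>0. \<forall>A\<in>sets M. measure M A < d \<longrightarrow> \<bar>\<nu> A \<bullet> b\<bar> \<le> e" if "e > 0" for e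
        using ac[OF that] le order_trans by blast
    qed blast
  qed
  then obtain h where h: "\<And>b. b \<in> Basis \<Longrightarrow> integrable M (h b)"
      "\<And>b A. b \<in> Basis \<Longrightarrow> A \<in> sets M \<Longrightarrow> \<nu> A \<bullet> b = (\<integral>x. indicator A x * h b x \<partial>M)"
    by metis
  show thesis
  proof
    show "integrable M (\<lambda>x. \<Sum>b\<in>Basis. h b x *\<^sub>R b)"
      using h(1) by (intro Bochner_Integration.integrable_sum integrable_scaleR_left) auto
    show "\<nu> A = (\<integral>x. indicator A x *\<^sub>R (\<Sum>b\<in>Basis. h b x *\<^sub>R b) \<partial>M)" if A: "A \<in> sets M" for A
    proof -
      have int: "integrable M (\<lambda>x. indicator A x * h b x)" if "b \<in> Basis" for b
        using integrable_mult_indicator[OF A h(1)[OF that]] by simp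
      have "(\<integral>x. indicator A x *\<^sub>R (\<Sum>b\<in>Basis. h b x *\<^sub>R b) \<partial>M)
          = (\<integral>x. (\<Sum>b\<in>Basis. (indicator A x * h b x) *\<^sub>R b) \<partial>M)"
        by (simp add: scaleR_sum_right)
      also have "\<dots> = (\<Sum>b\<in>Basis. (\<integral>x. indicator A x * h b x \<partial>M) *\<^sub>R b)"
        using int by (subst Bochner_Integration.integral_sum) auto
      also have "\<dots> = (\<Sum>b\<in>Basis. (\<nu> A \<bullet> b) *\<^sub>R b)"
        using h(2) A by (intro sum.cong) auto
      finally show ?thesis
        by (simp add: euclidean_representation)
    qed
  qed
qed

section \<open>The Banach space \<open>L\<^sub>1[0,1]\<close>\<close>

lemma l1_rel_self_iff: "l1_rel f f \<longleftrightarrow> integrable leb01 f"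
  by (simp add: l1_rel_def)

lemma integrable_rep_l1: "integrable leb01 (rep_l1 f)"
  using Quotient3_rep_reflp[OF Quotient3_l1, of f] by (simp add: l1_rel_self_iff)

lemma abs_rep_l1: "abs_l1 (rep_l1 f) = f"
  by (rule Quotient3_abs_rep[OF Quotient3_l1])

lemma rep_abs_l1:
  assumes "integrable leb01 f"
  shows "AE x in leb01. rep_l1 (abs_l1 f) x = f x"
  using rep_abs_rsp_left[OF Quotient3_l1, of f f] assms by (simp add: l1_rel_def)

lemma plus_abs_l1:
  assumes "integrable leb01 f" "integrable leb01 g"
  shows "abs_l1 f + abs_l1 g = abs_l1 (\<lambda>x. f x + g x)"
  using assms by (intro plus_l1.abs_eq) (simp_all add: l1_rel_self_iff)

lemma minus_abs_l1:
  assumes "integrable leb01 f" "integrable leb01 g"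
  shows "abs_l1 f - abs_l1 g = abs_l1 (\<lambda>x. f x - g x)"
  using assms by (intro minus_l1.abs_eq) (simp_all add: l1_rel_self_iff)

lemma scaleR_abs_l1:
  assumes "integrable leb01 f"
  shows "c *\<^sub>R abs_l1 f = abs_l1 (\<lambda>x. c *\<^sub>R f x)"
  using assms by (intro scaleR_l1.abs_eq) (simp_all add: l1_rel_self_iff)

lemma scale_abs_l1:
  assumes "integrable leb01 f"
  shows "scale_l1 c (abs_l1 f) = abs_l1 (\<lambda>x. c * f x)"
  using assms by (intro scale_l1.abs_eq) (simp_all add: l1_rel_self_iff)

lemma norm_abs_l1:
  assumes "integrable leb01 f"
  shows "norm (abs_l1 f) = (\<integral>x. norm (f x) \<partial>leb01)"
  using assms by (intro norm_l1.abs_eq) (simp_all add: l1_rel_self_iff)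

lemma sum_abs_l1:
  assumes "\<And>i. i \<in> I \<Longrightarrow> integrable leb01 (f i)"
  shows "(\<Sum>i\<in>I. abs_l1 (f i)) = abs_l1 (\<lambda>x. \<Sum>i\<in>I. f i x)"
  using assms
proof (induction I rule: infinite_finite_induct)
  case (insert i I)
  then show ?case
    by (simp add: plus_abs_l1)
qed (simp_all add: zero_l1_def)

lemma sum_scaleR_abs_l1:
  assumes "\<And>i. i \<in> I \<Longrightarrow> integrable leb01 (f i)"
  shows "(\<Sum>i\<in>I. a i *\<^sub>R abs_l1 (f i)) = abs_l1 (\<lambda>x. \<Sum>i\<in>I. a i *\<^sub>R f i x)"
proof -
  have "(\<Sum>i\<in>I. a i *\<^sub>R abs_l1 (f i)) = (\<Sum>i\<in>I. abs_l1 (\<lambda>x. a i *\<^sub>R f i x))"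
    using assms by (intro sum.cong refl scaleR_abs_l1)
  also have "\<dots> = abs_l1 (\<lambda>x. \<Sum>i\<in>I. a i *\<^sub>R f i x)"
    using assms by (intro sum_abs_l1) auto
  finally show ?thesis .
qed

lemma subspace_l1: "l1.subspace Y \<Longrightarrow> subspace Y"
  unfolding subspace_def l1.subspace_def by (simp add: scaleR_l1_eq_scale_l1)

text \<open>A subsequence converges almost everywhere, and its limit is the candidate. Fatou's lemma
  carries the Cauchy estimate \<open>norm (X n - X j) < e\<close> over to the limit, which also
  shows that the limit is integrable.\<close>

instance l1 :: ("{real_normed_field, euclidean_space}") banach
proof
  fix X :: "nat \<Rightarrow> 'a l1" assume X: "Cauchy X"
  define s where "s n = rep_l1 (X n)" for n
  have s: "integrable leb01 (s n)" "X n = abs_l1 (s n)" for n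
    by (simp_all add: s_def integrable_rep_l1 abs_rep_l1)
  have nrm: "norm (X i - X j) = (\<integral>x. norm (s i x - s j x) \<partial>leb01)" for i j
    using s by (simp add: minus_abs_l1 norm_abs_l1)
  have Cau: "\<exists>N. \<forall>i\<ge>N. \<forall>j\<ge>N. (\<integral>x. norm (s i x - s j x) \<partial>leb01) < e" if "e > 0" for e
    using CauchyD[OF X that] by (simp add: nrm)
  obtain r where r: "strict_mono r" "AE x in leb01. Cauchy (\<lambda>i. s (r i) x)"
    using cauchy_L1_AE_cauchy_subseq[OF s(1) Cau] by metis
  \<comment> \<open>On the null set where the subsequence diverges, \<open>lim\<close> has an
    unspecified value; u is measurable all the same.\<close>
  define u where "u x = lim (\<lambda>i. s (r i) x)" for x
  have meas[measurable]: "s n \<in> borel_measurable leb01" for n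
    using s(1)[of n] by (rule borel_measurable_integrable)
  have [measurable]: "u \<in> borel_measurable leb01"
    unfolding u_def by (intro borel_measurable_lim_metric meas)
  have u: "AE x in leb01. (\<lambda>i. s (r i) x) \<longlonglongrightarrow> u x"
    using r(2) by eventually_elim (auto simp: u_def Cauchy_convergent_iff convergent_LIMSEQ_iff)
  have fatou: "(\<integral>\<^sup>+x. norm (s n x - u x) \<partial>leb01) \<le> ennreal e"
    if n: "\<And>j. j \<ge> n \<Longrightarrow> (\<integral>x. norm (s n x - s j x) \<partial>leb01) < e" for n e
  proof -
    have "(\<integral>\<^sup>+x. norm (s n x - u x) \<partial>leb01)
        = (\<integral>\<^sup>+x. liminf (\<lambda>i. ennreal (norm (s n x - s (r i) x))) \<partial>leb01)"
    proof (rule nn_integral_cong_AE)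
      show "AE x in leb01. ennreal (norm (s n x - u x)) = liminf (\<lambda>i. ennreal (norm (s n x - s (r i) x)))"
        using u
      proof eventually_elim
        case (elim x)
        then have "(\<lambda>i. ennreal (norm (s n x - s (r i) x))) \<longlonglongrightarrow> ennreal (norm (s n x - u x))"
          by (intro tendsto_intros)
        then show ?case
          by (intro lim_imp_Liminf[symmetric]) simp_all
      qed
    qed
    also have "\<dots> \<le> liminf (\<lambda>i. \<integral>\<^sup>+x. norm (s n x - s (r i) x) \<partial>leb01)"
      by (rule nn_integral_liminf) auto
    also have "\<dots> \<le> ennreal e"
    proof (rule Liminf_le)
      have "(\<integral>\<^sup>+x. norm (s n x - s (r i) x) \<partial>leb01) \<le> ennreal e" if "i \<ge> n" for i
      proof -
        have "(\<integral>\<^sup>+x. norm (s n x - s (r i) x) \<partial>leb01) = ennreal (\<integral>x. norm (s n x - s (r i) x) \<partial>leb01)"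
          using s by (intro nn_integral_eq_integral) auto
        then show ?thesis
          using n[of "r i"] that seq_suble[OF r(1), of i] by (simp add: ennreal_leI)
      qed
      then show "\<forall>\<^sub>F i in sequentially. (\<integral>\<^sup>+x. norm (s n x - s (r i) x) \<partial>leb01) \<le> ennreal e"
        by (auto simp: eventually_sequentially)
    qed simp
    finally show ?thesis .
  qed
  have uint: "integrable leb01 u"
  proof -
    obtain N where N: "\<forall>i\<ge>N. \<forall>j\<ge>N. (\<integral>x. norm (s i x - s j x) \<partial>leb01) < 1"
      using Cau[of 1] by auto
    have "(\<integral>\<^sup>+x. norm (s N x - u x) \<partial>leb01) < \<infinity>"
      using fatou[of N 1] N by (auto intro: le_less_trans)
    then have "integrable leb01 (\<lambda>x. s N x - u x)"
      by (intro integrableI_bounded) auto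
    then have "integrable leb01 (\<lambda>x. s N x - (s N x - u x))"
      using s(1) Bochner_Integration.integrable_diff by blast
    then show ?thesis by simp
  qed
  have "X \<longlonglongrightarrow> abs_l1 u"
  proof (rule metric_LIMSEQ_I)
    fix e :: real assume "e > 0"
    then obtain N where N: "\<forall>i\<ge>N. \<forall>j\<ge>N. (\<integral>x. norm (s i x - s j x) \<partial>leb01) < e/2"
      using Cau[of "e/2"] by auto
    have "dist (X n) (abs_l1 u) < e" if "n \<ge> N" for n
    proof -
      have "dist (X n) (abs_l1 u) = (\<integral>x. norm (s n x - u x) \<partial>leb01)"
        using s uint by (simp add: dist_norm minus_abs_l1 norm_abs_l1)
      moreover have "ennreal (\<integral>x. norm (s n x - u x) \<partial>leb01) = (\<integral>\<^sup>+x. norm (s n x - u x) \<partial>leb01)"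
        using s uint by (intro nn_integral_eq_integral[symmetric]) auto
      moreover have "\<dots> \<le> ennreal (e/2)"
        using fatou[of n "e/2"] N that by auto
      ultimately have "ennreal (dist (X n) (abs_l1 u)) \<le> ennreal (e/2)"
        by simp
      then have "dist (X n) (abs_l1 u) \<le> e/2"
        using \<open>e > 0\<close> by (subst (asm) ennreal_le_iff) auto
      then show ?thesis
        using \<open>e > 0\<close> by simp
    qed
    then show "\<exists>N. \<forall>n\<ge>N. dist (X n) (abs_l1 u) < e" by blast
  qed
  then show "convergent X"
    by (rule convergentI)
qed

section \<open>Functionals on \<open>L\<^sub>1[0,1]\<close>\<close>

text \<open>The bilinear form \<open>(c * d) \<bullet> 1\<close> replaces the real part of \<open>c * d\<close>: through it, real functionals
  on the scalars are scalars, which makes real extensions of functionals scalar-linear.\<close>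

lemma inner_mult_1_nondegenerate:
  fixes d :: "'k::{real_normed_field, euclidean_space}"
  assumes "\<And>c. (c * d) \<bullet> 1 = 0"
  shows "d = 0"
proof (rule ccontr)
  assume "d \<noteq> 0"
  then have "(1::'k) \<bullet> 1 = 0"
    using assms[of "inverse d"] by simp
  then show False by simp
qed

text \<open>The linear map taking d to the functional \<open>\<lambda>c. (c * d) \<bullet> 1\<close>
  is injective by nondegeneracy, hence onto, as both sides have the same finite dimension; J is this
  map in coordinates. The bound on d is exact because \<open>c = inverse d\<close> gives
  \<open>L c = 1\<close>.\<close>

lemma real_functional_eq_inner_mult_1:
  fixes L :: "'k::{real_normed_field, euclidean_space} \<Rightarrow> real"
  assumes L: "linear L" and bound: "\<And>c. \<bar>L c\<bar> \<le> m * norm c"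
  obtains d where "\<And>c. L c = (c * d) \<bullet> 1" "norm d \<le> m"
proof -
  define J :: "'k \<Rightarrow> 'k" where "J d = (\<Sum>b\<in>Basis. ((b * d) \<bullet> 1) *\<^sub>R b)" for d
  have J: "linear J"
    unfolding J_def by (rule linearI)
      (simp_all add: distrib_left inner_add_left scaleR_add_left sum.distrib scaleR_sum_right)
  have Jb: "J d \<bullet> b = (b * d) \<bullet> 1" if "b \<in> Basis" for b d
    unfolding J_def using that by (simp add: inner_sum_left inner_Basis if_distrib cong: if_cong)
  have expand: "M c = (\<Sum>b\<in>Basis. (c \<bullet> b) * M b)" if "linear M" for M :: "'k \<Rightarrow> real" and c
  proof -
    have "M c = M (\<Sum>b\<in>Basis. (c \<bullet> b) *\<^sub>R b)"
      by (simp add: euclidean_representation)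
    then show ?thesis
      using that by (simp add: linear_sum linear_scale)
  qed
  have lin: "linear (\<lambda>c. (c * d) \<bullet> 1)" for d :: 'k
    by (rule linearI) (simp_all add: distrib_right inner_add_left)
  have "inj J"
    unfolding linear_injective_0[OF J]
  proof (intro allI impI)
    fix d assume "J d = 0"
    then have "(b * d) \<bullet> 1 = 0" if "b \<in> Basis" for b
      using Jb[OF that, of d] by simp
    then have "(c * d) \<bullet> 1 = 0" for c
      using expand[OF lin[of d], of c] by simp
    then show "d = 0"
      by (rule inner_mult_1_nondegenerate)
  qed
  then have "surj J"
    using J linear_injective_imp_surjective by blast
  then obtain d where "J d = (\<Sum>b\<in>Basis. L b *\<^sub>R b)"
    by (metis surjD)
  then have "(b * d) \<bullet> 1 = L b" if "b \<in> Basis" for b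
    using Jb[OF that, of d] that by (simp add: inner_sum_left inner_Basis if_distrib cong: if_cong)
  then have d: "L c = (c * d) \<bullet> 1" for c
    using expand[OF lin[of d], of c] expand[OF L, of c] by simp
  have "norm d \<le> m"
  proof (cases "d = 0")
    case True
    then show ?thesis using bound[of 1] by simp
  next
    case False
    then have "1 \<le> m * norm (inverse d)"
      using bound[of "inverse d"] d[of "inverse d"] by (simp add: dot_square_norm)
    then show ?thesis
      using False by (simp add: norm_divide field_simps)
  qed
  with d show thesis by (rule that)
qed

text \<open>The classical passage from real to complex scalars. The real functional
  \<open>\<lambda>x. \<phi> x \<bullet> 1\<close> is extended to F, and \<open>\<psi> x\<close> is
  the scalar that represents \<open>\<lambda>c. F (scale_l1 c x)\<close>. Uniqueness of this scalar
  makes \<psi> linear over the scalars, and the constant B is preserved.\<close>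

lemma hahn_banach_l1:
  fixes \<phi> :: "'k::{real_normed_field, euclidean_space} l1 \<Rightarrow> 'k"
  assumes Y: "l1.subspace Y"
    and add: "\<And>x y. x \<in> Y \<Longrightarrow> y \<in> Y \<Longrightarrow> \<phi> (x + y) = \<phi> x + \<phi> y"
    and scale: "\<And>c x. x \<in> Y \<Longrightarrow> \<phi> (scale_l1 c x) = c * \<phi> x"
    and bound: "\<And>x. x \<in> Y \<Longrightarrow> norm (\<phi> x) \<le> B * norm x"
    and B: "0 \<le> B"
  obtains \<psi> where "\<And>x y. \<psi> (x + y) = \<psi> x + \<psi> y" "\<And>c x. \<psi> (scale_l1 c x) = c * \<psi> x"
    "\<And>x. norm (\<psi> x) \<le> B * norm x" "\<And>x. x \<in> Y \<Longrightarrow> \<psi> x = \<phi> x"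
proof -
  obtain F where F: "linear F" and FB: "\<And>x. F x \<le> B * norm x"
    and FY: "\<And>x. x \<in> Y \<Longrightarrow> F x = \<phi> x \<bullet> 1"
  proof (rule hahn_banach[of Y "\<lambda>x. \<phi> x \<bullet> 1" B])
    show "subspace Y" by (rule subspace_l1[OF Y])
    show "\<phi> (x + y) \<bullet> 1 = \<phi> x \<bullet> 1 + \<phi> y \<bullet> 1" if "x \<in> Y" "y \<in> Y" for x y
      using add[OF that] by (simp add: inner_add_left)
    show "\<phi> (c *\<^sub>R x) \<bullet> 1 = c * (\<phi> x \<bullet> 1)" if "x \<in> Y" for c x
      using scale[OF that, of "of_real c"] by (simp add: scaleR_l1_eq_scale_l1 flip: scaleR_conv_of_real)
    show "\<phi> x \<bullet> 1 \<le> B * norm x" if "x \<in> Y" for x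
      using norm_cauchy_schwarz[of "\<phi> x" 1] bound[OF that] by simp
  qed (use B in auto)
  have Fabs: "\<bar>F x\<bar> \<le> B * norm x" for x
    using FB[of x] FB[of "- x"] linear_neg[OF F, of x] by simp
  have "\<exists>d. (\<forall>c. F (scale_l1 c x) = (c * d) \<bullet> 1) \<and> norm d \<le> B * norm x" for x
  proof (rule real_functional_eq_inner_mult_1[of "\<lambda>c. F (scale_l1 c x)" "B * norm x"])
    show "linear (\<lambda>c. F (scale_l1 c x))"
    proof (rule linearI)
      show "F (scale_l1 (a + b) x) = F (scale_l1 a x) + F (scale_l1 b x)" for a b
        by (simp add: l1.scale_left_distrib linear_add[OF F])
      show "F (scale_l1 (r *\<^sub>R b) x) = r *\<^sub>R F (scale_l1 b x)" for r b
        using linear_scale[OF F, of r "scale_l1 b x"]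
        by (simp add: scaleR_l1_eq_scale_l1 scaleR_conv_of_real)
    qed
    show "\<bar>F (scale_l1 c x)\<bar> \<le> B * norm x * norm c" for c
      using Fabs[of "scale_l1 c x"] by (simp add: norm_scale_l1 ac_simps)
  qed blast
  then obtain \<psi> where \<psi>: "\<And>c x. F (scale_l1 c x) = (c * \<psi> x) \<bullet> 1" "\<And>x. norm (\<psi> x) \<le> B * norm x"
    by metis
  have eqI: "\<psi> x = e" if "\<And>c. F (scale_l1 c x) = (c * e) \<bullet> 1" for x e
    using inner_mult_1_nondegenerate[of "\<psi> x - e"] \<psi>(1)[of _ x] that
    by (simp add: right_diff_distrib inner_diff_left)
  show thesis
  proof
    show "\<psi> (x + y) = \<psi> x + \<psi> y" for x y
      by (rule eqI) (simp add: l1.scale_right_distrib linear_add[OF F] \<psi>(1) distrib_left inner_add_left)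
    show "\<psi> (scale_l1 a x) = a * \<psi> x" for a x
      by (rule eqI) (simp add: \<psi>(1) mult.assoc)
    show "norm (\<psi> x) \<le> B * norm x" for x by (rule \<psi>(2))
    show "\<psi> x = \<phi> x" if x: "x \<in> Y" for x
      by (rule eqI) (use x Y in \<open>simp add: FY scale l1.subspace_scale\<close>)
  qed
qed

text \<open>The functional that takes \<open>y + scale_l1 c h\<close> to c vanishes on Y and is 1 at
  h. As Y is closed, h has positive distance from it, and this bounds the functional, which then
  extends by Hahn-Banach.\<close>

lemma separating_functional_l1:
  fixes Y :: "'k::{real_normed_field, euclidean_space} l1 set"
  assumes Y: "l1.subspace Y" "closed Y" and h: "h \<notin> Y"
  obtains \<psi> B where "\<And>x y. \<psi> (x + y) = \<psi> x + \<psi> y" "\<And>c x. \<psi> (scale_l1 c x) = c * \<psi> x"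
    "\<And>x. norm (\<psi> x) \<le> B * norm x" "0 \<le> B" "\<And>x. x \<in> Y \<Longrightarrow> \<psi> x = 0" "\<psi> h \<noteq> (0::'k)"
proof -
  obtain d where d: "d > 0" "\<And>y. y \<in> Y \<Longrightarrow> d \<le> norm (h - y)"
  proof -
    have "open (- Y)" "h \<in> - Y" using Y h by auto
    then obtain d where "d > 0" "\<And>y. dist y h < d \<Longrightarrow> y \<in> - Y"
      by (metis open_dist)
    then show thesis
      using that[of d] by (metis ComplD dist_norm dist_commute not_le)
  qed
  define V where "V = {y + scale_l1 c h |y c. y \<in> Y}"
  define \<phi> where "\<phi> x = (THE c. x - scale_l1 c h \<in> Y)" for x
  have VI: "y + scale_l1 c h \<in> V" if "y \<in> Y" for y c
    using that by (auto simp: V_def)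
  have \<phi>: "\<phi> (y + scale_l1 c h) = c" if y: "y \<in> Y" for y c
    unfolding \<phi>_def
  proof (rule the_equality)
    show "y + scale_l1 c h - scale_l1 c h \<in> Y" using y by simp
    fix e assume e: "y + scale_l1 c h - scale_l1 e h \<in> Y"
    show "e = c"
    proof (rule ccontr)
      assume "e \<noteq> c"
      have "y + scale_l1 c h - scale_l1 e h - y \<in> Y"
        using e y Y(1) l1.subspace_diff by blast
      then have "scale_l1 (c - e) h \<in> Y"
        by (simp add: l1.scale_left_diff_distrib)
      then have "scale_l1 (inverse (c - e)) (scale_l1 (c - e) h) \<in> Y"
        by (rule l1.subspace_scale[OF Y(1)])
      then show False
        using \<open>e \<noteq> c\<close> h by simp
    qed
  qed
  have V: "l1.subspace V"
  proof (rule l1.subspaceI)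
    show "0 \<in> V"
      using VI[OF l1.subspace_0[OF Y(1)], of 0] by simp
    fix x y assume "x \<in> V" "y \<in> V"
    then obtain u c v e where "u \<in> Y" "v \<in> Y" "x = u + scale_l1 c h" "y = v + scale_l1 e h"
      unfolding V_def by blast
    then show "x + y \<in> V"
      using VI[of "u + v" "c + e"] l1.subspace_add[OF Y(1)]
      by (simp add: l1.scale_left_distrib algebra_simps)
  next
    fix c x assume "x \<in> V"
    then obtain u e where "u \<in> Y" "x = u + scale_l1 e h"
      unfolding V_def by blast
    then show "scale_l1 c x \<in> V"
      using VI[of "scale_l1 c u" "c * e"] l1.subspace_scale[OF Y(1)]
      by (simp add: l1.scale_right_distrib)
  qed
  obtain \<psi> where \<psi>: "\<And>x y. \<psi> (x + y) = \<psi> x + \<psi> y" "\<And>c x. \<psi> (scale_l1 c x) = c * \<psi> x"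
    "\<And>x. norm (\<psi> x) \<le> 1/d * norm x" "\<And>x. x \<in> V \<Longrightarrow> \<psi> x = \<phi> x"
  proof (rule hahn_banach_l1[OF V, of \<phi> "1/d"])
    fix x y assume "x \<in> V" "y \<in> V"
    then obtain u c v e where "u \<in> Y" "v \<in> Y" "x = u + scale_l1 c h" "y = v + scale_l1 e h"
      unfolding V_def by blast
    then show "\<phi> (x + y) = \<phi> x + \<phi> y"
      using \<phi>[of "u + v" "c + e"] l1.subspace_add[OF Y(1)]
      by (simp add: \<phi> l1.scale_left_distrib algebra_simps)
  next
    fix c x assume "x \<in> V"
    then obtain u e where "u \<in> Y" "x = u + scale_l1 e h"
      unfolding V_def by blast
    then show "\<phi> (scale_l1 c x) = c * \<phi> x"
      using \<phi>[of "scale_l1 c u" "c * e"] l1.subspace_scale[OF Y(1)]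
      by (simp add: \<phi> l1.scale_right_distrib)
  next
    fix x assume "x \<in> V"
    then obtain u c where uc: "u \<in> Y" "x = u + scale_l1 c h"
      unfolding V_def by blast
    \<comment> \<open>For nonzero c the vector is c times \<open>h - y\<close>, where y is the
      element \<open>scale_l1 (- inverse c) u\<close> of Y.\<close>
    have "d * norm c \<le> norm (u + scale_l1 c h)"
    proof (cases "c = 0")
      case False
      have "d \<le> norm (h - scale_l1 (- inverse c) u)"
        using uc by (intro d l1.subspace_scale[OF Y(1)])
      then have "norm c * d \<le> norm c * norm (h - scale_l1 (- inverse c) u)"
        by (intro mult_left_mono) auto
      also have "\<dots> = norm (scale_l1 c (h - scale_l1 (- inverse c) u))"
        by (simp add: norm_scale_l1)
      also have "scale_l1 c (h - scale_l1 (- inverse c) u) = u + scale_l1 c h"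
        using False by (simp add: l1.scale_right_distrib add.commute)
      finally show ?thesis by (simp add: ac_simps)
    qed simp
    then show "norm (\<phi> x) \<le> 1/d * norm x"
      using \<phi>[OF uc(1)] uc(2) d(1) by (simp add: field_simps)
  qed (use d in auto)
  show thesis
  proof (rule that[OF \<psi>(1,2,3)])
    show "\<psi> x = 0" if "x \<in> Y" for x
      using \<psi>(4)[OF VI[OF that, of 0]] \<phi>[OF that, of 0] by simp
    show "\<psi> h \<noteq> 0"
      using \<psi>(4)[OF VI[of 0 1]] \<phi>[of 0 1] l1.subspace_0[OF Y(1)] by simp
  qed (use d in auto)
qed

section \<open>Representation of functionals by bounded functions\<close>

lemma finite_measure_leb01: "finite_measure leb01"
  by (rule finite_measureI) (simp add: emeasure_restrict_space)

text \<open>Tested on the set where h exceeds C, the hypothesis says that the nonnegative function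
  \<open>indicator A x * (h x - C)\<close> has integral at most 0, so it vanishes almost
  everywhere.\<close>

lemma (in finite_measure) AE_le_of_integral_le:
  fixes h :: "'a \<Rightarrow> real"
  assumes h: "integrable M h"
    and le: "\<And>A. A \<in> sets M \<Longrightarrow> (\<integral>x. indicator A x * h x \<partial>M) \<le> C * measure M A"
  shows "AE x in M. h x \<le> C"
proof -
  have [measurable]: "h \<in> borel_measurable M" using h by auto
  define A where "A = {x \<in> space M. C < h x}"
  have A[measurable]: "A \<in> sets M" by (simp add: A_def)
  have int: "integrable M (\<lambda>x. indicator A x * (h x - C))"
    using integrable_mult_indicator[OF A, of "\<lambda>x. h x - C"] h by simp
  have "(\<integral>x. indicator A x * (h x - C) \<partial>M) = (\<integral>x. indicator A x * h x - C * indicator A x \<partial>M)"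
    by (simp add: algebra_simps)
  also have "\<dots> = (\<integral>x. indicator A x * h x \<partial>M) - C * measure M A"
    using integrable_mult_indicator[OF A h] integrable_mult_indicator[OF A, of "\<lambda>_. 1::real"]
    by (subst Bochner_Integration.integral_diff) auto
  finally have "(\<integral>x. indicator A x * (h x - C) \<partial>M) \<le> 0"
    using le[OF A] by simp
  moreover have nn: "0 \<le> indicator A x * (h x - C)" for x
    by (auto simp: A_def indicator_def)
  ultimately have "(\<integral>x. indicator A x * (h x - C) \<partial>M) = 0"
    using Bochner_Integration.integral_nonneg[of M "\<lambda>x. indicator A x * (h x - C)"] by (simp add: antisym)
  then have "AE x in M. indicator A x * (h x - C) = 0"
    using integral_nonneg_eq_0_iff_AE[OF int] nn by simp
  moreover have "AE x in M. x \<in> space M" by (rule AE_space)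
  ultimately show ?thesis
    by eventually_elim (auto simp: A_def indicator_def split: if_splits)
qed

lemma integrable_bounded_mult:
  fixes f g :: "'a \<Rightarrow> 'k::{real_normed_field, euclidean_space}"
  assumes "integrable M f" "g \<in> borel_measurable M" "\<And>x. norm (g x) \<le> C"
  shows "integrable M (\<lambda>x. g x * f x)"
proof (rule Bochner_Integration.integrable_bound[of M "\<lambda>x. C * norm (f x)"])
  have [measurable]: "f \<in> borel_measurable M" using assms(1) by auto
  note assms(2)[measurable]
  show "(\<lambda>x. g x * f x) \<in> borel_measurable M" by simp
  show "AE x in M. norm (g x * f x) \<le> norm (C * norm (f x))"
    using assms(3) by (auto simp: norm_mult abs_mult intro!: mult_right_mono order_trans[OF _ abs_ge_self])
qed (use assms in auto)

lemma norm_integral_bounded_mult_le: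
  fixes f g :: "'a \<Rightarrow> 'k::{real_normed_field, euclidean_space}"
  assumes f: "integrable M f" and g: "g \<in> borel_measurable M" "\<And>x. norm (g x) \<le> C"
  shows "norm (\<integral>x. g x * f x \<partial>M) \<le> C * (\<integral>x. norm (f x) \<partial>M)"
proof -
  have "norm (\<integral>x. g x * f x \<partial>M) \<le> (\<integral>x. norm (g x * f x) \<partial>M)"
    by (rule integral_norm_bound)
  also have "\<dots> \<le> (\<integral>x. C * norm (f x) \<partial>M)"
    using assms by (intro integral_mono integrable_norm integrable_bounded_mult)
      (auto simp: norm_mult mult_right_mono)
  finally show ?thesis by simp
qed

text \<open>On indicators, \<psi> is an additive set function with values at most B times the
  measure. It therefore has a density, and testing the components of the density on measurable sets
  shows that they are bounded by B almost everywhere. Approximation extends the formula from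
  indicators to all integrable functions.\<close>

lemma l1_functional_representation:
  fixes \<psi> :: "'k::{real_normed_field, euclidean_space} l1 \<Rightarrow> 'k"
  assumes add: "\<And>x y. \<psi> (x + y) = \<psi> x + \<psi> y" and scale: "\<And>c x. \<psi> (scale_l1 c x) = c * \<psi> x"
    and bound: "\<And>x. norm (\<psi> x) \<le> B * norm x" and B: "0 \<le> B"
  obtains g C where "g \<in> borel_measurable leb01" "\<And>x. norm (g x) \<le> C"
    "\<And>f. integrable leb01 f \<Longrightarrow> \<psi> (abs_l1 f) = (\<integral>x. g x * f x \<partial>leb01)"
proof -
  interpret finite_measure leb01 by (rule finite_measure_leb01)
  define \<nu> where "\<nu> A = \<psi> (abs_l1 (\<lambda>x. indicator A x *\<^sub>R 1))" for A
  have ind: "integrable leb01 (\<lambda>x. indicator A x *\<^sub>R (c::'k))" if "A \<in> sets leb01" for A c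
    using integrable_mult_indicator[OF that, of "\<lambda>_. c"] by simp
  have \<nu>B: "norm (\<nu> A) \<le> B * measure leb01 A" if A: "A \<in> sets leb01" for A
  proof -
    have "norm (abs_l1 (\<lambda>x. indicator A x *\<^sub>R (1::'k))) = measure leb01 A"
      using sets.sets_into_space[OF A] A by (simp add: norm_abs_l1 ind Int_absorb2)
    then show ?thesis
      using bound[of "abs_l1 (\<lambda>x. indicator A x *\<^sub>R 1)"] by (simp add: \<nu>_def)
  qed
  obtain g where g: "integrable leb01 g" "\<And>A. A \<in> sets leb01 \<Longrightarrow> \<nu> A = (\<integral>x. indicator A x *\<^sub>R g x \<partial>leb01)"
  proof (rule bounded_additive_density_euclidean[of \<nu> "B * measure leb01 (space leb01)"])
    show "\<nu> (A1 \<union> A2) = \<nu> A1 + \<nu> A2"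
      if A: "A1 \<in> sets leb01" "A2 \<in> sets leb01" "A1 \<inter> A2 = {}" for A1 A2
    proof -
      have "abs_l1 (\<lambda>x. indicator A1 x *\<^sub>R (1::'k)) + abs_l1 (\<lambda>x. indicator A2 x *\<^sub>R 1)
          = abs_l1 (\<lambda>x. indicator (A1 \<union> A2) x *\<^sub>R 1)"
        using A by (simp add: plus_abs_l1 ind indicator_add scaleR_left_distrib[symmetric])
      then show ?thesis
        by (simp add: \<nu>_def add[symmetric])
    qed
    show "norm (\<nu> A) \<le> B * measure leb01 (space leb01)" if A: "A \<in> sets leb01" for A
      using \<nu>B[OF A] mult_left_mono[OF bounded_measure[of A] B] by linarith
    show "\<exists>d>0. \<forall>A\<in>sets leb01. measure leb01 A < d \<longrightarrow> norm (\<nu> A) \<le> e" if "e > 0" for e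
    proof (intro exI[of _ "e / (B + 1)"] conjI ballI impI)
      show "0 < e / (B + 1)" using that B by simp
      fix A assume A: "A \<in> sets leb01" "measure leb01 A < e / (B + 1)"
      have "B * measure leb01 A \<le> (B + 1) * measure leb01 A"
        by (simp add: algebra_simps)
      also have "\<dots> \<le> e"
        using A(2) B by (simp add: field_simps)
      finally show "norm (\<nu> A) \<le> e"
        using \<nu>B[OF A(1)] by simp
    qed
  qed blast
  have [measurable]: "g \<in> borel_measurable leb01" using g(1) by auto
  \<comment> \<open>g satisfies its bound only almost everywhere. G satisfies it at every point,
    with the dimension of the scalars as an extra factor, since the norm is estimated by the sum of
    the coordinates.\<close>
  define G where "G x = (if \<forall>b\<in>Basis. \<bar>g x \<bullet> b\<bar> \<le> B then g x else 0)" for x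
  have [measurable]: "G \<in> borel_measurable leb01"
    unfolding G_def by measurable
  have Gb: "norm (G x) \<le> real (card (Basis :: 'k set)) * B" for x
  proof (cases "\<forall>b\<in>Basis. \<bar>g x \<bullet> b\<bar> \<le> B")
    case True
    have "norm (g x) \<le> (\<Sum>b\<in>Basis. \<bar>g x \<bullet> b\<bar>)" by (rule norm_le_l1)
    also have "\<dots> \<le> (\<Sum>b\<in>(Basis :: 'k set). B)" using True by (intro sum_mono) auto
    finally show ?thesis using True by (simp add: G_def)
  qed (auto simp: G_def B)
  have comp: "AE x in leb01. g x \<bullet> b \<le> B" if b: "norm b \<le> 1" for b
  proof (rule AE_le_of_integral_le)
    show "integrable leb01 (\<lambda>x. g x \<bullet> b)" using g(1) by simp
    fix A assume A: "A \<in> sets leb01"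
    have "(\<integral>x. indicator A x * (g x \<bullet> b) \<partial>leb01) = (\<integral>x. (indicator A x *\<^sub>R g x) \<bullet> b \<partial>leb01)"
      by simp
    also have "\<dots> = \<nu> A \<bullet> b"
      using integrable_mult_indicator[OF A g(1)] g(2)[OF A] by (subst integral_inner_left) auto
    also have "\<dots> \<le> norm (\<nu> A) * norm b"
      by (rule norm_cauchy_schwarz)
    also have "\<dots> \<le> norm (\<nu> A)"
      using b by (simp add: mult_left_le)
    finally show "(\<integral>x. indicator A x * (g x \<bullet> b) \<partial>leb01) \<le> B * measure leb01 A"
      using \<nu>B[OF A] by simp
  qed
  have "AE x in leb01. \<forall>b\<in>(Basis::'k set). g x \<bullet> b \<le> B \<and> g x \<bullet> (- b) \<le> B"
    by (intro AE_finite_allI finite_Basis AE_conjI comp) simp_all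
  then have Gg: "AE x in leb01. g x = G x"
    by eventually_elim (auto simp: G_def abs_le_iff)
  define C where "C = real (card (Basis :: 'k set)) * B"
  have GC: "norm (G x) \<le> C" for x using Gb by (simp add: C_def)
  note Gint = integrable_bounded_mult[of leb01 _ G C] and Gle = norm_integral_bounded_mult_le[of leb01 _ G C]
  have "\<psi> (abs_l1 f) = (\<integral>x. G x * f x \<partial>leb01)" if "integrable leb01 f" for f
    using that
  proof (induction rule: integrable_induct)
    case (base A c)
    have "\<psi> (abs_l1 (\<lambda>x. indicator A x *\<^sub>R c)) = \<psi> (scale_l1 c (abs_l1 (\<lambda>x. indicator A x *\<^sub>R 1)))"
      using base by (simp add: scale_abs_l1 ind)
    also have "\<dots> = c * (\<integral>x. indicator A x *\<^sub>R g x \<partial>leb01)"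
      using base g(2) by (simp add: scale \<nu>_def)
    also have "(\<integral>x. indicator A x *\<^sub>R g x \<partial>leb01) = (\<integral>x. indicator A x *\<^sub>R G x \<partial>leb01)"
      using Gg base by (intro integral_cong_AE) (auto elim: eventually_mono)
    also have "c * (\<integral>x. indicator A x *\<^sub>R G x \<partial>leb01) = (\<integral>x. c * (indicator A x *\<^sub>R G x) \<partial>leb01)"
      by (rule integral_mult_right_zero[symmetric])
    also have "\<dots> = (\<integral>x. G x * (indicator A x *\<^sub>R c) \<partial>leb01)"
      by (simp add: mult.commute)
    finally show ?case .
  next
    case (add f1 f2)
    then show ?case
      by (simp add: plus_abs_l1[symmetric] assms(1) distrib_left Gint GC)
  next
    case (lim f s)
    \<comment> \<open>The defect of the formula vanishes at every \<open>s i\<close> and is bounded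
      by \<open>B + C\<close> times the L_1 norm, so it vanishes at the limit.\<close>
    define \<delta> where "\<delta> h = \<psi> (abs_l1 h) - (\<integral>x. G x * h x \<partial>leb01)" for h
    have \<delta>: "norm (\<delta> f) \<le> (B + C) * (\<integral>x. norm (s i x - f x) \<partial>leb01)" for i
    proof -
      have fs: "integrable leb01 (\<lambda>x. f x - s i x)"
        using lim by auto
      have "\<psi> (abs_l1 f) = \<psi> (abs_l1 (\<lambda>x. f x - s i x)) + \<psi> (abs_l1 (s i))"
        using plus_abs_l1[OF fs lim(1)[of i]] assms(1)[of "abs_l1 (\<lambda>x. f x - s i x)" "abs_l1 (s i)"] by simp
      moreover have "(\<integral>x. G x * f x \<partial>leb01) = (\<integral>x. G x * (f x - s i x) \<partial>leb01) + (\<integral>x. G x * s i x \<partial>leb01)"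
        using lim by (simp add: right_diff_distrib Gint GC)
      ultimately have "\<delta> f = \<psi> (abs_l1 (\<lambda>x. f x - s i x)) - (\<integral>x. G x * (f x - s i x) \<partial>leb01)"
        using lim by (simp add: \<delta>_def)
      then have "norm (\<delta> f) \<le> norm (\<psi> (abs_l1 (\<lambda>x. f x - s i x))) + norm (\<integral>x. G x * (f x - s i x) \<partial>leb01)"
        by (simp add: norm_triangle_ineq4)
      also have "\<dots> \<le> B * norm (abs_l1 (\<lambda>x. f x - s i x)) + C * (\<integral>x. norm (f x - s i x) \<partial>leb01)"
        by (intro add_mono bound Gle fs GC) simp
      also have "\<dots> = (B + C) * (\<integral>x. norm (s i x - f x) \<partial>leb01)"
        using fs by (simp add: norm_abs_l1 algebra_simps norm_minus_commute)
      finally show ?thesis .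
    qed
    \<comment> \<open>The majorant \<open>3 * norm (f x)\<close> arises from
      \<open>norm (s i x) \<le> 2 * norm (f x)\<close> and the triangle inequality.\<close>
    have "(\<lambda>i. \<integral>x. norm (s i x - f x) \<partial>leb01) \<longlonglongrightarrow> (\<integral>x. 0 \<partial>leb01)"
    proof (rule integral_dominated_convergence[where w = "\<lambda>x. 3 * norm (f x)"])
      have [measurable]: "f \<in> borel_measurable leb01" "s i \<in> borel_measurable leb01" for i
        using lim by auto
      show "(\<lambda>x. norm (s i x - f x)) \<in> borel_measurable leb01" for i by simp
      show "AE x in leb01. (\<lambda>i. norm (s i x - f x)) \<longlonglongrightarrow> 0"
        by (intro AE_I2 tendsto_norm_zero LIM_zero lim(2))
      show "AE x in leb01. norm (norm (s i x - f x)) \<le> 3 * norm (f x)" for i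
      proof (rule AE_I2)
        fix x assume "x \<in> space leb01"
        then show "norm (norm (s i x - f x)) \<le> 3 * norm (f x)"
          using lim(3)[of x i] norm_triangle_ineq4[of "s i x" "f x"] by simp
      qed
    qed (use lim in auto)
    then have "(\<lambda>i. (B + C) * (\<integral>x. norm (s i x - f x) \<partial>leb01)) \<longlonglongrightarrow> (B + C) * 0"
      by (intro tendsto_mult_left) simp
    then have "norm (\<delta> f) \<le> (B + C) * 0"
      using \<delta> by (intro LIMSEQ_le_const) auto
    then show ?case
      by (simp add: \<delta>_def)
  qed
  then show thesis
    using that[of G C] GC by simp
qed

section \<open>Reflexivity from uniform integrability\<close>

definition tail_integral :: "real \<Rightarrow> (real \<Rightarrow> 'k::{real_normed_field, euclidean_space}) \<Rightarrow> real"
  where "tail_integral M f = (\<integral>x. indicator {M<..} (norm (f x)) * norm (f x) \<partial>leb01)"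

lemma integrable_tail:
  fixes f :: "real \<Rightarrow> 'k::{real_normed_field, euclidean_space}"
  assumes "integrable leb01 f"
  shows "integrable leb01 (\<lambda>x. indicator {M<..} (norm (f x)) * norm (f x))"
proof (rule Bochner_Integration.integrable_bound[of _ "\<lambda>x. norm (f x)"])
  have [measurable]: "f \<in> borel_measurable leb01" using assms by auto
  show "(\<lambda>x. indicator {M<..} (norm (f x)) * norm (f x)) \<in> borel_measurable leb01"
    by measurable
qed (use assms in \<open>auto simp: indicator_def\<close>)

text \<open>The product is at most \<open>M * norm (g x)\<close> where \<open>norm (f x)\<close> is
  at most M, and at most \<open>C * norm (f x)\<close> elsewhere. If the tails are uniformly small,
  integration against g becomes small, uniformly in f, once g has small L_1 norm and bounded
  supremum.\<close>

lemma norm_integral_mult_le_tail: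
  fixes f g :: "real \<Rightarrow> 'k::{real_normed_field, euclidean_space}"
  assumes f: "integrable leb01 f" and g: "g \<in> borel_measurable leb01" "\<And>x. norm (g x) \<le> C"
    and M: "0 \<le> M"
  shows "norm (\<integral>x. g x * f x \<partial>leb01) \<le> M * (\<integral>x. norm (g x) \<partial>leb01) + C * tail_integral M f"
proof -
  interpret finite_measure leb01 by (rule finite_measure_leb01)
  have gi: "integrable leb01 g"
    using g by (intro integrable_const_bound[of _ C]) auto
  have "norm (\<integral>x. g x * f x \<partial>leb01) \<le> (\<integral>x. norm (g x * f x) \<partial>leb01)"
    by (rule integral_norm_bound)
  also have "\<dots> \<le> (\<integral>x. M * norm (g x) + C * (indicator {M<..} (norm (f x)) * norm (f x)) \<partial>leb01)"
  proof (rule integral_mono)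
    show "integrable leb01 (\<lambda>x. norm (g x * f x))"
      using f g by (intro integrable_norm integrable_bounded_mult) auto
    show "integrable leb01 (\<lambda>x. M * norm (g x) + C * (indicator {M<..} (norm (f x)) * norm (f x)))"
      using gi integrable_tail[OF f, of M] by auto
    fix x
    show "norm (g x * f x) \<le> M * norm (g x) + C * (indicator {M<..} (norm (f x)) * norm (f x))"
    proof (cases "M < norm (f x)")
      case True
      then have "norm (g x) * norm (f x) \<le> C * norm (f x)"
        using g(2) by (intro mult_right_mono) auto
      then show ?thesis using True M by (simp add: norm_mult add_increasing)
    next
      case False
      then have "norm (g x) * norm (f x) \<le> norm (g x) * M"
        by (intro mult_left_mono) auto
      then show ?thesis using False by (simp add: norm_mult mult.commute)
    qed
  qed
  also have "\<dots> = M * (\<integral>x. norm (g x) \<partial>leb01) + C * tail_integral M f"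
    unfolding tail_integral_def using gi integrable_tail[OF f, of M]
    by (subst Bochner_Integration.integral_add) auto
  finally show ?thesis .
qed

text \<open>The limit step offers one bound D for the whole sequence. This is essential for its use
  below: a functional on bounded functions that comes from the bidual is shown to be continuous only
  along uniformly bounded sequences.\<close>

lemma bounded_measurable_induct [consumes 2, case_names base add lim]:
  fixes g :: "'a \<Rightarrow> 'b::{real_normed_vector, second_countable_topology}"
  assumes g: "g \<in> borel_measurable M" "\<And>x. norm (g x) \<le> C"
    and base: "\<And>A c. A \<in> sets M \<Longrightarrow> P (\<lambda>x. indicator A x *\<^sub>R c)"
    and add: "\<And>f1 f2 C1 C2. f1 \<in> borel_measurable M \<Longrightarrow> (\<And>x. norm (f1 x) \<le> C1) \<Longrightarrow> P f1 \<Longrightarrow>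
      f2 \<in> borel_measurable M \<Longrightarrow> (\<And>x. norm (f2 x) \<le> C2) \<Longrightarrow> P f2 \<Longrightarrow> P (\<lambda>x. f1 x + f2 x)"
    and lim: "\<And>f s D. (\<And>i::nat. s i \<in> borel_measurable M) \<Longrightarrow> (\<And>i x. norm (s i x) \<le> D) \<Longrightarrow>
      (\<And>i. P (s i)) \<Longrightarrow> (\<And>x. x \<in> space M \<Longrightarrow> (\<lambda>i. s i x) \<longlonglongrightarrow> f x) \<Longrightarrow>
      f \<in> borel_measurable M \<Longrightarrow> (\<And>x. norm (f x) \<le> D) \<Longrightarrow> P f"
  shows "P g"
proof -
  have fin: "(\<exists>C. \<forall>x. norm (\<Sum>c\<in>F. indicator (A c) x *\<^sub>R c) \<le> C) \<and>
      P (\<lambda>x. \<Sum>c\<in>F. indicator (A c) x *\<^sub>R c)"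
    if "finite F" "\<And>c. A c \<in> sets M" for A and F :: "'b set"
    using that(1)
  proof (induction F)
    case empty
    then show ?case using base[of "{}" 0] by auto
  next
    case (insert c F)
    then obtain D where D: "\<And>x. norm (\<Sum>c\<in>F. indicator (A c) x *\<^sub>R c) \<le> D" by blast
    have b: "norm (indicator (A c) x *\<^sub>R c) \<le> norm c" for x
      by (simp add: indicator_def)
    have "P (\<lambda>x. indicator (A c) x *\<^sub>R c + (\<Sum>c\<in>F. indicator (A c) x *\<^sub>R c))"
    proof (rule add[OF _ b _ _ D])
      show "(\<lambda>x. indicator (A c) x *\<^sub>R c) \<in> borel_measurable M"
        "(\<lambda>x. \<Sum>c\<in>F. indicator (A c) x *\<^sub>R c) \<in> borel_measurable M"
        using that(2) by measurable
    qed (use that(2) insert.IH base in auto)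
    moreover have "norm (indicator (A c) x *\<^sub>R c + (\<Sum>c\<in>F. indicator (A c) x *\<^sub>R c)) \<le> norm c + D" for x
      by (rule norm_triangle_le[OF add_mono[OF b D]])
    ultimately show ?case
      unfolding sum.insert[OF insert.hyps] by blast
  qed
  obtain s where s: "\<And>i. simple_function M (s i)" "\<And>x. x \<in> space M \<Longrightarrow> (\<lambda>i. s i x) \<longlonglongrightarrow> g x"
    "\<And>i x. x \<in> space M \<Longrightarrow> norm (s i x) \<le> 2 * norm (g x)"
    using borel_measurable_implies_sequence_metric[OF g(1), of 0] unfolding norm_conv_dist by metis
  \<comment> \<open>t agrees with s on the space, but is visibly a finite sum of indicators and is 0
    off the space, where s is not controlled. The bound \<open>2 * C\<close> comes from
    \<open>norm (s i x) \<le> 2 * norm (g x)\<close>.\<close>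
  define t where "t i x = (\<Sum>c\<in>s i ` space M. indicator (s i -` {c} \<inter> space M) x *\<^sub>R c)" for i x
  have finite: "finite (s i ` space M)" for i
    using s(1) by (rule simple_functionD)
  have ts: "t i x = s i x" if "x \<in> space M" for i x
  proof -
    have "t i x = (\<Sum>c\<in>s i ` space M. if c = s i x then c else 0)"
      unfolding t_def using that by (intro sum.cong) auto
    then show ?thesis
      using finite that by simp
  qed
  have "C \<ge> 0" using g(2) norm_ge_zero order_trans by blast
  show "P g"
  proof (rule lim)
    show "P (t i)" for i
      unfolding t_def using fin[OF finite, of "\<lambda>c. s i -` {c} \<inter> space M" i] simple_functionD(2)[OF s(1)]
      by blast
    show "(\<lambda>i. t i x) \<longlonglongrightarrow> g x" if "x \<in> space M" for x
      using s(2) that by (simp add: ts)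
    show "t i \<in> borel_measurable M" for i
      using borel_measurable_simple_function[OF s(1)[of i]] ts by (subst measurable_cong[of M _ "s i"]) auto
    show "norm (t i x) \<le> 2 * C" for i x
    proof (cases "x \<in> space M")
      case True
      then show ?thesis
        using s(3)[OF True, of i] g(2)[of x] by (simp add: ts)
    next
      case False
      then show ?thesis using \<open>C \<ge> 0\<close> by (simp add: t_def)
    qed
    show "norm (g x) \<le> 2 * C" for x
      using g(2)[of x] \<open>C \<ge> 0\<close> by linarith
  qed (use g in auto)
qed

lemma abs_dual_norm_le:
  fixes \<phi> :: "'k::{real_normed_field, euclidean_space} l1 \<Rightarrow> 'k"
  assumes "0 \<in> Y" "\<And>y. y \<in> Y \<Longrightarrow> norm y \<le> 1 \<Longrightarrow> norm (\<phi> y) \<le> c"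
  shows "\<bar>dual_norm norm Y \<phi>\<bar> \<le> c"
proof -
  have "norm (\<phi> 0) \<le> dual_norm norm Y \<phi>"
    unfolding dual_norm_def using assms by (intro cSUP_upper) (auto simp: bdd_above_def)
  then have "0 \<le> dual_norm norm Y \<phi>"
    using norm_ge_zero order_trans by blast
  moreover have "dual_norm norm Y \<phi> \<le> c"
    unfolding dual_norm_def using assms by (intro cSUP_least) auto
  ultimately show ?thesis by simp
qed

text \<open>Every functional on Y is integration against some bounded g, so \<Psi> is known once it
  is known on the functionals \<open>\<Phi> g\<close>. Uniform integrability makes
  \<open>\<Psi> (\<Phi> g)\<close> continuous in g under uniformly bounded pointwise convergence,
  and therefore it is the integral of g against one integrable h.\<close>

lemma reflexive_l1_of_uniformly_integrable:
  fixes Y :: "'k::{real_normed_field, euclidean_space} l1 set"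
  assumes Y: "l1.subspace Y" "closed Y"
    and UI: "\<And>e. e > 0 \<Longrightarrow> \<exists>M\<ge>0. \<forall>y\<in>Y. norm y \<le> 1 \<longrightarrow> tail_integral M (rep_l1 y) \<le> e"
  shows "reflexive_l1 Y"
  unfolding reflexive_l1_def
proof
  interpret finite_measure leb01 by (rule finite_measure_leb01)
  fix \<Psi> assume \<Psi>: "\<Psi> \<in> l1_bidual Y"
  have \<Psi>_add: "\<Psi> (\<lambda>x. \<phi> x + \<phi>' x) = \<Psi> \<phi> + \<Psi> \<phi>'" if "\<phi> \<in> l1_dual Y" "\<phi>' \<in> l1_dual Y" for \<phi> \<phi>'
    using \<Psi> that by (simp add: l1_bidual_def dual_carrier_def)
  have \<Psi>_scale: "\<Psi> (\<lambda>x. c * \<phi> x) = c * \<Psi> \<phi>" if "\<phi> \<in> l1_dual Y" for c \<phi>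
    using \<Psi> that by (simp add: l1_bidual_def dual_carrier_def)
  obtain K0 where K0: "\<And>\<phi>. \<phi> \<in> l1_dual Y \<Longrightarrow> norm (\<Psi> \<phi>) \<le> K0 * dual_norm norm Y \<phi>"
    using \<Psi> unfolding l1_bidual_def dual_carrier_def by blast
  \<comment> \<open>The constant in the bidual bound may be negative; the absolute value makes the
    bound monotone in the estimate of the dual norm.\<close>
  define K where "K = \<bar>K0\<bar>"
  have "0 \<le> K" by (simp add: K_def)
  have Y0: "0 \<in> Y" by (rule l1.subspace_0[OF Y(1)])
  have \<Psi>_le: "norm (\<Psi> \<phi>) \<le> K * c"
    if "\<phi> \<in> l1_dual Y" "\<And>y. y \<in> Y \<Longrightarrow> norm y \<le> 1 \<Longrightarrow> norm (\<phi> y) \<le> c" for \<phi> c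
  proof -
    have "norm (\<Psi> \<phi>) \<le> \<bar>K0 * dual_norm norm Y \<phi>\<bar>"
      using K0[OF that(1)] by linarith
    also have "\<dots> \<le> K * c"
      using abs_dual_norm_le[of Y \<phi> c, OF Y0] that(2) by (simp add: abs_mult K_def mult_left_mono)
    finally show ?thesis .
  qed
  define bm where "bm g C \<longleftrightarrow> g \<in> borel_measurable leb01 \<and> (\<forall>x. norm (g x) \<le> C)" for g :: "real \<Rightarrow> 'k" and C
  \<comment> \<open>The value 0 off Y is the normalisation in \<open>l1_dual\<close>.
    Representatives are linear in y only almost everywhere, which is enough under the
    integral.\<close>
  define \<Phi> where "\<Phi> g y = (if y \<in> Y then (\<integral>x. g x * rep_l1 y x \<partial>leb01) else 0)" for g y
  have rep_add: "AE x in leb01. rep_l1 (y + z) x = rep_l1 y x + rep_l1 z x" for y z :: "'k l1"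
    using rep_abs_l1[of "\<lambda>x. rep_l1 y x + rep_l1 z x"]
    by (simp add: plus_abs_l1[symmetric] integrable_rep_l1 abs_rep_l1)
  have rep_scale: "AE x in leb01. rep_l1 (scale_l1 c y) x = c * rep_l1 y x" for c and y :: "'k l1"
    using rep_abs_l1[of "\<lambda>x. c * rep_l1 y x"]
    by (simp add: scale_abs_l1[symmetric] integrable_rep_l1 abs_rep_l1)
  have gi: "integrable leb01 (\<lambda>x. g x * f x)" if "bm g C" "integrable leb01 f" for g C f
    using that by (intro integrable_bounded_mult) (auto simp: bm_def)
  have [measurable]: "rep_l1 y \<in> borel_measurable leb01" for y :: "'k l1"
    using integrable_rep_l1[of y] by (rule borel_measurable_integrable)
  have \<Phi>_dual: "\<Phi> g \<in> l1_dual Y" if g: "bm g C" for g C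
  proof -
    have [measurable]: "g \<in> borel_measurable leb01" using g by (simp add: bm_def)
    have "\<Phi> g (y + z) = \<Phi> g y + \<Phi> g z" if yz: "y \<in> Y" "z \<in> Y" for y z
    proof -
      have "(\<integral>x. g x * rep_l1 (y + z) x \<partial>leb01) = (\<integral>x. g x * rep_l1 y x + g x * rep_l1 z x \<partial>leb01)"
        using rep_add[of y z]
        by (intro integral_cong_AE) (auto simp: distrib_left elim: eventually_mono)
      then show ?thesis
        using yz l1.subspace_add[OF Y(1) yz] gi[OF g integrable_rep_l1] by (simp add: \<Phi>_def)
    qed
    moreover have "\<Phi> g (scale_l1 c y) = c * \<Phi> g y" if y: "y \<in> Y" for c y
    proof -
      have "(\<integral>x. g x * rep_l1 (scale_l1 c y) x \<partial>leb01) = (\<integral>x. c * (g x * rep_l1 y x) \<partial>leb01)"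
        using rep_scale[of c y]
        by (intro integral_cong_AE) (auto simp: ac_simps elim: eventually_mono)
      then show ?thesis
        using y l1.subspace_scale[OF Y(1) y] by (simp add: \<Phi>_def)
    qed
    moreover have "norm (\<Phi> g y) \<le> C * norm y" if y: "y \<in> Y" for y
      using norm_integral_bounded_mult_le[OF integrable_rep_l1[of y], of g C] g y
        norm_abs_l1[OF integrable_rep_l1, of y]
      by (simp add: \<Phi>_def bm_def abs_rep_l1)
    ultimately show ?thesis
      by (auto simp: l1_dual_def dual_carrier_def \<Phi>_def intro!: exI[of _ C])
  qed
  have \<Phi>_add: "\<Phi> (\<lambda>x. g x + g' x) = (\<lambda>y. \<Phi> g y + \<Phi> g' y)" if "bm g C" "bm g' C'" for g g' C C'
    using gi[OF that(1) integrable_rep_l1] gi[OF that(2) integrable_rep_l1]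
    by (auto simp: \<Phi>_def distrib_right fun_eq_iff)
  have \<Phi>_scale: "\<Phi> (\<lambda>x. c * g x) = (\<lambda>y. c * \<Phi> g y)" for c g
    by (auto simp: \<Phi>_def fun_eq_iff mult.assoc)
  have \<Psi>\<Phi>_add: "\<Psi> (\<Phi> (\<lambda>x. g x + g' x)) = \<Psi> (\<Phi> g) + \<Psi> (\<Phi> g')" if "bm g C" "bm g' C'" for g g' C C'
    using \<Psi>_add[OF \<Phi>_dual[OF that(1)] \<Phi>_dual[OF that(2)]] \<Phi>_add[OF that] by simp
  \<comment> \<open>The only use of uniform integrability. It yields absolute continuity of the set
    function as well as the limit step for bounded functions.\<close>
  have \<Psi>\<Phi>_tail: "\<exists>M\<ge>0. \<forall>g C. bm g C \<longrightarrow> norm (\<Psi> (\<Phi> g)) \<le> K * (M * (\<integral>x. norm (g x) \<partial>leb01) + C * e)"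
    if "e > 0" for e
  proof -
    obtain M where M: "M \<ge> 0" "\<And>y. y \<in> Y \<Longrightarrow> norm y \<le> 1 \<Longrightarrow> tail_integral M (rep_l1 y) \<le> e"
      using UI[OF \<open>e > 0\<close>] by blast
    have "norm (\<Psi> (\<Phi> g)) \<le> K * (M * (\<integral>x. norm (g x) \<partial>leb01) + C * e)" if g: "bm g C" for g C
    proof (rule \<Psi>_le[OF \<Phi>_dual[OF g]])
      fix y assume y: "y \<in> Y" "norm y \<le> 1"
      have "0 \<le> norm (g 0)" by simp
      also have "\<dots> \<le> C" using g by (simp add: bm_def)
      finally have "C * tail_integral M (rep_l1 y) \<le> C * e"
        using M(2)[OF y] by (rule mult_left_mono[rotated])
      then show "norm (\<Phi> g y) \<le> M * (\<integral>x. norm (g x) \<partial>leb01) + C * e"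
        using norm_integral_mult_le_tail[OF integrable_rep_l1[of y], of g C M] g M(1) y
        by (simp add: \<Phi>_def bm_def)
    qed
    then show ?thesis using M(1) by blast
  qed
  define I where "I A = (\<lambda>x. indicator A x *\<^sub>R (1::'k))" for A :: "real set"
  have bmI: "bm (I A) 1" if "A \<in> sets leb01" for A
    using that by (auto simp: bm_def I_def indicator_def)
  have nI: "(\<integral>x. norm (I A x) \<partial>leb01) = measure leb01 A" if "A \<in> sets leb01" for A
    using that sets.sets_into_space[OF that] by (simp add: I_def Int_absorb2)
  obtain h where h: "integrable leb01 h"
    "\<And>A. A \<in> sets leb01 \<Longrightarrow> \<Psi> (\<Phi> (I A)) = (\<integral>x. indicator A x *\<^sub>R h x \<partial>leb01)"
  proof (rule bounded_additive_density_euclidean[of "\<lambda>A. \<Psi> (\<Phi> (I A))" K])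
    show "\<Psi> (\<Phi> (I (A \<union> B))) = \<Psi> (\<Phi> (I A)) + \<Psi> (\<Phi> (I B))"
      if "A \<in> sets leb01" "B \<in> sets leb01" "A \<inter> B = {}" for A B
    proof -
      have "I (A \<union> B) = (\<lambda>x. I A x + I B x)"
        using that(3) by (auto simp: I_def indicator_def fun_eq_iff)
      then show ?thesis
        using \<Psi>\<Phi>_add[OF bmI[OF that(1)] bmI[OF that(2)]] by simp
    qed
    show "norm (\<Psi> (\<Phi> (I A))) \<le> K" if A: "A \<in> sets leb01" for A
    proof -
      have "norm (\<Phi> (I A) y) \<le> 1" if y: "y \<in> Y" "norm y \<le> 1" for y
        using norm_integral_bounded_mult_le[OF integrable_rep_l1[of y], of "I A" 1] bmI[OF A] y
          norm_abs_l1[OF integrable_rep_l1, of y]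
        by (simp add: \<Phi>_def bm_def abs_rep_l1)
      then show ?thesis
        using \<Psi>_le[OF \<Phi>_dual[OF bmI[OF A]], of 1] by simp
    qed
    show "\<exists>d>0. \<forall>A\<in>sets leb01. measure leb01 A < d \<longrightarrow> norm (\<Psi> (\<Phi> (I A))) \<le> e" if e: "e > 0" for e
    proof -
      \<comment> \<open>The error is split in half: \<open>e'\<close> pays for the tail above M, and
        then d, chosen after M, pays for the part of height at most M.\<close>
      define e' where "e' = e / (2 * (K + 1))"
      have e': "e' > 0" "K * e' \<le> e / 2"
        using e \<open>0 \<le> K\<close> by (auto simp: e'_def field_simps add_pos_nonneg)
      obtain M where M: "M \<ge> 0" "\<And>g C. bm g C \<Longrightarrow> norm (\<Psi> (\<Phi> g)) \<le> K * (M * (\<integral>x. norm (g x) \<partial>leb01) + C * e')"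
        using \<Psi>\<Phi>_tail[OF e'(1)] by blast
      define d where "d = e / (2 * (K * M + 1))"
      have d: "d > 0" "K * M * d \<le> e / 2"
        using e \<open>0 \<le> K\<close> M(1) by (auto simp: d_def field_simps add_pos_nonneg)
      have "norm (\<Psi> (\<Phi> (I A))) \<le> e" if A: "A \<in> sets leb01" "measure leb01 A < d" for A
      proof -
        have "norm (\<Psi> (\<Phi> (I A))) \<le> K * (M * measure leb01 A + 1 * e')"
          using M(2)[OF bmI[OF A(1)]] nI[OF A(1)] by simp
        also have "\<dots> = K * M * measure leb01 A + K * e'"
          by (simp add: algebra_simps)
        also have "\<dots> \<le> K * M * d + K * e'"
          using A(2) M(1) \<open>0 \<le> K\<close> by (intro add_right_mono mult_left_mono) auto
        finally show ?thesis using d e' by simp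
      qed
      then show ?thesis using d(1) by blast
    qed
  qed blast
  have [measurable]: "h \<in> borel_measurable leb01" using h(1) by auto
  have rep\<Psi>: "\<Psi> (\<Phi> g) = (\<integral>x. g x * h x \<partial>leb01)" if "g \<in> borel_measurable leb01" "\<And>x. norm (g x) \<le> C" for g C
    using that
  proof (induction rule: bounded_measurable_induct)
    case (base A c)
    have "(\<lambda>x. indicator A x *\<^sub>R c) = (\<lambda>x. c * I A x)"
      by (simp add: I_def)
    then have "\<Psi> (\<Phi> (\<lambda>x. indicator A x *\<^sub>R c)) = c * \<Psi> (\<Phi> (I A))"
      by (simp add: \<Phi>_scale \<Psi>_scale[OF \<Phi>_dual[OF bmI[OF base]]])
    also have "\<dots> = (\<integral>x. c * (indicator A x *\<^sub>R h x) \<partial>leb01)"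
      unfolding h(2)[OF base] by (rule integral_mult_right_zero[symmetric])
    finally show ?case by simp
  next
    case (add f1 f2 C1 C2)
    then have b: "bm f1 C1" "bm f2 C2" by (auto simp: bm_def)
    show ?case
      using \<Psi>\<Phi>_add[OF b] add gi[OF b(1) h(1)] gi[OF b(2) h(1)] by (simp add: distrib_right)
  next
    case (lim f s D)
    note [measurable] = lim(1) lim(4)
    define r where "r i x = f x - s i x" for i x
    have bf: "bm f D" and bs: "bm (s i) D" for i
      using lim by (auto simp: bm_def)
    have br: "bm (r i) (2 * D)" for i
      unfolding bm_def
    proof (intro conjI allI)
      show "r i \<in> borel_measurable leb01"
        unfolding r_def by measurable
      show "norm (r i x) \<le> 2 * D" for x
        unfolding r_def using norm_triangle_ineq4[of "f x" "s i x"] lim(2)[of i x] lim(5)[of x] by linarith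
    qed
    then have [measurable]: "r i \<in> borel_measurable leb01" for i by (simp add: bm_def)
    have rD: "norm (r i x) \<le> 2 * D" for i x using br by (simp add: bm_def)
    have r0: "(\<lambda>i. r i x) \<longlonglongrightarrow> 0" if "x \<in> space leb01" for x
      using tendsto_diff[OF tendsto_const[of "f x"] lim(3)[OF that]] by (simp add: r_def)
    have l1: "(\<lambda>i. \<integral>x. norm (r i x) \<partial>leb01) \<longlonglongrightarrow> (\<integral>x. 0 \<partial>leb01)"
    proof (rule integral_dominated_convergence[where w = "\<lambda>x. 2 * D"])
      show "AE x in leb01. (\<lambda>i. norm (r i x)) \<longlonglongrightarrow> 0"
        by (intro AE_I2 tendsto_norm_zero r0)
    qed (use rD in auto)
    have l2: "(\<lambda>i. \<integral>x. r i x * h x \<partial>leb01) \<longlonglongrightarrow> (\<integral>x. 0 \<partial>leb01)"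
    proof (rule integral_dominated_convergence[where w = "\<lambda>x. 2 * D * norm (h x)"])
      show "AE x in leb01. (\<lambda>i. r i x * h x) \<longlonglongrightarrow> 0"
        by (intro AE_I2 tendsto_mult_left_zero r0)
      show "AE x in leb01. norm (r i x * h x) \<le> 2 * D * norm (h x)" for i
        using rD by (intro AE_I2) (auto simp: norm_mult intro!: mult_right_mono)
    qed (use h in auto)
    \<comment> \<open>The defect at f equals the defect at every difference \<open>r i\<close>,
      because it vanishes at \<open>s i\<close>. There the integral terms tend to 0, and the tail
      term is arbitrarily small.\<close>
    define \<delta> where "\<delta> g = \<Psi> (\<Phi> g) - (\<integral>x. g x * h x \<partial>leb01)" for g
    have \<delta>: "\<delta> f = \<Psi> (\<Phi> (r i)) - (\<integral>x. r i x * h x \<partial>leb01)" for i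
    proof -
      have "f = (\<lambda>x. r i x + s i x)" by (simp add: r_def)
      then have "\<Psi> (\<Phi> f) = \<Psi> (\<Phi> (r i)) + \<Psi> (\<Phi> (s i))"
        using \<Psi>\<Phi>_add[OF br[of i] bs[of i]] by simp
      moreover have "(\<integral>x. r i x * h x \<partial>leb01) = (\<integral>x. f x * h x \<partial>leb01) - (\<integral>x. s i x * h x \<partial>leb01)"
        using gi[OF bf h(1)] gi[OF bs[of i] h(1)] by (simp add: r_def left_diff_distrib)
      ultimately show ?thesis
        using lim(6)[of i] by (simp add: \<delta>_def)
    qed
    have small: "norm (\<delta> f) \<le> K * (2 * D * e)" if e: "e > 0" for e
    proof -
      obtain M where M: "M \<ge> 0" "\<And>g C. bm g C \<Longrightarrow> norm (\<Psi> (\<Phi> g)) \<le> K * (M * (\<integral>x. norm (g x) \<partial>leb01) + C * e)"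
        using \<Psi>\<Phi>_tail[OF e] by blast
      have "norm (\<delta> f) \<le> K * (M * (\<integral>x. norm (r i x) \<partial>leb01) + 2 * D * e) + norm (\<integral>x. r i x * h x \<partial>leb01)" for i
        using M(2)[OF br[of i]] norm_triangle_ineq4[of "\<Psi> (\<Phi> (r i))" "\<integral>x. r i x * h x \<partial>leb01"]
        unfolding \<delta>[of i] by linarith
      moreover have "(\<lambda>i. K * (M * (\<integral>x. norm (r i x) \<partial>leb01) + 2 * D * e) + norm (\<integral>x. r i x * h x \<partial>leb01))
          \<longlonglongrightarrow> K * (M * (\<integral>x. 0 \<partial>leb01) + 2 * D * e) + norm (\<integral>x. (0::'k) \<partial>leb01)"
        by (intro tendsto_intros l1 l2)
      ultimately have "norm (\<delta> f) \<le> K * (M * (\<integral>x. 0 \<partial>leb01) + 2 * D * e) + norm (\<integral>x. (0::'k) \<partial>leb01)"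
        by (intro LIMSEQ_le_const) auto
      then show ?thesis by simp
    qed
    have "0 \<le> D" using lim(5)[of 0] norm_ge_zero order_trans by blast
    have "norm (\<delta> f) \<le> 0 + e" if e: "e > 0" for e
    proof -
      have "K * (2 * D * (e / (2 * K * D + 1))) \<le> e"
        using e \<open>0 \<le> K\<close> \<open>0 \<le> D\<close> by (simp add: field_simps add_pos_nonneg)
      moreover have "e / (2 * K * D + 1) > 0"
        using e \<open>0 \<le> K\<close> \<open>0 \<le> D\<close> by (simp add: add_nonneg_pos)
      ultimately show ?thesis
        using small by fastforce
    qed
    then have "norm (\<delta> f) \<le> 0" by (rule field_le_epsilon)
    then show ?case by (simp add: \<delta>_def)
  qed
  have \<Phi>_rep: "\<Phi> g = (\<lambda>y. if y \<in> Y then \<psi> y else 0)"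
    if "\<And>f. integrable leb01 f \<Longrightarrow> \<psi> (abs_l1 f) = (\<integral>x. g x * f x \<partial>leb01)" for g \<psi>
    using that[OF integrable_rep_l1] by (auto simp: \<Phi>_def fun_eq_iff abs_rep_l1)
  \<comment> \<open>A functional that vanishes on Y but not at h would be integration against a
    bounded g with \<open>\<Phi> g\<close> zero; but then the integral of g against h is \<Psi> at
    zero, that is, 0.\<close>
  have hY: "abs_l1 h \<in> Y"
  proof (rule ccontr)
    assume "abs_l1 h \<notin> Y"
    then obtain \<psi> B where \<psi>: "\<And>x y. \<psi> (x + y) = \<psi> x + \<psi> y" "\<And>c x. \<psi> (scale_l1 c x) = c * \<psi> x"
      "\<And>x. norm (\<psi> x) \<le> B * norm x" "0 \<le> B" "\<And>x. x \<in> Y \<Longrightarrow> \<psi> x = 0" "\<psi> (abs_l1 h) \<noteq> (0::'k)"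
      using separating_functional_l1[OF Y] by blast
    obtain g C where g: "g \<in> borel_measurable leb01" "\<And>x. norm (g x) \<le> C"
      "\<And>f. integrable leb01 f \<Longrightarrow> \<psi> (abs_l1 f) = (\<integral>x. g x * f x \<partial>leb01)"
      using l1_functional_representation[OF \<psi>(1-4)] by blast
    have "\<Phi> g = (\<lambda>y. 0)"
      using \<Phi>_rep[OF g(3)] \<psi>(5) by (auto simp: fun_eq_iff)
    moreover have "\<Psi> (\<lambda>y. 0) = 0"
      using \<Psi>_scale[OF \<Phi>_dual[of "\<lambda>_. 0" 0], of 0] by (simp add: bm_def)
    ultimately have "\<psi> (abs_l1 h) = 0"
      using g(3)[OF h(1)] rep\<Psi>[OF g(1,2)] by simp
    with \<psi>(6) show False by simp
  qed
  \<comment> \<open>Extension to all of L_1 and representation by a bounded g bring \<phi> into the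
    form \<open>\<Phi> g\<close>, for which \<open>rep\<Psi>\<close> gives the value.\<close>
  have "\<Psi> \<phi> = \<phi> (abs_l1 h)" if \<phi>: "\<phi> \<in> l1_dual Y" for \<phi>
  proof -
    from \<phi> obtain B0 where B0: "\<And>y. y \<in> Y \<Longrightarrow> norm (\<phi> y) \<le> B0 * norm y"
      unfolding l1_dual_def dual_carrier_def by blast
    have B: "norm (\<phi> y) \<le> \<bar>B0\<bar> * norm y" if "y \<in> Y" for y
      using B0[OF that] mult_right_mono[OF abs_ge_self[of B0] norm_ge_zero[of y]] by linarith
    obtain \<psi> where \<psi>: "\<And>x y. \<psi> (x + y) = \<psi> x + \<psi> y" "\<And>c x. \<psi> (scale_l1 c x) = c * \<psi> x"
      "\<And>x. norm (\<psi> x) \<le> \<bar>B0\<bar> * norm x" "\<And>x. x \<in> Y \<Longrightarrow> \<psi> x = \<phi> x"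
    proof (rule hahn_banach_l1[OF Y(1), of \<phi> "\<bar>B0\<bar>"])
      show "\<phi> (x + y) = \<phi> x + \<phi> y" if "x \<in> Y" "y \<in> Y" for x y
        using \<phi> that by (simp add: l1_dual_def dual_carrier_def)
      show "\<phi> (scale_l1 c x) = c * \<phi> x" if "x \<in> Y" for c x
        using \<phi> that by (simp add: l1_dual_def dual_carrier_def)
    qed (use B in auto)
    obtain g C where g: "g \<in> borel_measurable leb01" "\<And>x. norm (g x) \<le> C"
      "\<And>f. integrable leb01 f \<Longrightarrow> \<psi> (abs_l1 f) = (\<integral>x. g x * f x \<partial>leb01)"
      using l1_functional_representation[OF \<psi>(1-3) abs_ge_zero] by blast
    have "\<Phi> g = \<phi>"
      using \<Phi>_rep[OF g(3)] \<psi>(4) \<phi> by (auto simp: fun_eq_iff l1_dual_def dual_carrier_def)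
    then show ?thesis
      using g(3)[OF h(1)] rep\<Psi>[OF g(1,2)] \<psi>(4)[OF hY] by simp
  qed
  then show "\<exists>x\<in>Y. \<forall>\<phi>\<in>l1_dual Y. \<Psi> \<phi> = \<phi> x"
    using hY by blast
qed

section \<open>Gliding humps\<close>

definition norm_on :: "'a measure \<Rightarrow> 'a set \<Rightarrow> ('a \<Rightarrow> 'b::euclidean_space) \<Rightarrow> real"
  where "norm_on M A f = (\<integral>x. indicator A x * norm (f x) \<partial>M)"

lemma integrable_norm_on:
  fixes f :: "'a \<Rightarrow> 'b::euclidean_space"
  assumes "integrable M f" "A \<in> sets M"
  shows "integrable M (\<lambda>x. indicator A x * norm (f x))"
  using integrable_mult_indicator[OF assms(2) integrable_norm[OF assms(1)]] by simp

lemma norm_on_mono: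
  assumes "integrable M f" "A \<in> sets M" "B \<in> sets M" "A \<subseteq> B"
  shows "norm_on M A f \<le> norm_on M B f"
  unfolding norm_on_def using assms
  by (intro integral_mono integrable_norm_on) (auto simp: indicator_def)

lemma norm_on_Un:
  assumes "integrable M f" "A \<in> sets M" "B \<in> sets M" "A \<inter> B = {}"
  shows "norm_on M (A \<union> B) f = norm_on M A f + norm_on M B f"
proof -
  have "norm_on M (A \<union> B) f = (\<integral>x. indicator A x * norm (f x) + indicator B x * norm (f x) \<partial>M)"
    unfolding norm_on_def using assms(4)
    by (intro Bochner_Integration.integral_cong) (auto simp: indicator_def)
  then show ?thesis
    unfolding norm_on_def using assms by (simp add: integrable_norm_on)
qed

lemma norm_on_Diff:
  assumes "integrable M f" "A \<in> sets M" "B \<in> sets M" "A \<subseteq> B"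
  shows "norm_on M (B - A) f = norm_on M B f - norm_on M A f"
  using norm_on_Un[of M f A "B - A"] assms by (simp add: Un_absorb1)

lemma norm_on_space: "norm_on M (space M) f = (\<integral>x. norm (f x) \<partial>M)"
  unfolding norm_on_def by (intro Bochner_Integration.integral_cong) auto

lemma norm_on_le:
  assumes "integrable M f" "A \<in> sets M"
  shows "norm_on M A f \<le> (\<integral>x. norm (f x) \<partial>M)"
  using norm_on_mono[OF assms(1,2) sets.top] sets.sets_into_space[OF assms(2)]
  by (simp add: norm_on_space)

lemma norm_on_scaleR: "norm_on M A (\<lambda>x. c *\<^sub>R f x) = \<bar>c\<bar> * norm_on M A f"
proof -
  have "norm_on M A (\<lambda>x. c *\<^sub>R f x) = (\<integral>x. \<bar>c\<bar> * (indicator A x * norm (f x)) \<partial>M)"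
    by (simp add: norm_on_def ac_simps)
  then show ?thesis by (simp add: norm_on_def)
qed

lemma norm_on_add_le:
  assumes "integrable M f" "integrable M g" "A \<in> sets M"
  shows "norm_on M A (\<lambda>x. f x + g x) \<le> norm_on M A f + norm_on M A g"
proof -
  have "norm_on M A (\<lambda>x. f x + g x) \<le> (\<integral>x. indicator A x * norm (f x) + indicator A x * norm (g x) \<partial>M)"
    unfolding norm_on_def using assms
    by (intro integral_mono Bochner_Integration.integrable_add integrable_norm_on)
      (auto simp: indicator_def norm_triangle_ineq)
  then show ?thesis
    unfolding norm_on_def using assms by (simp add: integrable_norm_on)
qed

lemma norm_on_sum_le:
  assumes "finite I" "\<And>i. i \<in> I \<Longrightarrow> integrable M (f i)" "A \<in> sets M"
  shows "norm_on M A (\<lambda>x. \<Sum>i\<in>I. f i x) \<le> (\<Sum>i\<in>I. norm_on M A (f i))"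
  using assms(1,2)
proof (induction I)
  case empty
  then show ?case by (simp add: norm_on_def)
next
  case (insert i I)
  have "norm_on M A (\<lambda>x. f i x + (\<Sum>i\<in>I. f i x)) \<le> norm_on M A (f i) + norm_on M A (\<lambda>x. \<Sum>i\<in>I. f i x)"
    using insert.prems assms(3) by (intro norm_on_add_le) auto
  moreover have "norm_on M A (\<lambda>x. \<Sum>i\<in>I. f i x) \<le> (\<Sum>i\<in>I. norm_on M A (f i))"
    using insert.prems by (intro insert.IH) simp
  ultimately show ?case
    using insert.hyps by simp
qed

lemma (in finite_measure) norm_on_bounded:
  assumes "f \<in> borel_measurable M" "A \<in> sets M" "\<And>x. x \<in> A \<Longrightarrow> norm (f x) \<le> C"
  shows "norm_on M A f \<le> C * measure M A"
proof -
  note [measurable] = assms(1,2)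
  have i: "integrable M (indicator A :: _ \<Rightarrow> real)"
    using integrable_mult_indicator[OF assms(2), of "\<lambda>_. 1::real"] by simp
  have C: "indicator A x * norm (f x) \<le> C * indicator A x" for x
    using assms(3)[of x] by (auto simp: indicator_def)
  have "norm_on M A f \<le> (\<integral>x. C * indicator A x \<partial>M)"
    unfolding norm_on_def
  proof (rule integral_mono)
    show "integrable M (\<lambda>x. indicator A x * norm (f x))"
    proof (rule Bochner_Integration.integrable_bound)
      show "integrable M (\<lambda>x. C * indicator A x)" using i by simp
      show "AE x in M. norm (indicator A x * norm (f x)) \<le> norm (C * indicator A x)"
      proof (rule AE_I2)
        fix x
        show "norm (indicator A x * norm (f x)) \<le> norm (C * indicator A x)"
          using C[of x] by (simp add: indicator_def)
      qed
    qed simp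
  qed (use i C in auto)
  then show ?thesis
    using sets.sets_into_space[OF assms(2)] by (simp add: Int_absorb2)
qed

text \<open>Above a large height n the function has mass at most \<open>e / 2\<close>, by dominated
  convergence; below it, mass is at most n times the measure of the set.\<close>

lemma (in finite_measure) norm_on_absolutely_continuous:
  fixes f :: "'a \<Rightarrow> 'b::euclidean_space"
  assumes f: "integrable M f" and e: "e > 0"
  obtains d where "d > 0" "\<And>A. A \<in> sets M \<Longrightarrow> measure M A \<le> d \<Longrightarrow> norm_on M A f \<le> e"
proof -
  have [measurable]: "f \<in> borel_measurable M" using f by auto
  define T where "T n = {x \<in> space M. real n < norm (f x)}" for n
  have [measurable]: "T n \<in> sets M" for n by (simp add: T_def)
  have "(\<lambda>n. norm_on M (T n) f) \<longlonglongrightarrow> (\<integral>x. 0 \<partial>M)"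
    unfolding norm_on_def
  proof (rule integral_dominated_convergence[where w = "\<lambda>x. norm (f x)"])
    show "AE x in M. (\<lambda>n. indicator (T n) x * norm (f x)) \<longlonglongrightarrow> 0"
    proof (rule AE_I2)
      fix x
      obtain n0 where "norm (f x) < real n0" using reals_Archimedean2 by blast
      then have "indicator (T n) x * norm (f x) = 0" if "n \<ge> n0" for n
        using that by (auto simp: T_def indicator_def)
      then show "(\<lambda>n. indicator (T n) x * norm (f x)) \<longlonglongrightarrow> 0"
        by (intro tendsto_eventually eventually_sequentiallyI[of n0])
    qed
  qed (use f in \<open>auto simp: indicator_def\<close>)
  then have "(\<lambda>n. norm_on M (T n) f) \<longlonglongrightarrow> 0" by simp
  then obtain n where "norm (norm_on M (T n) f - 0) < e / 2"
    using LIMSEQ_D[of _ 0 "e/2"] e by fastforce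
  then have n: "norm_on M (T n) f \<le> e / 2" by simp
  define d where "d = e / (2 * (real n + 1))"
  show thesis
  proof
    show "d > 0" using e by (simp add: d_def)
    fix A assume [measurable]: "A \<in> sets M" and A: "measure M A \<le> d"
    have "norm_on M A f = norm_on M (A \<inter> T n) f + norm_on M (A - T n) f"
      using norm_on_Un[OF f, of "A \<inter> T n" "A - T n"] by (simp add: Int_Diff_Un Int_Diff_disjoint)
    also have "norm_on M (A \<inter> T n) f \<le> e / 2"
      using norm_on_mono[OF f, of "A \<inter> T n" "T n"] n by simp
    also have "norm_on M (A - T n) f \<le> real n * measure M (A - T n)"
      using sets.sets_into_space[of A M] by (intro norm_on_bounded) (auto simp: T_def)
    also have "\<dots> \<le> real n * d"
      using A finite_measure_mono[of "A - T n" A] by (intro mult_left_mono) auto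
    also have "\<dots> \<le> e / 2"
      using e by (simp add: d_def field_simps)
    finally show "norm_on M A f \<le> e" by simp
  qed
qed

text \<open>The next set is always chosen after the function before it, and so small that the
  function hardly charges it. P is left open because this is applied twice: to functions of nearly
  maximal mass above a height, and to normalised concentrated functions.\<close>

lemma (in finite_measure) gliding_hump:
  fixes P :: "nat \<Rightarrow> ('a \<Rightarrow> 'b::euclidean_space) \<Rightarrow> 'a set \<Rightarrow> bool"
  assumes ex: "\<And>n \<eta>. \<eta> > 0 \<Longrightarrow> \<exists>f A. P n f A \<and> measure M A \<le> \<eta>"
    and P: "\<And>n f A. P n f A \<Longrightarrow> integrable M f" "\<And>n f A. P n f A \<Longrightarrow> A \<in> sets M"
    and e: "\<And>n. e n > 0" and \<eta>: "\<eta> > 0"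
  obtains f A where "\<And>n. P n (f n) (A n)" "measure M (\<Union>n. A n) \<le> \<eta>"
    "\<And>n. norm_on M (\<Union>m\<in>{n<..}. A m) (f n) \<le> e n"
proof -
  \<comment> \<open>In a state \<open>(f, A, d)\<close> the number d limits the measure of the next
    set. Since d at least halves in each step, all later sets together have measure at most
    \<open>2 * d\<close>, on which f is negligible. The total is at most \<eta>: one third for
    \<open>A 0\<close> and twice a third for the others.\<close>
  define Q where "Q n s \<longleftrightarrow> (case s of (f, A, d) \<Rightarrow> P n f A \<and> 0 < d \<and> measure M A \<le> \<eta> / 3 \<and> d \<le> \<eta> / 3 \<and>
      (\<forall>B\<in>sets M. measure M B \<le> 2 * d \<longrightarrow> norm_on M B f \<le> e n))" for n s
  have step: "\<exists>f A d'. Q n (f, A, d') \<and> measure M A \<le> d \<and> d' \<le> d / 2" if d: "d > 0" for n d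
  proof -
    obtain f A where fA: "P n f A" "measure M A \<le> min d (\<eta> / 3)"
      using ex[of "min d (\<eta> / 3)" n] d \<eta> by (meson divide_pos_pos min_less_iff_conj zero_less_numeral)
    obtain c where c: "c > 0" "\<And>B. B \<in> sets M \<Longrightarrow> measure M B \<le> c \<Longrightarrow> norm_on M B f \<le> e n"
      using norm_on_absolutely_continuous[OF P(1)[OF fA(1)] e] by blast
    show ?thesis
      using fA c d \<eta> by (intro exI[of _ f] exI[of _ A] exI[of _ "min (c / 2) (min (d / 2) (\<eta> / 3))"])
        (auto simp: Q_def)
  qed
  have "\<exists>s. \<forall>n. Q n (s n) \<and> (measure M (fst (snd (s (Suc n)))) \<le> snd (snd (s n)) \<and>
      snd (snd (s (Suc n))) \<le> snd (snd (s n)) / 2)"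
  proof (rule dependent_nat_choice)
    show "\<exists>s. Q 0 s" using step[of 1 0] by auto
    show "\<exists>s'. Q (Suc n) s' \<and> (measure M (fst (snd s')) \<le> snd (snd s) \<and> snd (snd s') \<le> snd (snd s) / 2)"
      if "Q n s" for s n
    proof -
      have "snd (snd s) > 0" using that by (auto simp: Q_def)
      from step[OF this, of "Suc n"] obtain f A d'
        where "Q (Suc n) (f, A, d')" "measure M A \<le> snd (snd s)" "d' \<le> snd (snd s) / 2" by blast
      then show ?thesis by (intro exI[of _ "(f, A, d')"]) simp
    qed
  qed
  then obtain s where s: "\<And>n. Q n (s n)" "\<And>n. measure M (fst (snd (s (Suc n)))) \<le> snd (snd (s n))"
    "\<And>n. snd (snd (s (Suc n))) \<le> snd (snd (s n)) / 2" by blast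
  define f A d where "f n = fst (s n)" and "A n = fst (snd (s n))" and "d n = snd (snd (s n))" for n
  have Q: "P n (f n) (A n)" "0 < d n" "measure M (A n) \<le> \<eta> / 3" "d n \<le> \<eta> / 3"
      "\<And>B. B \<in> sets M \<Longrightarrow> measure M B \<le> 2 * d n \<Longrightarrow> norm_on M B (f n) \<le> e n" for n
    using s(1)[of n] by (auto simp: Q_def f_def A_def d_def split: prod.splits)
  have A[measurable]: "A n \<in> sets M" for n
    using P(2)[OF Q(1)] .
  have dd: "d (n + k) \<le> d n / 2 ^ k" for n k
  proof (induction k)
    case (Suc k)
    have "d (Suc (n + k)) \<le> d (n + k) / 2"
      using s(3) by (simp add: d_def)
    also have "\<dots> \<le> d n / 2 ^ k / 2"
      using Suc by (intro divide_right_mono) auto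
    finally show ?case by (simp add: field_simps)
  qed simp
  have tail: "measure M (\<Union>m\<in>{n<..}. A m) \<le> 2 * d n" for n
  proof -
    have le: "measure M (A (Suc (n + k))) \<le> d n * (1/2) ^ k" for k
      using s(2)[of "n + k"] dd[of n k] by (simp add: A_def d_def power_divide)
    have gs: "(\<lambda>k. d n * (1/2) ^ k) sums (d n * 2)"
      using sums_mult[OF geometric_sums[of "1/2::real"], of "d n"] by simp
    then have sm: "summable (\<lambda>k. measure M (A (Suc (n + k))))"
      by (intro summable_comparison_test'[OF sums_summable, OF gs, of 0]) (use le in auto)
    have eq: "(\<Union>m\<in>{n<..}. A m) = (\<Union>k. A (Suc (n + k)))"
    proof -
      have "{n<..} = range (\<lambda>k. Suc (n + k))"
        by (auto simp: image_iff less_iff_Suc_add)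
      then show ?thesis by auto
    qed
    have "measure M (\<Union>k. A (Suc (n + k))) \<le> (\<Sum>k. measure M (A (Suc (n + k))))"
      by (rule finite_measure_subadditive_countably) (use sm in auto)
    also have "\<dots> \<le> (\<Sum>k. d n * (1/2) ^ k)"
      using le sm gs by (intro suminf_le) (auto simp: sums_iff)
    also have "\<dots> = 2 * d n"
      using gs by (simp add: sums_iff)
    finally show ?thesis by (simp add: eq)
  qed
  show thesis
  proof
    show "P n (f n) (A n)" for n by (rule Q)
    show "norm_on M (\<Union>m\<in>{n<..}. A m) (f n) \<le> e n" for n
      by (rule Q(5)[OF _ tail]) auto
    have "(\<Union>n. A n) = (\<Union>n\<in>insert 0 {0<..}. A n)"
      by (rule SUP_cong) auto
    then have "measure M (\<Union>n. A n) \<le> measure M (A 0) + measure M (\<Union>m\<in>{0<..}. A m)"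
      using measure_Un_le[of "A 0" M "\<Union>m\<in>{0<..}. A m"] by simp
    then show "measure M (\<Union>n. A n) \<le> \<eta>"
      using tail[of 0] Q(3,4)[of 0] by linarith
  qed
qed

text \<open>In each summand the mass on \<open>D n\<close> counts positively and that on the rest of
  E negatively. Pointwise this is the reverse triangle inequality at a point of \<open>D k\<close>,
  where the k-th term is set against all others; at a point of E in no \<open>D n\<close> the left
  side is at most 0.\<close>

lemma sum_norm_on_disjoint_le:
  fixes f :: "nat \<Rightarrow> 'a \<Rightarrow> 'b::euclidean_space"
  assumes f: "\<And>n. integrable M (f n)" and E: "E \<in> sets M"
    and D: "\<And>n. D n \<in> sets M" "\<And>n. D n \<subseteq> E" "disjoint_family D"
  shows "(\<Sum>n<N. \<bar>a n\<bar> * (2 * norm_on M (D n) (f n) - norm_on M E (f n)))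
    \<le> norm_on M E (\<lambda>x. \<Sum>n<N. a n *\<^sub>R f n x)"
proof -
  define h where "h n x = \<bar>a n\<bar> * (2 * (indicator (D n) x * norm (f n x)) - indicator E x * norm (f n x))" for n x
  have hi: "integrable M (h n)" for n
    unfolding h_def
    by (intro integrable_mult_right Bochner_Integration.integrable_diff integrable_norm_on f E D(1))
  have "(\<Sum>n<N. h n x) \<le> indicator E x * norm (\<Sum>n<N. a n *\<^sub>R f n x)" for x
  proof (cases "x \<in> E")
    case True
    show ?thesis
    proof (cases "\<exists>k<N. x \<in> D k")
      case True
      then obtain k where k: "k < N" "x \<in> D k" by blast
      have other: "x \<notin> D n" if "n \<noteq> k" for n
        using D(3) k that unfolding disjoint_family_on_def by blast
      have "(\<Sum>n<N. h n x) = h k x + (\<Sum>n\<in>{..<N} - {k}. h n x)"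
        using k by (simp add: sum.remove)
      also have "\<dots> = norm (a k *\<^sub>R f k x) - (\<Sum>n\<in>{..<N} - {k}. norm (a n *\<^sub>R f n x))"
        using k \<open>x \<in> E\<close> other by (simp add: h_def sum_negf algebra_simps)
      also have "\<dots> \<le> norm (a k *\<^sub>R f k x) - norm (\<Sum>n\<in>{..<N} - {k}. a n *\<^sub>R f n x)"
        using norm_sum[of "\<lambda>n. a n *\<^sub>R f n x" "{..<N} - {k}"] by linarith
      also have "\<dots> \<le> norm (a k *\<^sub>R f k x + (\<Sum>n\<in>{..<N} - {k}. a n *\<^sub>R f n x))"
        by (rule norm_diff_ineq)
      also have "a k *\<^sub>R f k x + (\<Sum>n\<in>{..<N} - {k}. a n *\<^sub>R f n x) = (\<Sum>n<N. a n *\<^sub>R f n x)"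
        using k by (simp add: sum.remove)
      finally show ?thesis using \<open>x \<in> E\<close> by simp
    next
      case False
      then have "(\<Sum>n<N. h n x) \<le> 0"
        using \<open>x \<in> E\<close> by (intro sum_nonpos) (auto simp: h_def)
      also have "\<dots> \<le> indicator E x * norm (\<Sum>n<N. a n *\<^sub>R f n x)" by simp
      finally show ?thesis .
    qed
  next
    case False
    then have "x \<notin> D n" for n using D(2) by blast
    then show ?thesis using False by (simp add: h_def)
  qed
  then have "(\<integral>x. (\<Sum>n<N. h n x) \<partial>M) \<le> norm_on M E (\<lambda>x. \<Sum>n<N. a n *\<^sub>R f n x)"
    unfolding norm_on_def using hi f E by (intro integral_mono integrable_norm_on) auto
  moreover have "(\<integral>x. h n x \<partial>M) = \<bar>a n\<bar> * (2 * norm_on M (D n) (f n) - norm_on M E (f n))" for n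
    unfolding h_def norm_on_def using f E D(1) by (simp add: integrable_norm_on)
  ultimately show ?thesis
    using hi by simp
qed

text \<open>By the parallelogram identity, the squared L_2 norms of \<open>v + b N\<close> and
  \<open>v - b N\<close> average to the sum of those of v and \<open>b N\<close>. One of the two
  signs therefore adds at most \<open>C\<^sup>2 * measure M (space M)\<close>.\<close>

lemma (in finite_measure) exists_signs_integral_sum_le:
  fixes b :: "nat \<Rightarrow> 'a \<Rightarrow> 'b::euclidean_space"
  assumes b: "\<And>n. b n \<in> borel_measurable M" "\<And>n x. norm (b n x) \<le> C"
  shows "\<exists>s::nat \<Rightarrow> real. (\<forall>n. \<bar>s n\<bar> = 1) \<and>
    (\<integral>x. (norm (\<Sum>n<N. s n *\<^sub>R b n x))\<^sup>2 \<partial>M) \<le> real N * (C\<^sup>2 * measure M (space M))"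
proof (induction N)
  case 0
  show ?case by (intro exI[of _ "\<lambda>_. 1"]) simp
next
  case (Suc N)
  then obtain s where s: "\<And>n. \<bar>s n\<bar> = 1"
    "(\<integral>x. (norm (\<Sum>n<N. s n *\<^sub>R b n x))\<^sup>2 \<partial>M) \<le> real N * (C\<^sup>2 * measure M (space M))" by blast
  note [measurable] = b(1)
  define v where "v x = (\<Sum>n<N. s n *\<^sub>R b n x)" for x
  have [measurable]: "v \<in> borel_measurable M" unfolding v_def by measurable
  have vb: "norm (v x) \<le> real N * C" for x
  proof -
    have "norm (v x) \<le> (\<Sum>n<N. norm (s n *\<^sub>R b n x))"
      unfolding v_def by (rule norm_sum)
    also have "\<dots> \<le> (\<Sum>n<N. C)" using b(2) s(1) by (intro sum_mono) simp
    finally show ?thesis by simp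
  qed
  have sq: "integrable M (\<lambda>x. (norm (u x))\<^sup>2)"
    if [measurable]: "u \<in> borel_measurable M" and "\<And>x. norm (u x) \<le> D" for u :: "'a \<Rightarrow> 'b" and D
    using that(2) by (intro integrable_const_bound[of _ "D\<^sup>2"] AE_I2) (auto intro: power_mono)
  have tri: "norm (v x + c *\<^sub>R b N x) \<le> real N * C + C" if "\<bar>c\<bar> = 1" for c x
    using norm_triangle_le[OF add_mono[OF vb[of x], of "norm (c *\<^sub>R b N x)" C]] b(2)[of N x] that by simp
  have i: "integrable M (\<lambda>x. (norm (v x + c *\<^sub>R b N x))\<^sup>2)" if "\<bar>c\<bar> = 1" for c
    using tri[OF that] by (intro sq) auto
  have iv: "integrable M (\<lambda>x. (norm (v x))\<^sup>2)" using vb by (intro sq) auto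
  have ib: "integrable M (\<lambda>x. (norm (b N x))\<^sup>2)" using b by (intro sq) auto
  have "(\<integral>x. (norm (v x + 1 *\<^sub>R b N x))\<^sup>2 \<partial>M) + (\<integral>x. (norm (v x + (-1) *\<^sub>R b N x))\<^sup>2 \<partial>M)
      = (\<integral>x. (norm (v x + 1 *\<^sub>R b N x))\<^sup>2 + (norm (v x + (-1) *\<^sub>R b N x))\<^sup>2 \<partial>M)"
    using i[of 1] i[of "-1"] by (subst Bochner_Integration.integral_add) auto
  also have "\<dots> = (\<integral>x. 2 * (norm (v x))\<^sup>2 + 2 * (norm (b N x))\<^sup>2 \<partial>M)"
    by (intro Bochner_Integration.integral_cong refl)
      (simp add: power2_norm_eq_inner inner_add_left inner_add_right inner_diff_left inner_diff_right inner_commute)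
  also have "\<dots> = 2 * (\<integral>x. (norm (v x))\<^sup>2 \<partial>M) + 2 * (\<integral>x. (norm (b N x))\<^sup>2 \<partial>M)"
    using iv ib by simp
  also have "(\<integral>x. (norm (b N x))\<^sup>2 \<partial>M) \<le> (\<integral>x. C\<^sup>2 \<partial>M)"
    using ib b(2) by (intro integral_mono) (auto intro: power_mono)
  finally have sum: "(\<integral>x. (norm (v x + 1 *\<^sub>R b N x))\<^sup>2 \<partial>M) + (\<integral>x. (norm (v x + (-1) *\<^sub>R b N x))\<^sup>2 \<partial>M)
      \<le> 2 * (real N * (C\<^sup>2 * measure M (space M))) + 2 * (C\<^sup>2 * measure M (space M))"
    using s(2) by (simp add: v_def ac_simps)
  obtain c :: real where c: "\<bar>c\<bar> = 1"
    "(\<integral>x. (norm (v x + c *\<^sub>R b N x))\<^sup>2 \<partial>M) \<le> real N * (C\<^sup>2 * measure M (space M)) + C\<^sup>2 * measure M (space M)"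
  proof (cases "(\<integral>x. (norm (v x + 1 *\<^sub>R b N x))\<^sup>2 \<partial>M) \<le> real N * (C\<^sup>2 * measure M (space M)) + C\<^sup>2 * measure M (space M)")
    case True
    then show ?thesis by (intro that[of 1]) auto
  next
    case False
    then show ?thesis using sum by (intro that[of "-1"]) linarith+
  qed
  have "(\<Sum>n<N. (s(N := c)) n *\<^sub>R b n x) = v x" for x
    unfolding v_def by (intro sum.cong) auto
  then have eq: "(\<Sum>n<Suc N. (s(N := c)) n *\<^sub>R b n x) = v x + c *\<^sub>R b N x" for x
    by simp
  show ?case
  proof (intro exI conjI allI)
    show "\<bar>(s(N := c)) n\<bar> = 1" for n
      using s(1) c(1) by simp
    show "(\<integral>x. (norm (\<Sum>n<Suc N. (s(N := c)) n *\<^sub>R b n x))\<^sup>2 \<partial>M) \<le> real (Suc N) * (C\<^sup>2 * measure M (space M))"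
      unfolding eq using c(2) by (simp add: distrib_right)
  qed
qed

text \<open>The squared L_2 norm of the signed sum grows only linearly in N, so that of the average
  is of order 1/N.\<close>

lemma (in finite_measure) exists_signed_average_small:
  fixes b :: "nat \<Rightarrow> 'a \<Rightarrow> 'b::euclidean_space"
  assumes b: "\<And>n. b n \<in> borel_measurable M" "\<And>n x. norm (b n x) \<le> C" and e: "e > 0"
  obtains N and s :: "nat \<Rightarrow> real" where "N > 0" "\<And>n. \<bar>s n\<bar> = 1"
    "(\<integral>x. norm (\<Sum>n<N. (s n / real N) *\<^sub>R b n x) \<partial>M) \<le> e"
proof -
  define m where "m = measure M (space M)"
  have "m \<ge> 0" by (simp add: m_def)
  \<comment> \<open>t balances the two terms of \<open>amgm\<close>: the constant term integrates to
    at most \<open>e / 2\<close>, and N is then taken so large that the quadratic term does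
    too.\<close>
  define t where "t = e / (m + 1)"
  have t: "t > 0" "t * m \<le> e"
    using e \<open>m \<ge> 0\<close> by (auto simp: t_def field_simps)
  obtain N :: nat where N: "C\<^sup>2 * m / (t * e) < real N"
    using reals_Archimedean2 by blast
  have "0 \<le> C\<^sup>2 * m / (t * e)" using t e \<open>m \<ge> 0\<close> by simp
  then have "real N > 0" using N by linarith
  then have N0: "N > 0" by simp
  have Nle: "C\<^sup>2 * m / (real N * t) \<le> e"
    using N N0 t e by (simp add: field_simps)
  obtain s :: "nat \<Rightarrow> real" where s: "\<And>n. \<bar>s n\<bar> = 1"
    "(\<integral>x. (norm (\<Sum>n<N. s n *\<^sub>R b n x))\<^sup>2 \<partial>M) \<le> real N * (C\<^sup>2 * m)"
    using exists_signs_integral_sum_le[of b C N, OF b] unfolding m_def by blast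
  define v where "v x = (\<Sum>n<N. s n *\<^sub>R b n x)" for x
  note [measurable] = b(1)
  have [measurable]: "v \<in> borel_measurable M" unfolding v_def by measurable
  have vb: "norm (v x) \<le> real N * C" for x
  proof -
    have "norm (v x) \<le> (\<Sum>n<N. norm (s n *\<^sub>R b n x))"
      unfolding v_def by (rule norm_sum)
    also have "\<dots> \<le> (\<Sum>n<N. C)" using b(2) s(1) by (intro sum_mono) simp
    finally show ?thesis by simp
  qed
  have iv: "integrable M v"
    using vb by (intro integrable_const_bound[of _ "real N * C"]) auto
  have iv2: "integrable M (\<lambda>x. (norm (v x))\<^sup>2)"
    using vb by (intro integrable_const_bound[of _ "(real N * C)\<^sup>2"] AE_I2) (auto intro: power_mono)
  define w where "w x = norm (v x) / real N" for x
  \<comment> \<open>This pointwise inequality passes from L_2 to L_1 in place of the Cauchy-Schwarz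
    inequality for integrals.\<close>
  have amgm: "w x \<le> t / 2 + (1 / (2 * t)) * (w x)\<^sup>2" for x
  proof -
    have "0 \<le> (w x - t)\<^sup>2 / (2 * t)" using t by simp
    also have "\<dots> = t / 2 + (1 / (2 * t)) * (w x)\<^sup>2 - w x"
      using t by (simp add: power2_eq_square field_simps)
    finally show ?thesis by simp
  qed
  have iw2: "integrable M (\<lambda>x. (w x)\<^sup>2)"
    using iv2 by (simp add: w_def power_divide)
  have "(\<integral>x. w x \<partial>M) \<le> (\<integral>x. t / 2 + (1 / (2 * t)) * (w x)\<^sup>2 \<partial>M)"
    using amgm iv iw2 by (intro integral_mono) (auto simp: w_def)
  also have "\<dots> = t / 2 * m + (1 / (2 * t)) * (\<integral>x. (w x)\<^sup>2 \<partial>M)"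
    using iw2 by (simp add: m_def ac_simps)
  also have "(\<integral>x. (w x)\<^sup>2 \<partial>M) = (\<integral>x. (norm (v x))\<^sup>2 \<partial>M) / (real N)\<^sup>2"
    by (simp add: w_def power_divide)
  also have "(1 / (2 * t)) * \<dots> \<le> (1 / (2 * t)) * (real N * (C\<^sup>2 * m) / (real N)\<^sup>2)"
    using s(2) t by (intro mult_left_mono divide_right_mono) (auto simp: v_def)
  also have "\<dots> = C\<^sup>2 * m / (real N * t) / 2"
    using N0 by (simp add: power2_eq_square field_simps)
  also have "t / 2 * m + C\<^sup>2 * m / (real N * t) / 2 \<le> e / 2 + e / 2"
    using Nle t(2) by (intro add_mono divide_right_mono) simp_all
  finally have "(\<integral>x. w x \<partial>M) \<le> e" by simp
  moreover have "norm (\<Sum>n<N. (s n / real N) *\<^sub>R b n x) = w x" for x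
  proof -
    have "(\<Sum>n<N. (s n / real N) *\<^sub>R b n x) = (1 / real N) *\<^sub>R v x"
      by (simp add: v_def scaleR_sum_right divide_inverse ac_simps)
    then show ?thesis by (simp add: w_def)
  qed
  ultimately show thesis
    using that[OF N0, of s] s(1) by simp
qed

section \<open>Concentration on small sets\<close>

lemma norm_on_le_Diff_add:
  assumes f: "integrable M f" and A: "A \<in> sets M" "B \<in> sets M"
  shows "norm_on M A f \<le> norm_on M (A - B) f + norm_on M B f"
proof -
  have "norm_on M A f = norm_on M (A - B) f + norm_on M (A \<inter> B) f"
    using norm_on_Un[OF f, of "A - B" "A \<inter> B"] A by (auto simp: Un_Diff_Int)
  then show ?thesis
    using norm_on_mono[OF f, of "A \<inter> B" B] A by simp
qed

lemma disjoint_family_Diff_UN_greaterThan: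
  fixes A :: "nat \<Rightarrow> 'a set"
  shows "disjoint_family (\<lambda>n. A n - (\<Union>k\<in>{n<..}. A k))"
  unfolding disjoint_family_on_def
proof (intro ballI impI)
  fix m n :: nat
  assume "m \<noteq> n"
  then have "m < n \<or> n < m" by auto
  then show "(A m - (\<Union>k\<in>{m<..}. A k)) \<inter> (A n - (\<Union>k\<in>{n<..}. A k)) = {}"
    by auto
qed

text \<open>The signed average g has mass at most \<open>3 * e\<close> off E and norm at least
  \<open>\<delta> / 2\<close>. Normalising it thus leaves a mass off E of order
  \<open>e / \<delta>\<close>, and \<delta> does not depend on \<epsilon> or \<eta>.\<close>

lemma (in finite_measure) exists_concentrated:
  fixes F :: "('a \<Rightarrow> 'b::euclidean_space) set"
  assumes add: "\<And>f g. f \<in> F \<Longrightarrow> g \<in> F \<Longrightarrow> (\<lambda>x. f x + g x) \<in> F"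
    and scale: "\<And>c f. f \<in> F \<Longrightarrow> (\<lambda>x. c *\<^sub>R f x) \<in> F"
    and int: "\<And>f. f \<in> F \<Longrightarrow> integrable M f"
    and e0: "e0 > 0"
    and tails: "\<And>m::nat. \<exists>f\<in>F. (\<integral>x. norm (f x) \<partial>M) \<le> 1 \<and>
      e0 < norm_on M {x \<in> space M. real m < norm (f x)} f"
    and \<epsilon>: "\<epsilon> > 0" and \<eta>: "\<eta> > 0"
  obtains f E where "f \<in> F" "E \<in> sets M" "measure M E \<le> \<eta>" "(\<integral>x. norm (f x) \<partial>M) = 1"
    "norm_on M (space M - E) f \<le> \<epsilon>"
proof -
  define ball where "ball = {f \<in> F. (\<integral>x. norm (f x) \<partial>M) \<le> 1}"
  define L where "L m f = {x \<in> space M. real m < norm (f x)}" for m and f :: "'a \<Rightarrow> 'b"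
  have Lm: "L m f \<in> sets M" if "f \<in> F" for m f
  proof -
    have [measurable]: "f \<in> borel_measurable M" using int[OF that] by auto
    show ?thesis unfolding L_def by measurable
  qed
  define \<rho> where "\<rho> m = (SUP f\<in>ball. norm_on M (L m f) f)" for m
  have le1: "norm_on M (L m f) f \<le> 1" if "f \<in> ball" for m f
    using that norm_on_le[OF int[of f] Lm[of f m]] by (auto simp: ball_def)
  have bdd: "bdd_above ((\<lambda>f. norm_on M (L m f) f) ` ball)" for m
    using le1 by (auto simp: bdd_above_def)
  have \<rho>_upper: "norm_on M (L m f) f \<le> \<rho> m" if "f \<in> ball" for m f
    unfolding \<rho>_def using that bdd by (intro cSUP_upper)
  have \<rho>_e0: "e0 \<le> \<rho> m" for m
    using tails[of m] \<rho>_upper[of _ m] by (force simp: ball_def L_def)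
  have ne: "ball \<noteq> {}" using tails[of 0] by (auto simp: ball_def)
  \<comment> \<open>\<open>\<rho> m\<close> is the largest mass that the unit ball carries above
    height m, as a supremum; it decreases in m, so \<delta> is its limit.\<close>
  define \<delta> where "\<delta> = (INF m. \<rho> m)"
  have \<delta>: "\<delta> > 0"
    using e0 \<rho>_e0 cINF_greatest[of UNIV e0 \<rho>] by (simp add: \<delta>_def)
  have \<delta>_le: "\<delta> \<le> \<rho> m" for m
    unfolding \<delta>_def using \<rho>_e0 by (intro cINF_lower) (auto simp: bdd_below_def)
  \<comment> \<open>\<open>e \<le> \<delta> / 12\<close> keeps \<open>\<delta> - 6 * e\<close> at or
    above \<open>\<delta> / 2\<close>, and \<open>e \<le> \<delta> * \<epsilon> / 12\<close> makes
    \<open>3 * e\<close> small against \<epsilon> times the norm of g.\<close>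
  define e where "e = \<delta> * min 1 \<epsilon> / 12"
  have e: "e > 0" "e \<le> \<delta> / 12" "e \<le> \<delta> * \<epsilon> / 12"
    using \<delta> \<epsilon> by (auto simp: e_def min_def)
  obtain m where m: "\<rho> m < \<delta> + e"
  proof -
    have "(INF m. \<rho> m) < \<delta> + e" using e by (simp add: \<delta>_def)
    then show thesis
      using that \<rho>_e0 by (subst (asm) cINF_less_iff) (auto simp: bdd_below_def)
  qed
  define P where "P n f A \<longleftrightarrow> f \<in> ball \<and> A \<in> sets M \<and> A \<subseteq> L m f \<and> \<delta> - e \<le> norm_on M A f" for n :: nat and f A
  have ex: "\<exists>f A. P n f A \<and> measure M A \<le> \<eta>'" if \<eta>': "\<eta>' > 0" for n \<eta>'
  proof -
    obtain k0 :: nat where k0: "1 / \<eta>' < real k0" using reals_Archimedean2 by blast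
    \<comment> \<open>Above any height k some function of the ball has mass more than
      \<open>\<delta> - e\<close>, and by Chebyshev's inequality the set where it exceeds k has
      measure at most \<open>1 / k\<close>.\<close>
    define k where "k = max m k0"
    have k: "k \<ge> m" "1 / \<eta>' < real k" using k0 by (auto simp: k_def)
    have "\<delta> - e < \<rho> k" using \<delta>_le[of k] e by simp
    then obtain f where f: "f \<in> ball" "\<delta> - e < norm_on M (L k f) f"
      unfolding \<rho>_def using bdd ne by (subst (asm) less_cSUP_iff) auto
    then have fF: "f \<in> F" by (simp add: ball_def)
    have "real k * measure M (L k f) \<le> norm_on M (L k f) f"
    proof -
      have i: "integrable M (indicator (L k f) :: _ \<Rightarrow> real)"
        using integrable_mult_indicator[OF Lm[OF fF, of k], of "\<lambda>_. 1::real"] by simp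
      have "(\<integral>x. real k * indicator (L k f) x \<partial>M) \<le> norm_on M (L k f) f"
        unfolding norm_on_def
      proof (rule integral_mono)
        show "integrable M (\<lambda>x. real k * indicator (L k f) x)" using i by simp
        show "integrable M (\<lambda>x. indicator (L k f) x * norm (f x))"
          by (intro integrable_norm_on int fF Lm)
      qed (auto simp: indicator_def L_def)
      then show ?thesis
        using sets.sets_into_space[OF Lm[OF fF, of k]] by (simp add: Int_absorb2)
    qed
    also have "\<dots> \<le> 1" by (rule le1[OF f(1)])
    finally have "real k * measure M (L k f) \<le> 1" .
    also have "1 \<le> real k * \<eta>'" using k(2) \<eta>' by (simp add: field_simps)
    finally have "real k * measure M (L k f) \<le> real k * \<eta>'" .
    moreover have "real k > 0" using k(2) \<eta>' by (meson divide_pos_pos less_trans zero_less_one)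
    ultimately have "measure M (L k f) \<le> \<eta>'" by simp
    moreover have "L k f \<subseteq> L m f" using k(1) by (auto simp: L_def)
    ultimately show ?thesis
      using f Lm[OF fF] unfolding P_def by (intro exI[of _ f] exI[of _ "L k f"]) auto
  qed
  \<comment> \<open>On a set of measure at most \<open>\<eta>'\<close> the parts of height at most m
    have mass at most e, so E will carry hardly anything of them.\<close>
  define \<eta>' where "\<eta>' = min \<eta> (e / (real m + 1))"
  have \<eta>': "\<eta>' > 0" "\<eta>' \<le> \<eta>" using \<eta> e by (auto simp: \<eta>'_def)
  have m\<eta>': "real m * \<eta>' \<le> e"
  proof -
    have "real m * \<eta>' \<le> real m * (e / (real m + 1))"
      by (intro mult_left_mono) (auto simp: \<eta>'_def)
    also have "\<dots> \<le> e" using e by (simp add: field_simps)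
    finally show ?thesis .
  qed
  obtain f A where fA: "\<And>n. P n (f n) (A n)" "measure M (\<Union>n. A n) \<le> \<eta>'"
    "\<And>n. norm_on M (\<Union>m\<in>{n<..}. A m) (f n) \<le> e"
  proof (rule gliding_hump[of P "\<lambda>_. e" \<eta>', OF ex])
    show "integrable M f" if "P n f A" for n f A
      using that int by (auto simp: P_def ball_def)
    show "A \<in> sets M" if "P n f A" for n f A
      using that by (auto simp: P_def)
  qed (use e \<eta>' in auto)
  have f: "f n \<in> ball" "f n \<in> F" "integrable M (f n)" and A[measurable]: "A n \<in> sets M"
    and AL: "A n \<subseteq> L m (f n)" and fAn: "\<delta> - e \<le> norm_on M (A n) (f n)" for n
    using fA(1)[of n] int by (auto simp: P_def ball_def)
  have [measurable]: "f n \<in> borel_measurable M" for n using f(3)[of n] by auto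
  define E where "E = (\<Union>n. A n)"
  have E[measurable]: "E \<in> sets M" by (simp add: E_def)
  have mE: "measure M E \<le> \<eta>'" using fA(2) by (simp add: E_def)
  have AE: "A n \<subseteq> E" for n by (auto simp: E_def)
  \<comment> \<open>The choice of m pays off: above height m there is at most
    \<open>\<delta> + e\<close>, of which \<open>A n\<close> already holds
    \<open>\<delta> - e\<close>.\<close>
  have mid: "norm_on M (L m (f n) - A n) (f n) \<le> 2 * e" for n
    using norm_on_Diff[OF f(3)[of n] A Lm[OF f(2)] AL[of n]] \<rho>_upper[OF f(1), of m n] m fAn[of n] by linarith
  define b where "b n x = (if norm (f n x) \<le> real m then f n x else 0)" for n x
  have [measurable]: "b n \<in> borel_measurable M" for n unfolding b_def by measurable
  have bb: "norm (b n x) \<le> real m" for n x by (simp add: b_def)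
  have bi: "integrable M (b n)" for n
    using bb by (intro integrable_const_bound[of _ "real m"] AE_I2) auto
  obtain N and s :: "nat \<Rightarrow> real" where N: "N > 0" and s: "\<And>n. \<bar>s n\<bar> = 1"
    "(\<integral>x. norm (\<Sum>n<N. (s n / real N) *\<^sub>R b n x) \<partial>M) \<le> e"
    using exists_signed_average_small[of b "real m" e] bb e by auto
  define c where "c n = s n / real N" for n
  have absc: "\<bar>c n\<bar> = 1 / real N" for n using s(1) by (simp add: c_def abs_divide)
  define g where "g x = (\<Sum>n<N. c n *\<^sub>R f n x)" for x
  have gF: "g \<in> F"
  proof -
    have "(\<lambda>x. \<Sum>n<Suc k. c n *\<^sub>R f n x) \<in> F" for k
    proof (induction k)
      case (Suc k)
      show ?case
        using add[OF Suc scale[OF f(2), of "c (Suc k)" "Suc k"]] by simp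
    next
      case 0
      show ?case
        using scale[OF f(2), of "c 0" 0] by simp
    qed
    moreover obtain k where "N = Suc k"
      using N gr0_conv_Suc by blast
    moreover have "g = (\<lambda>x. \<Sum>n<N. c n *\<^sub>R f n x)"
      by (rule ext) (rule g_def)
    ultimately show ?thesis
      by (simp only:)
  qed
  have gi: "integrable M g" by (rule int[OF gF])
  \<comment> \<open>Off E, g splits into the average of the truncations \<open>b n\<close>, which is
    at most e by the choice of signs, and that of the parts above height m outside
    \<open>A n\<close>, at most \<open>2 * e\<close> by \<open>mid\<close> whatever the
    signs.\<close>
  have off: "norm_on M (space M - E) g \<le> 3 * e"
  proof -
    have fb: "integrable M (\<lambda>x. f n x - b n x)" for n using f(3) bi by simp
    have *: "norm_on M (space M - E) (\<lambda>x. f n x - b n x) \<le> 2 * e" for n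
    proof -
      have "norm_on M (space M - E) (\<lambda>x. f n x - b n x) \<le> norm_on M (L m (f n) - A n) (f n)"
        unfolding norm_on_def
      proof (rule integral_mono)
        show "integrable M (\<lambda>x. indicator (space M - E) x * norm (f n x - b n x))"
          by (intro integrable_norm_on fb) auto
        show "integrable M (\<lambda>x. indicator (L m (f n) - A n) x * norm (f n x))"
          using f(3) Lm[OF f(2)] by (intro integrable_norm_on) auto
        fix x assume "x \<in> space M"
        then show "indicator (space M - E) x * norm (f n x - b n x) \<le> indicator (L m (f n) - A n) x * norm (f n x)"
          using AE[of n] by (auto simp: indicator_def b_def L_def)
      qed
      then show ?thesis using mid[of n] by linarith
    qed
    have "g = (\<lambda>x. (\<Sum>n<N. c n *\<^sub>R b n x) + (\<Sum>n<N. c n *\<^sub>R (f n x - b n x)))"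
      by (simp add: g_def fun_eq_iff sum.distrib[symmetric] scaleR_diff_right)
    then have "norm_on M (space M - E) g \<le> norm_on M (space M - E) (\<lambda>x. \<Sum>n<N. c n *\<^sub>R b n x)
        + norm_on M (space M - E) (\<lambda>x. \<Sum>n<N. c n *\<^sub>R (f n x - b n x))"
      using fb bi norm_on_add_le[of M "\<lambda>x. \<Sum>n<N. c n *\<^sub>R b n x" "\<lambda>x. \<Sum>n<N. c n *\<^sub>R (f n x - b n x)" "space M - E"]
      by simp
    also have "norm_on M (space M - E) (\<lambda>x. \<Sum>n<N. c n *\<^sub>R b n x) \<le> e"
      using norm_on_le[of M "\<lambda>x. \<Sum>n<N. c n *\<^sub>R b n x" "space M - E"] bi s(2) by (simp add: c_def)
    also have "norm_on M (space M - E) (\<lambda>x. \<Sum>n<N. c n *\<^sub>R (f n x - b n x))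
        \<le> (\<Sum>n<N. norm_on M (space M - E) (\<lambda>x. c n *\<^sub>R (f n x - b n x)))"
      using fb by (intro norm_on_sum_le) auto
    also have "\<dots> \<le> (\<Sum>n<N. (1 / real N) * (2 * e))"
      unfolding norm_on_scaleR absc using * by (intro sum_mono mult_left_mono) auto
    also have "\<dots> = 2 * e" using N by simp
    finally show ?thesis by simp
  qed
  define D where "D n = A n - (\<Union>k\<in>{n<..}. A k)" for n
  have D[measurable]: "D n \<in> sets M" for n by (simp add: D_def)
  have "disjoint_family D"
    unfolding D_def by (rule disjoint_family_Diff_UN_greaterThan)
  \<comment> \<open>The removal of the later sets costs at most e on \<open>D n\<close>, which
    counts twice. The rest of E holds at most \<open>2 * e\<close> above height m and e below it. A
    last e is lost because \<open>A n\<close> has only mass \<open>\<delta> - e\<close>.\<close>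
  have fE: "2 * norm_on M (D n) (f n) - norm_on M E (f n) \<ge> \<delta> - 6 * e" for n
  proof -
    have D1: "norm_on M (A n) (f n) \<le> norm_on M (D n) (f n) + e"
      unfolding D_def using norm_on_le_Diff_add[OF f(3)[of n] A, of "\<Union>k\<in>{n<..}. A k" n] fA(3)[of n] by simp
    have "norm_on M E (f n) = norm_on M (A n) (f n) + norm_on M (E - A n) (f n)"
      using norm_on_Diff[OF f(3)[of n] A E AE[of n]] by simp
    also have "E - A n = (E - A n) \<inter> L m (f n) \<union> ((E - A n) - L m (f n))" by auto
    also have "norm_on M \<dots> (f n) = norm_on M ((E - A n) \<inter> L m (f n)) (f n) + norm_on M ((E - A n) - L m (f n)) (f n)"
      using Lm[OF f(2), of m n] by (intro norm_on_Un f) auto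
    also have "norm_on M ((E - A n) \<inter> L m (f n)) (f n) \<le> norm_on M (L m (f n) - A n) (f n)"
      using Lm[OF f(2), of m n] by (intro norm_on_mono f) auto
    also have "\<dots> \<le> 2 * e" by (rule mid)
    also have "norm_on M ((E - A n) - L m (f n)) (f n) \<le> real m * measure M ((E - A n) - L m (f n))"
      using Lm[OF f(2), of m n] sets.sets_into_space[OF E] by (intro norm_on_bounded) (auto simp: L_def)
    also have "\<dots> \<le> real m * \<eta>'"
      by (intro mult_left_mono order_trans[OF finite_measure_mono mE]) auto
    also have "\<dots> \<le> e" by (rule m\<eta>')
    finally have "norm_on M E (f n) \<le> norm_on M (A n) (f n) + (2 * e + e)" by simp
    then show ?thesis using D1 fAn[of n] by linarith
  qed
  have "\<delta> - 6 * e = (\<Sum>n<N. \<bar>c n\<bar> * (\<delta> - 6 * e))"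
    using N by (simp add: absc)
  also have "\<dots> \<le> (\<Sum>n<N. \<bar>c n\<bar> * (2 * norm_on M (D n) (f n) - norm_on M E (f n)))"
    using fE by (intro sum_mono mult_left_mono) auto
  also have "\<dots> \<le> norm_on M E g"
    unfolding g_def
  proof (intro sum_norm_on_disjoint_le f(3) E D \<open>disjoint_family D\<close>)
    show "D n \<subseteq> E" for n
      using AE[of n] by (auto simp: D_def)
  qed
  also have "\<dots> \<le> (\<integral>x. norm (g x) \<partial>M)"
    by (rule norm_on_le[OF gi E])
  finally have ng: "\<delta> / 2 \<le> (\<integral>x. norm (g x) \<partial>M)"
    using e by linarith
  define k where "k = (\<integral>x. norm (g x) \<partial>M)"
  have k: "k > 0" "\<delta> / 2 \<le> k" using ng \<delta> by (auto simp: k_def)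
  show thesis
  proof
    show "(\<lambda>x. (1 / k) *\<^sub>R g x) \<in> F" by (rule scale[OF gF])
    show "E \<in> sets M" by (rule E)
    show "measure M E \<le> \<eta>" using mE \<eta>' by simp
    show "(\<integral>x. norm ((1 / k) *\<^sub>R g x) \<partial>M) = 1"
      using k by (simp add: k_def[symmetric])
    have "3 * e \<le> \<epsilon> * (\<delta> / 2)"
      using e(3) mult_pos_pos[OF \<delta> \<epsilon>] by (simp add: mult.commute[of \<epsilon>])
    also have "\<dots> \<le> \<epsilon> * k"
      using k(2) \<epsilon> by (intro mult_left_mono) auto
    finally show "norm_on M (space M - E) (\<lambda>x. (1 / k) *\<^sub>R g x) \<le> \<epsilon>"
      unfolding norm_on_scaleR using off k(1) by (simp add: field_simps)
  qed
qed

text \<open>\<open>f n\<close> loses at most \<open>e n / 4\<close> off \<open>A n\<close> and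
  \<open>e n / 4\<close> to the later sets. So \<open>D n\<close> carries at least
  \<open>1 - e n / 2\<close> of the unit mass, and twice this minus 1 is the coefficient
  \<open>1 - e n\<close>.\<close>

lemma (in finite_measure) exists_asymptotically_isometric_l1:
  fixes F :: "('a \<Rightarrow> 'b::euclidean_space) set"
  assumes int: "\<And>f. f \<in> F \<Longrightarrow> integrable M f"
    and conc: "\<And>\<epsilon> \<eta>. \<epsilon> > 0 \<Longrightarrow> \<eta> > 0 \<Longrightarrow> \<exists>f\<in>F. \<exists>E\<in>sets M. measure M E \<le> \<eta> \<and>
      (\<integral>x. norm (f x) \<partial>M) = 1 \<and> norm_on M (space M - E) f \<le> \<epsilon>"
    and e: "\<And>n. e n > 0"
  obtains f :: "nat \<Rightarrow> 'a \<Rightarrow> 'b" where "\<And>n. f n \<in> F" "\<And>n. (\<integral>x. norm (f n x) \<partial>M) = 1"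
    "\<And>a N. (\<Sum>n<N. (1 - e n) * \<bar>a n\<bar>) \<le> (\<integral>x. norm (\<Sum>n<N. a n *\<^sub>R f n x) \<partial>M)"
proof -
  define P where "P n f A \<longleftrightarrow> f \<in> F \<and> A \<in> sets M \<and> (\<integral>x. norm (f x) \<partial>M) = 1 \<and>
    norm_on M (space M - A) f \<le> e n / 4" for n f A
  obtain f A where fA: "\<And>n. P n (f n) (A n)" "measure M (\<Union>n. A n) \<le> 1"
    "\<And>n. norm_on M (\<Union>m\<in>{n<..}. A m) (f n) \<le> e n / 4"
  proof (rule gliding_hump[of P "\<lambda>n. e n / 4" 1])
    show "\<exists>f A. P n f A \<and> measure M A \<le> \<eta>" if "\<eta> > 0" for n \<eta>
      using conc[of "e n / 4" \<eta>] e[of n] that unfolding P_def by auto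
  qed (use e int in \<open>auto simp: P_def\<close>)
  have f: "f n \<in> F" "integrable M (f n)" "(\<integral>x. norm (f n x) \<partial>M) = 1"
    and A[measurable]: "A n \<in> sets M" and off: "norm_on M (space M - A n) (f n) \<le> e n / 4" for n
    using fA(1)[of n] int by (auto simp: P_def)
  define D where "D n = A n - (\<Union>k\<in>{n<..}. A k)" for n
  have D[measurable]: "D n \<in> sets M" for n by (simp add: D_def)
  have disj: "disjoint_family D"
    unfolding D_def by (rule disjoint_family_Diff_UN_greaterThan)
  have Dn: "1 - e n \<le> 2 * norm_on M (D n) (f n) - norm_on M (space M) (f n)" for n
  proof -
    have D1: "norm_on M (A n) (f n) \<le> norm_on M (D n) (f n) + e n / 4"
      unfolding D_def using norm_on_le_Diff_add[OF f(2)[of n] A, of "\<Union>k\<in>{n<..}. A k" n] fA(3)[of n] by simp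
    have "norm_on M (space M - A n) (f n) = 1 - norm_on M (A n) (f n)"
      using norm_on_Diff[OF f(2)[of n] A[of n] sets.top sets.sets_into_space[OF A]] f(3)[of n]
      by (simp add: norm_on_space)
    then show ?thesis
      using D1 off[of n] f(3)[of n] by (simp add: norm_on_space)
  qed
  show thesis
  proof (rule that[of f])
    show "(\<Sum>n<N. (1 - e n) * \<bar>a n\<bar>) \<le> (\<integral>x. norm (\<Sum>n<N. a n *\<^sub>R f n x) \<partial>M)" for a N
    proof -
      have "(\<Sum>n<N. (1 - e n) * \<bar>a n\<bar>) \<le> (\<Sum>n<N. \<bar>a n\<bar> * (2 * norm_on M (D n) (f n) - norm_on M (space M) (f n)))"
        using Dn by (intro sum_mono) (simp add: mult.commute mult_left_mono)
      also have "\<dots> \<le> norm_on M (space M) (\<lambda>x. \<Sum>n<N. a n *\<^sub>R f n x)"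
        using f(2) D disj sets.sets_into_space[OF D] by (intro sum_norm_on_disjoint_le) auto
      finally show ?thesis by (simp add: norm_on_space)
    qed
  qed (use f in auto)
qed

section \<open>The shift on an \<open>l\<^sub>1\<close> basis\<close>

text \<open>If d is the difference of two coefficient sequences, the shifted difference has norm at
  most the sum of \<open>\<bar>d n\<bar> * norm (g (Suc n))\<close>. By \<open>gap\<close> this is
  less than the sum of \<open>\<mu> n * \<bar>d n\<bar>\<close>, which by \<open>lower\<close> is at
  most the norm before the shift. The uniform bound \<kappa> makes the norm equivalent to that of
  l_1 on the coefficients.\<close>

lemma fixed_point_free_contraction:
  fixes g :: "nat \<Rightarrow> 'a::banach" and \<mu> :: "nat \<Rightarrow> real"
  assumes Y: "subspace Y" "closed Y" "\<And>n. g n \<in> Y"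
    and \<kappa>: "0 < \<kappa>" "\<And>n. \<kappa> \<le> \<mu> n"
    and gap: "\<And>n. norm (g (Suc n)) < \<mu> n"
    and lower: "\<And>a N. (\<Sum>n<N. \<mu> n * \<bar>a n\<bar>) \<le> norm (\<Sum>n<N. a n *\<^sub>R g n)"
  obtains C T where "C \<subseteq> Y" "C \<noteq> {}" "closed C" "bounded C" "convex C" "T \<in> C \<rightarrow> C"
    "\<And>x y. x \<in> C \<Longrightarrow> y \<in> C \<Longrightarrow> x \<noteq> y \<Longrightarrow> norm (T x - T y) < norm (x - y)"
    "\<And>x. x \<in> C \<Longrightarrow> T x \<noteq> x"
proof -
  \<comment> \<open>The lower estimate at a unit coefficient vector. Together with
    \<open>gap\<close> it makes the norms of the \<open>g n\<close> decrease, and so bounds them by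
    that of \<open>g 0\<close>.\<close>
  have \<mu>g: "\<mu> n \<le> norm (g n)" for n
  proof -
    have "\<mu> n = (\<Sum>i<Suc n. \<mu> i * \<bar>if i = n then 1 else 0\<bar>)"
      by (simp add: if_distrib[of abs] if_distrib cong: if_cong)
    also have "\<dots> \<le> norm (\<Sum>i<Suc n. (if i = n then 1 else 0) *\<^sub>R g i)"
      by (rule lower)
    also have "(\<Sum>i<Suc n. (if i = n then 1 else 0) *\<^sub>R g i) = g n"
      by (simp add: if_distrib[of "\<lambda>c. c *\<^sub>R _"] cong: if_cong)
    finally show ?thesis .
  qed
  have "decseq (\<lambda>n. norm (g n))"
    using \<mu>g gap by (intro decseq_SucI) (meson less_eq_real_def order_less_le_trans)
  then have g0: "norm (g n) \<le> norm (g 0)" for n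
    using decseqD[of "\<lambda>n. norm (g n)" 0 n] by simp
  define K where "K = norm (g 0)"
  have gK: "norm (g n) \<le> K" for n
    using g0 by (simp add: K_def)
  have "0 \<le> K" by (simp add: K_def)
  have \<mu>K: "\<mu> n \<le> K" for n
    using \<mu>g[of n] gK[of n] by linarith
  \<comment> \<open>A is l_1, and G is the isomorphism of it onto a subspace of Y, with bounds
    \<open>Gupper\<close> and \<open>G\<kappa>\<close>.\<close>
  define A where "A = {a::nat \<Rightarrow> real. summable (\<lambda>n. \<bar>a n\<bar>)}"
  define G where "G a = (\<Sum>n. a n *\<^sub>R g n)" for a
  have nsum: "summable (\<lambda>n. \<bar>a n\<bar> * norm (h n))" if "a \<in> A" "\<And>n. norm (h n) \<le> K" for a and h :: "nat \<Rightarrow> 'a"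
  proof (rule summable_comparison_test')
    show "summable (\<lambda>n. \<bar>a n\<bar> * K)"
      using that(1) by (simp add: A_def summable_mult2)
    show "norm (\<bar>a n\<bar> * norm (h n)) \<le> \<bar>a n\<bar> * K" if "n \<ge> 0" for n
      using \<open>\<And>n. norm (h n) \<le> K\<close> by (simp add: mult_left_mono)
  qed
  have gsum: "summable (\<lambda>n. a n *\<^sub>R g n)" if "a \<in> A" for a
    using nsum[OF that gK] by (intro summable_norm_cancel[of "\<lambda>n. a n *\<^sub>R g n"]) simp
  have \<mu>sum: "summable (\<lambda>n. \<mu> n * \<bar>a n\<bar>)" if "a \<in> A" for a
  proof (rule summable_comparison_test')
    show "summable (\<lambda>n. K * \<bar>a n\<bar>)"
      using that by (simp add: A_def summable_mult)
    show "norm (\<mu> n * \<bar>a n\<bar>) \<le> K * \<bar>a n\<bar>" if "n \<ge> 0" for n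
      using \<mu>K[of n] \<kappa>(1) \<kappa>(2)[of n] by (simp add: abs_mult mult_right_mono)
  qed
  have diffA: "(\<lambda>n. a n - b n) \<in> A" if "a \<in> A" "b \<in> A" for a b
    unfolding A_def using that
    by (auto simp: A_def intro!: summable_comparison_test'[OF summable_add[of "\<lambda>n. \<bar>a n\<bar>" "\<lambda>n. \<bar>b n\<bar>"], of 0])
  have Gdiff: "G (\<lambda>n. a n - b n) = G a - G b" if "a \<in> A" "b \<in> A" for a b
    unfolding G_def using suminf_diff[OF gsum[OF that(1)] gsum[OF that(2)]]
    by (simp add: scaleR_left_diff_distrib)
  have GY: "G a \<in> Y" if "a \<in> A" for a
  proof (rule closed_sequentially[OF Y(2)])
    show "(\<Sum>n<N. a n *\<^sub>R g n) \<in> Y" for N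
      using Y by (intro subspace_sum subspace_scale) auto
    show "(\<lambda>N. \<Sum>n<N. a n *\<^sub>R g n) \<longlonglongrightarrow> G a"
      unfolding G_def by (rule summable_LIMSEQ[OF gsum[OF that]])
  qed
  have Glower: "(\<Sum>n. \<mu> n * \<bar>a n\<bar>) \<le> norm (G a)" if "a \<in> A" for a
  proof (rule LIMSEQ_le)
    show "(\<lambda>N. \<Sum>n<N. \<mu> n * \<bar>a n\<bar>) \<longlonglongrightarrow> (\<Sum>n. \<mu> n * \<bar>a n\<bar>)"
      by (rule summable_LIMSEQ[OF \<mu>sum[OF that]])
    show "(\<lambda>N. norm (\<Sum>n<N. a n *\<^sub>R g n)) \<longlonglongrightarrow> norm (G a)"
      unfolding G_def by (intro tendsto_norm summable_LIMSEQ gsum that)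
    show "\<exists>N. \<forall>n\<ge>N. (\<Sum>n<n. \<mu> n * \<bar>a n\<bar>) \<le> norm (\<Sum>n<n. a n *\<^sub>R g n)"
      using lower by blast
  qed
  have Gupper: "norm (G a) \<le> K * (\<Sum>n. \<bar>a n\<bar>)" if "a \<in> A" for a
  proof -
    have "norm (G a) \<le> (\<Sum>n. norm (a n *\<^sub>R g n))"
      unfolding G_def using nsum[OF that gK] by (intro summable_norm) simp
    also have "\<dots> \<le> (\<Sum>n. K * \<bar>a n\<bar>)"
      using nsum[OF that gK] that gK
      by (intro suminf_le summable_mult) (auto simp: A_def mult.commute[of K] mult_left_mono)
    finally show ?thesis
      using that by (simp add: A_def suminf_mult)
  qed
  have G\<kappa>: "\<kappa> * (\<Sum>n. \<bar>a n\<bar>) \<le> norm (G a)" if "a \<in> A" for a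
  proof -
    have "\<kappa> * (\<Sum>n. \<bar>a n\<bar>) = (\<Sum>n. \<kappa> * \<bar>a n\<bar>)"
      using that by (simp add: A_def suminf_mult)
    also have "\<dots> \<le> (\<Sum>n. \<mu> n * \<bar>a n\<bar>)"
      using that \<kappa> \<mu>sum by (intro suminf_le) (auto simp: A_def mult_right_mono summable_mult)
    finally show ?thesis
      using Glower[OF that] by simp
  qed
  define S where "S = {t::nat \<Rightarrow> real. (\<forall>n. 0 \<le> t n) \<and> t sums 1}"
  have SA: "S \<subseteq> A"
    by (auto simp: S_def A_def sums_iff)
  have inj: "inj_on G A"
  proof (rule inj_onI)
    fix a b assume ab: "a \<in> A" "b \<in> A" "G a = G b"
    have s: "summable (\<lambda>n. \<bar>a n - b n\<bar>)"
      using diffA[OF ab(1,2)] by (simp add: A_def)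
    have "\<kappa> * (\<Sum>n. \<bar>a n - b n\<bar>) \<le> 0"
      using G\<kappa>[OF diffA[OF ab(1,2)]] Gdiff[OF ab(1,2)] ab(3) by simp
    then have "(\<Sum>n. \<bar>a n - b n\<bar>) \<le> 0"
      using \<kappa>(1) by (simp add: mult_le_0_iff)
    then have "(\<Sum>n. \<bar>a n - b n\<bar>) = 0"
      using suminf_nonneg[OF s] by simp
    then show "a = b"
      using suminf_eq_zero_iff[OF s] by auto
  qed
  define sh where "sh t n = (case n of 0 \<Rightarrow> 0 | Suc m \<Rightarrow> t m)" for t :: "nat \<Rightarrow> real" and n
  have shS: "sh t \<in> S" if "t \<in> S" for t
  proof -
    have "(\<lambda>n. sh t (Suc n)) sums 1"
      using that by (simp add: sh_def S_def)
    then show ?thesis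
      using that by (subst (asm) sums_Suc_iff) (auto simp: S_def sh_def split: nat.split)
  qed
  have Gsh: "G (sh t) = (\<Sum>n. t n *\<^sub>R g (Suc n))" if "t \<in> S" for t
    using suminf_split_head[OF gsum, of "sh t"] shS[OF that] SA
    by (auto simp: G_def sh_def)
  define C where "C = G ` S"
  define T where "T x = G (sh (inv_into S G x))" for x
  have TG: "T (G t) = G (sh t)" if "t \<in> S" for t
    using that inv_into_f_f[OF inj_on_subset[OF inj SA]] by (simp add: T_def)
  show thesis
  proof
    show "C \<subseteq> Y"
      using SA GY by (auto simp: C_def)
    have "(\<lambda>n. if n = 0 then 1 else 0) \<in> S"
      using sums_single[of 0 "\<lambda>_. 1::real"] by (simp add: S_def)
    then show "C \<noteq> {}"
      by (auto simp: C_def)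
    show "bounded C"
      unfolding bounded_iff C_def
    proof (intro exI ballI)
      fix x assume "x \<in> G ` S"
      then obtain t where t: "t \<in> S" "x = G t" by auto
      then have "(\<Sum>n. \<bar>t n\<bar>) = 1"
        by (auto simp: S_def sums_iff)
      then show "norm x \<le> K"
        using Gupper[of t] t SA by auto
    qed
    show "convex C"
      unfolding convex_def C_def
    proof (intro ballI allI impI)
      fix x y and u v :: real
      assume "x \<in> G ` S" "y \<in> G ` S" and uv: "0 \<le> u" "0 \<le> v" "u + v = 1"
      then obtain t s where ts: "t \<in> S" "x = G t" "s \<in> S" "y = G s" by auto
      have "(\<lambda>n. u * t n + v * s n) sums (u * 1 + v * 1)"
        using ts by (intro sums_add sums_mult) (auto simp: S_def)
      then have "(\<lambda>n. u * t n + v * s n) \<in> S"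
        using ts uv by (auto simp: S_def)
      moreover have "(\<lambda>n. u *\<^sub>R (t n *\<^sub>R g n) + v *\<^sub>R (s n *\<^sub>R g n)) sums (u *\<^sub>R G t + v *\<^sub>R G s)"
        unfolding G_def using gsum ts SA
        by (intro sums_add sums_scaleR_right summable_sums) auto
      then have "G (\<lambda>n. u * t n + v * s n) = u *\<^sub>R x + v *\<^sub>R y"
        by (simp add: sums_iff G_def ts scaleR_add_left)
      ultimately show "u *\<^sub>R x + v *\<^sub>R y \<in> G ` S"
        by (intro image_eqI[where f = G]) simp_all
    qed
    show "T \<in> C \<rightarrow> C"
      using TG shS by (auto simp: C_def)
    show "norm (T x - T y) < norm (x - y)" if "x \<in> C" "y \<in> C" "x \<noteq> y" for x y
    proof -
      obtain t s where ts: "t \<in> S" "x = G t" "s \<in> S" "y = G s"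
        using \<open>x \<in> C\<close> \<open>y \<in> C\<close> by (auto simp: C_def)
      define d where "d n = t n - s n" for n
      have d: "d \<in> A"
        unfolding d_def using ts SA by (intro diffA) auto
      have "t \<noteq> s"
        using \<open>x \<noteq> y\<close> ts by auto
      then obtain m where m: "d m \<noteq> 0"
        by (auto simp: d_def fun_eq_iff)
      have s1: "summable (\<lambda>n. \<bar>d n\<bar> * norm (g (Suc n)))"
        by (rule nsum[OF d gK])
      have s2: "summable (\<lambda>n. t n *\<^sub>R g (Suc n))" if "t \<in> S" for t
        using nsum[of t "\<lambda>n. g (Suc n)"] that SA gK
        by (intro summable_norm_cancel[of "\<lambda>n. t n *\<^sub>R g (Suc n)"]) auto
      have "T x - T y = (\<Sum>n. d n *\<^sub>R g (Suc n))"
        using suminf_diff[OF s2[OF ts(1)] s2[OF ts(3)]]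
        by (simp add: ts TG Gsh d_def scaleR_left_diff_distrib)
      then have "norm (T x - T y) \<le> (\<Sum>n. \<bar>d n\<bar> * norm (g (Suc n)))"
        using summable_norm[of "\<lambda>n. d n *\<^sub>R g (Suc n)"] s1 by simp
      \<comment> \<open>All terms of the difference are nonnegative, and a single index with nonzero
        coefficient makes the sum strictly positive.\<close>
      also have "\<dots> < (\<Sum>n. \<mu> n * \<bar>d n\<bar>)"
      proof -
        have "0 < (\<Sum>n. \<mu> n * \<bar>d n\<bar> - \<bar>d n\<bar> * norm (g (Suc n)))"
        proof (rule suminf_pos2[where i = m])
          show "summable (\<lambda>n. \<mu> n * \<bar>d n\<bar> - \<bar>d n\<bar> * norm (g (Suc n)))"
            by (intro summable_diff s1 \<mu>sum d)
          have eq: "\<mu> n * \<bar>d n\<bar> - \<bar>d n\<bar> * norm (g (Suc n)) = \<bar>d n\<bar> * (\<mu> n - norm (g (Suc n)))" for n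
            by (simp add: algebra_simps)
          show "0 \<le> \<mu> n * \<bar>d n\<bar> - \<bar>d n\<bar> * norm (g (Suc n))" for n
            using gap[of n] by (simp add: eq)
          show "0 < \<mu> m * \<bar>d m\<bar> - \<bar>d m\<bar> * norm (g (Suc m))"
            using gap[of m] m by (simp add: eq)
        qed
        then show ?thesis
          using suminf_diff[OF \<mu>sum[OF d] s1] by simp
      qed
      also have "\<dots> \<le> norm (G d)"
        by (rule Glower[OF d])
      also have "G d = x - y"
        unfolding d_def using ts SA by (subst Gdiff) auto
      finally show ?thesis .
    qed
    show "T x \<noteq> x" if "x \<in> C" for x
    proof
      assume "T x = x"
      obtain t where t: "t \<in> S" "x = G t"
        using \<open>x \<in> C\<close> by (auto simp: C_def)
      then have "G (sh t) = G t"
        using \<open>T x = x\<close> TG by simp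
      then have "sh t = t"
        using inj t shS SA by (auto dest!: inj_onD)
      \<comment> \<open>An invariant sequence starts with 0 and repeats each entry at the next
        index, so it vanishes and cannot have sum 1.\<close>
      then have "t n = 0" for n
      proof (induction n)
        case 0
        then show ?case by (metis sh_def nat.case(1))
      next
        case (Suc n)
        then show ?case by (metis sh_def nat.case(2))
      qed
      then have "t = (\<lambda>_. 0)"
        by auto
      then show False
        using t by (simp add: S_def sums_iff)
    qed
    \<comment> \<open>Infinite convex combinations are closed because, by \<open>G\<kappa>\<close>,
      convergence in norm forces l_1 convergence of the coefficients: no weight escapes to infinity,
      and the limit coefficients still sum to 1.\<close>
    show "closed C"
      unfolding closed_sequential_limits
    proof (intro allI impI, elim conjE)
      fix c z assume "\<forall>k. c k \<in> C" and lim: "c \<longlonglongrightarrow> z"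
      then have "\<forall>k. \<exists>t. t \<in> S \<and> c k = G t"
        by (auto simp: C_def)
      then obtain t where t: "\<And>k. t k \<in> S" "\<And>k. c k = G (t k)"
        by metis
      have tA: "t k \<in> A" for k using t SA by auto
      have Cau: "\<exists>K. \<forall>k\<ge>K. \<forall>l\<ge>K. (\<Sum>n. \<bar>t k n - t l n\<bar>) \<le> e" if "e > 0" for e
      proof -
        obtain K where K: "\<And>k l. k \<ge> K \<Longrightarrow> l \<ge> K \<Longrightarrow> norm (c k - c l) < \<kappa> * e"
          using CauchyD[OF LIMSEQ_imp_Cauchy[OF lim], of "\<kappa> * e"] \<kappa>(1) \<open>e > 0\<close>
          by (metis mult_pos_pos)
        have "(\<Sum>n. \<bar>t k n - t l n\<bar>) \<le> e" if "k \<ge> K" "l \<ge> K" for k l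
        proof -
          have "\<kappa> * (\<Sum>n. \<bar>t k n - t l n\<bar>) \<le> \<kappa> * e"
            using G\<kappa>[OF diffA[OF tA[of k] tA[of l]]] Gdiff[OF tA[of k] tA[of l]] K[OF that] t
            by simp
          then show ?thesis using \<kappa>(1) by simp
        qed
        then show ?thesis by blast
      qed
      have part: "(\<Sum>n<N. \<bar>t k n - t l n\<bar>) \<le> (\<Sum>n. \<bar>t k n - t l n\<bar>)" for N k l
        using diffA[OF tA[of k] tA[of l]] by (intro sum_le_suminf) (auto simp: A_def)
      have "Cauchy (\<lambda>k. t k n)" for n
      proof (rule metric_CauchyI)
        fix e :: real assume "e > 0"
        then obtain K where K: "\<And>k l. k \<ge> K \<Longrightarrow> l \<ge> K \<Longrightarrow> (\<Sum>n. \<bar>t k n - t l n\<bar>) \<le> e / 2"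
          using Cau[of "e/2"] by auto
        have "dist (t k n) (t l n) < e" if "k \<ge> K" "l \<ge> K" for k l
        proof -
          have "\<bar>t k n - t l n\<bar> \<le> (\<Sum>n<Suc n. \<bar>t k n - t l n\<bar>)"
            by (simp add: sum_nonneg)
          also have "\<dots> \<le> e / 2"
            using part[of k l "Suc n"] K[OF that] by linarith
          finally show ?thesis
            using \<open>e > 0\<close> by (simp add: dist_real_def)
        qed
        then show "\<exists>K. \<forall>k\<ge>K. \<forall>l\<ge>K. dist (t k n) (t l n) < e"
          by blast
      qed
      then have "\<forall>n. \<exists>l. (\<lambda>k. t k n) \<longlonglongrightarrow> l"
        using Cauchy_convergent convergent_def by blast
      then obtain s where s: "\<And>n. (\<lambda>k. t k n) \<longlonglongrightarrow> s n"
        by metis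
      \<comment> \<open>Completeness of l_1: the Cauchy estimate holds for each partial sum, passes
        to the coordinatewise limit there, and is then summed.\<close>
      have close: "\<exists>K. \<forall>k\<ge>K. (\<lambda>n. t k n - s n) \<in> A \<and> (\<Sum>n. \<bar>t k n - s n\<bar>) \<le> e" if "e > 0" for e
      proof -
        obtain K where K: "\<And>k l. k \<ge> K \<Longrightarrow> l \<ge> K \<Longrightarrow> (\<Sum>n. \<bar>t k n - t l n\<bar>) \<le> e"
          using Cau[OF \<open>e > 0\<close>] by auto
        have "(\<lambda>n. t k n - s n) \<in> A \<and> (\<Sum>n. \<bar>t k n - s n\<bar>) \<le> e" if "k \<ge> K" for k
        proof -
          have b: "(\<Sum>n<N. \<bar>t k n - s n\<bar>) \<le> e" for N
          proof (rule LIMSEQ_le_const2)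
            show "(\<lambda>l. \<Sum>n<N. \<bar>t k n - t l n\<bar>) \<longlonglongrightarrow> (\<Sum>n<N. \<bar>t k n - s n\<bar>)"
              by (intro tendsto_intros s)
            show "\<exists>K. \<forall>l\<ge>K. (\<Sum>n<N. \<bar>t k n - t l n\<bar>) \<le> e"
              using part[of k _ N] K[OF that] by (meson order_trans)
          qed
          then have "summable (\<lambda>n. \<bar>t k n - s n\<bar>)"
            by (intro summableI_nonneg_bounded[where x = e]) auto
          then show ?thesis
            using b by (auto simp: A_def intro!: suminf_le_const)
        qed
        then show ?thesis by blast
      qed
      obtain k0 where k0: "(\<lambda>n. t k0 n - s n) \<in> A"
        using close[of 1] by auto
      have sA: "s \<in> A"
        using diffA[OF tA[of k0] k0] by simp
      then have ssum: "summable s"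
        by (auto simp: A_def intro: summable_rabs_cancel)
      have sumd: "\<bar>1 - suminf s\<bar> \<le> (\<Sum>n. \<bar>t k n - s n\<bar>)" for k
      proof -
        have "t k sums 1" using t by (simp add: S_def)
        then have "(\<lambda>n. t k n - s n) sums (1 - suminf s)"
          by (intro sums_diff summable_sums ssum)
        then show ?thesis
          using summable_rabs[of "\<lambda>n. t k n - s n"] diffA[OF tA[of k] sA]
          by (simp add: A_def sums_iff)
      qed
      have "\<bar>1 - suminf s\<bar> \<le> 0 + e" if "e > 0" for e
        using close[OF that] sumd by (metis add_0 order_refl order_trans)
      then have "suminf s = 1"
        using field_le_epsilon[of "\<bar>1 - suminf s\<bar>" 0] by simp
      moreover have "0 \<le> s n" for n
        using t by (intro LIMSEQ_le_const[OF s]) (auto simp: S_def)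
      ultimately have "s \<in> S"
        using ssum by (simp add: S_def sums_iff)
      have "c \<longlonglongrightarrow> G s"
      proof (rule metric_LIMSEQ_I)
        fix e :: real assume "e > 0"
        define e' where "e' = e / (2 * (K + 1))"
        have "e' > 0" and e': "K * e' < e"
          using \<open>0 \<le> K\<close> \<open>e > 0\<close> by (auto simp: e'_def field_simps add_nonneg_pos)
        obtain k1 where k1: "\<And>k. k \<ge> k1 \<Longrightarrow> (\<Sum>n. \<bar>t k n - s n\<bar>) \<le> e'"
          using close[OF \<open>e' > 0\<close>] by auto
        have "dist (c k) (G s) < e" if "k \<ge> k1" for k
        proof -
          have "norm (c k - G s) \<le> K * (\<Sum>n. \<bar>t k n - s n\<bar>)"
            using Gupper[OF diffA[OF tA[of k] sA]] Gdiff[OF tA[of k] sA] t by simp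
          also have "\<dots> \<le> K * e'"
            using k1[OF that] \<open>0 \<le> K\<close> by (rule mult_left_mono)
          finally show ?thesis using e' by (simp add: dist_norm)
        qed
        then show "\<exists>k1. \<forall>k\<ge>k1. dist (c k) (G s) < e" by blast
      qed
      then have "z = G s"
        using lim LIMSEQ_unique by blast
      then show "z \<in> C"
        using \<open>s \<in> S\<close> by (simp add: C_def)
    qed
  qed
qed

section \<open>Non-reflexive subspaces\<close>

lemma nonreflexive_l1_contraction:
  fixes Y :: "'k::{real_normed_field, euclidean_space} l1 set"
  assumes Y: "l1.subspace Y" "closed Y" and nr: "\<not> reflexive_l1 Y"
  obtains C T where "C \<subseteq> Y" "C \<noteq> {}" "closed C" "bounded C" "convex C" "T \<in> C \<rightarrow> C"
    "contractive_on C T" "\<And>x. x \<in> C \<Longrightarrow> T x \<noteq> x"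
proof -
  interpret finite_measure leb01 by (rule finite_measure_leb01)
  \<comment> \<open>Y as a set of functions instead of classes, so that the results on concentration
    apply.\<close>
  define F where "F = {f. integrable leb01 f \<and> abs_l1 f \<in> Y}"
  obtain e0 where e0: "e0 > 0" "\<And>m. m \<ge> 0 \<Longrightarrow> \<exists>y\<in>Y. norm y \<le> 1 \<and> e0 < tail_integral m (rep_l1 y)"
    using reflexive_l1_of_uniformly_integrable[OF Y] nr by (meson not_le)
  have add: "(\<lambda>x. f x + g x) \<in> F" if "f \<in> F" "g \<in> F" for f g
    using that l1.subspace_add[OF Y(1), of "abs_l1 f" "abs_l1 g"]
    by (simp add: F_def plus_abs_l1)
  have scale: "(\<lambda>x. c *\<^sub>R f x) \<in> F" if "f \<in> F" for c f
    using that subspace_scale[OF subspace_l1[OF Y(1)], of "abs_l1 f" c]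
    by (simp add: F_def scaleR_abs_l1)
  have int: "integrable leb01 f" if "f \<in> F" for f
    using that by (simp add: F_def)
  have tails: "\<exists>f\<in>F. (\<integral>x. norm (f x) \<partial>leb01) \<le> 1 \<and>
      e0 < norm_on leb01 {x \<in> space leb01. real m < norm (f x)} f" for m
  proof -
    obtain y where y: "y \<in> Y" "norm y \<le> 1" "e0 < tail_integral (real m) (rep_l1 y)"
      using e0(2)[of "real m"] by auto
    have "tail_integral (real m) (rep_l1 y)
        = norm_on leb01 {x \<in> space leb01. real m < norm (rep_l1 y x)} (rep_l1 y)"
      unfolding tail_integral_def norm_on_def
      by (intro Bochner_Integration.integral_cong) (auto simp: indicator_def)
    then show ?thesis
      using y norm_abs_l1[OF integrable_rep_l1, of y] integrable_rep_l1[of y]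
      by (intro bexI[of _ "rep_l1 y"]) (auto simp: F_def abs_rep_l1)
  qed
  \<comment> \<open>The loss \<open>l n * e n\<close> is 1 / (2 (n + 1) (n + 2)), exactly half of
    the drop \<open>l n - l (Suc n)\<close> of the weights defined below; this gives
    \<open>l (Suc n) < \<mu> n\<close>.\<close>
  define e :: "nat \<Rightarrow> real" where "e n = 1 / (2 * (real n + 2)\<^sup>2)" for n
  obtain f where f: "\<And>n. f n \<in> F" "\<And>n. (\<integral>x. norm (f n x) \<partial>leb01) = 1"
    and lower: "\<And>a N. (\<Sum>n<N. (1 - e n) * \<bar>a n\<bar>) \<le> (\<integral>x. norm (\<Sum>n<N. a n *\<^sub>R f n x) \<partial>leb01)"
  proof (rule exists_asymptotically_isometric_l1[OF int, of F e])
    show "\<exists>f\<in>F. \<exists>E\<in>sets leb01. measure leb01 E \<le> \<eta> \<and> (\<integral>x. norm (f x) \<partial>leb01) = 1 \<and>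
        norm_on leb01 (space leb01 - E) f \<le> \<epsilon>" if "\<epsilon> > 0" "\<eta> > 0" for \<epsilon> \<eta>
      using exists_concentrated[of F, OF add scale int e0(1) tails that] by metis
  qed (auto simp: e_def)
  have fi: "integrable leb01 (f n)" and fY: "abs_l1 (f n) \<in> Y" for n
    using f(1)[of n] by (auto simp: F_def)
  \<comment> \<open>Weights that decrease strictly to 1: the strict decrease makes the shift
    contractive, and the positive limit keeps the copy of l_1 from degenerating.\<close>
  define l :: "nat \<Rightarrow> real" where "l n = (real n + 2) / (real n + 1)" for n
  define g where "g n = l n *\<^sub>R abs_l1 (f n)" for n
  define \<mu> where "\<mu> n = l n * (1 - e n)" for n
  have l: "l n > 0" for n by (simp add: l_def)
  have ng: "norm (g n) = l n" for n
    using l[of n] by (simp add: g_def norm_abs_l1 fi f(2))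
  have gap: "l (Suc n) < \<mu> n" for n
  proof -
    have eq: "\<mu> n - l (Suc n) = 1 / (2 * (real n + 1) * (real n + 2))"
      by (simp add: \<mu>_def l_def e_def divide_simps power2_eq_square) (simp add: algebra_simps)
    have "0 < \<mu> n - l (Suc n)"
      unfolding eq by (intro divide_pos_pos mult_pos_pos) auto
    then show ?thesis by simp
  qed
  obtain C T where CT: "C \<subseteq> Y" "C \<noteq> {}" "closed C" "bounded C" "convex C" "T \<in> C \<rightarrow> C"
    "\<And>x y. x \<in> C \<Longrightarrow> y \<in> C \<Longrightarrow> x \<noteq> y \<Longrightarrow> norm (T x - T y) < norm (x - y)"
    "\<And>x. x \<in> C \<Longrightarrow> T x \<noteq> x"
  proof (rule fixed_point_free_contraction[of Y g 1 \<mu>])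
    show "subspace Y" by (rule subspace_l1[OF Y(1)])
    show "closed Y" by (rule Y(2))
    show "g n \<in> Y" for n
      unfolding g_def by (rule subspace_scale[OF subspace_l1[OF Y(1)] fY])
    \<comment> \<open>The uniform lower bound is \<kappa> = 1, since \<open>\<mu> n\<close> exceeds
      the next weight.\<close>
    have "1 \<le> l (Suc n)" for n by (simp add: l_def)
    then show "1 \<le> \<mu> n" for n
      using gap[of n] by (meson less_eq_real_def order_trans)
    show "norm (g (Suc n)) < \<mu> n" for n
      using gap[of n] by (simp add: ng)
    show "(\<Sum>n<N. \<mu> n * \<bar>a n\<bar>) \<le> norm (\<Sum>n<N. a n *\<^sub>R g n)" for a N
    proof -
      have "(\<Sum>n<N. \<mu> n * \<bar>a n\<bar>) = (\<Sum>n<N. (1 - e n) * \<bar>a n * l n\<bar>)"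
        using l by (intro sum.cong) (auto simp: \<mu>_def abs_mult less_imp_le)
      also have "\<dots> \<le> (\<integral>x. norm (\<Sum>n<N. (a n * l n) *\<^sub>R f n x) \<partial>leb01)"
        by (rule lower)
      also have "\<dots> = norm (abs_l1 (\<lambda>x. \<Sum>n<N. (a n * l n) *\<^sub>R f n x))"
        using fi by (intro norm_abs_l1[symmetric]) auto
      also have "abs_l1 (\<lambda>x. \<Sum>n<N. (a n * l n) *\<^sub>R f n x) = (\<Sum>n<N. a n *\<^sub>R g n)"
        using fi by (simp add: g_def sum_scaleR_abs_l1[symmetric])
      finally show ?thesis .
    qed
  qed auto
  show thesis
  proof (rule that[OF CT(1-6)])
    show "contractive_on C T"
      using CT(7) by (simp add: contractive_on_def)
  qed (use CT(8) in blast)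
qed

lemma contractive_on_imp_nonexpansive_on: "contractive_on C T \<Longrightarrow> nonexpansive_on C T"
  unfolding contractive_on_def nonexpansive_on_def
  by (metis diff_self less_eq_real_def norm_zero order_refl)

theorem theorem5p2:
  fixes Y :: "'k::{real_normed_field, euclidean_space} l1 set"
  assumes "l1.subspace Y" and "closed Y" and "\<not> reflexive_l1 Y"
  shows "(\<exists>C T. C \<subseteq> Y \<and> C \<noteq> {} \<and> closed C \<and> bounded C \<and> convex C \<and>
            T \<in> C \<rightarrow> C \<and> nonexpansive_on C T \<and> \<not> (\<exists>x\<in>C. T x = x)) \<and>
         (\<exists>C T. C \<subseteq> Y \<and> C \<noteq> {} \<and> closed C \<and> bounded C \<and> convex C \<and>
            T \<in> C \<rightarrow> C \<and> contractive_on C T \<and> \<not> (\<exists>x\<in>C. T x = x))"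
proof -
  obtain C T where "C \<subseteq> Y" "C \<noteq> {}" "closed C" "bounded C" "convex C" "T \<in> C \<rightarrow> C"
    "contractive_on C T" "\<And>x. x \<in> C \<Longrightarrow> T x \<noteq> x"
    using nonreflexive_l1_contraction[OF assms] by blast
  then show ?thesis
    using contractive_on_imp_nonexpansive_on by blast
qed

end
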